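(* Let $G$ be any graph, and let \[t = \begin{cases} 2 & \text{if } v_\mathrm{odd}(G) = 4 \text{ and } \Delta(G) \geq 3, \\ \left\lceil\frac{v_\mathrm{odd}(G)}{4}\right \rceil & \text{otherwise,}\end{cases}\] and $d = 2\left \lceil \frac{\Delta(G)}{2} \right \rceil-2t$. Then \[p_{2,\mathrm{iso}}(G) \leq \begin{cases} 2t + \mathrm{la}(d) & \text{if } d \geq 0, \\ \frac{v_{\mathrm{odd}}(G)}{2} & \text{if } d < 0. \end{cases}\]
   Context: All graphs are finite and simple. A path odd-cover of a graph $G=(V,E)$ is a collection of paths in the complete graph on $V$ whose edge sets have symmetric difference equal to $E$; $p_2(G)$ is its minimum cardinality. $p_{2,\mathrm{iso}}(G)$ is the minimum of $p_2(H)$ over all graphs $H$ obtained from $G$ by adding isolated vertices. $\Delta(G)$ is the maximum degree and $v_{\mathrm{odd}}(G)$ the number of odd-degree vertices. $\mathrm{la}(H)$ is the linear arboricity of $H$ (minimum number of edge-disjoint linear forests, i.e. graphs whose components are paths, whose union is $E(H)$), and $\mathrm{la}(d)$ denotes the maximum of $\mathrm{la}(H)$ over all graphs $H$ with maximum degree $d$. *)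

theory Defs
  imports Complex_Main
begin

record 'v ugraph =
  verts :: "'v set"
  edges :: "'v set set"

definition simple_graph :: "'v ugraph \<Rightarrow> bool" where
  "simple_graph G \<longleftrightarrow> finite (verts G) \<and> (\<forall>e\<in>edges G. e \<subseteq> verts G \<and> card e = 2)"

definition degree :: "'v ugraph \<Rightarrow> 'v \<Rightarrow> nat" where
  "degree G v = card {e \<in> edges G. v \<in> e}"

text \<open>The inserted 0 only matters for the graph without vertices, whose maximum degree is 0.\<close>

definition max_degree :: "'v ugraph \<Rightarrow> nat" where
  "max_degree G = Max (insert 0 (degree G ` verts G))"

definition v_odd :: "'v ugraph \<Rightarrow> nat" where
  "v_odd G = card {v \<in> verts G. odd (degree G v)}"

text \<open>A path is given by its sequence of vertices; paths with a single vertex (and no edge)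
  are allowed.\<close>

definition path_on :: "'v set \<Rightarrow> 'v list \<Rightarrow> bool" where
  "path_on V xs \<longleftrightarrow> xs \<noteq> [] \<and> distinct xs \<and> set xs \<subseteq> V"

definition path_edges :: "'v list \<Rightarrow> 'v set set" where
  "path_edges xs = {{xs ! i, xs ! Suc i} | i. Suc i < length xs}"

text \<open>The paths live in the complete graph on the vertex set: consecutive vertices need not be
  adjacent in \<open>G\<close>.\<close>

definition path_odd_cover :: "'v ugraph \<Rightarrow> 'v list list \<Rightarrow> bool" where
  "path_odd_cover G ps \<longleftrightarrow>
     (\<forall>p\<in>set ps. path_on (verts G) p) \<and>
     foldr sym_diff (map path_edges ps) {} = edges G"

definition p2 :: "'v ugraph \<Rightarrow> nat" where
  "p2 G = (LEAST k. \<exists>ps. path_odd_cover G ps \<and> length ps = k)"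

text \<open>The new vertices are taken from the right summand of a disjoint sum, so that they are
  available even if the vertex type of \<open>G\<close> is finite.\<close>

definition add_isolated :: "nat \<Rightarrow> 'v ugraph \<Rightarrow> ('v + nat) ugraph" where
  "add_isolated m G =
     \<lparr>verts = Inl ` verts G \<union> Inr ` {..<m}, edges = (\<lambda>e. Inl ` e) ` edges G\<rparr>"

definition p2_iso :: "'v ugraph \<Rightarrow> nat" where
  "p2_iso G = (LEAST k. \<exists>m. k = p2 (add_isolated m G))"

definition reachable :: "'v ugraph \<Rightarrow> ('v \<times> 'v) set" where
  "reachable G = {(u, v). {u, v} \<in> edges G}\<^sup>* \<inter> verts G \<times> verts G"

definition induced :: "'v ugraph \<Rightarrow> 'v set \<Rightarrow> 'v ugraph" where
  "induced G C = \<lparr>verts = C, edges = {e \<in> edges G. e \<subseteq> C}\<rparr>"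

definition components :: "'v ugraph \<Rightarrow> 'v ugraph set" where
  "components G = induced G ` (verts G // reachable G)"

definition is_path_graph :: "'v ugraph \<Rightarrow> bool" where
  "is_path_graph P \<longleftrightarrow>
     (\<exists>xs. path_on (verts P) xs \<and> verts P = set xs \<and> edges P = path_edges xs)"

definition linear_forest :: "'v ugraph \<Rightarrow> bool" where
  "linear_forest F \<longleftrightarrow> simple_graph F \<and> (\<forall>P\<in>components F. is_path_graph P)"

definition linear_forest_decomposition :: "'v ugraph \<Rightarrow> 'v ugraph list \<Rightarrow> bool" where
  "linear_forest_decomposition H Fs \<longleftrightarrow>
     (\<forall>F\<in>set Fs. linear_forest F \<and> verts F \<subseteq> verts H) \<and>
     (\<forall>i<length Fs. \<forall>j<length Fs. i \<noteq> j \<longrightarrow> edges (Fs ! i) \<inter> edges (Fs ! j) = {}) \<and>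
     (\<Union>F\<in>set Fs. edges F) = edges H"

definition la :: "'v ugraph \<Rightarrow> nat" where
  "la H = (LEAST k. \<exists>Fs. linear_forest_decomposition H Fs \<and> length Fs = k)"

text \<open>Every finite graph has an isomorphic copy with vertices in \<^typ>\<open>nat\<close>, so this is the
  maximum over all graphs. The set is nonempty (it contains \<open>la\<close> of a star with \<open>d\<close> leaves)
  and finite, since a proper edge colouring with at most \<open>2 * d\<close> colours decomposes a graph of
  maximum degree \<open>d\<close> into matchings, which are linear forests.\<close>

definition la_max :: "nat \<Rightarrow> nat" where
  "la_max d = Max {la H | H :: nat ugraph. simple_graph H \<and> max_degree H = d}"

end

theory Submission
  imports Defs "HOL-Library.Multiset"
begin

text \<open>Let \<open>s = \<lceil>\<Delta>/2\<rceil>\<close>. An orientation with in- and out-degrees at most \<open>s\<close> and Koenig's theorem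
  decompose \<open>G\<close> into \<open>s\<close> graphs of maximum degree at most 2. Of these, \<open>t\<close> are split into two
  linear forests each, and every such forest is assigned two odd vertices of \<open>G\<close> (or new vertices,
  once the odd ones are used up) as future path ends; the union of the others decomposes into
  \<open>la(d)\<close> linear forests, whose future path ends are new vertices. If \<open>d < 0\<close>, all \<open>s\<close> graphs are
  split and the remaining pairs of odd vertices are assigned to empty forests.
  Every linear forest is completed to a path with the assigned ends by edges through new vertices.
  An unassigned end of one forest is an end of another forest too, so a link \<open>u - x - w\<close> in one
  forest can be cancelled by adding \<open>ux\<close> and \<open>xw\<close> to two further forests, where these edges
  only move an end; the total number of components decreases. If this is impossible, two forests
  share an end pair that can be linked in both. The added edges cancel in the symmetric
  difference.\<close>


section \<open>Path systems\<close>

text \<open>What drives the argument is a parity invariant. In any decomposition of the graph into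
  linear forests, a vertex is an end of an odd number of forests exactly when its degree is odd, and
  the assigned ends are chosen with the same parities. Linking the two assigned ends of every forest
  to one common new vertex \<open>\<omega>\<close> therefore makes each vertex an end of evenly many
  forests, and the task becomes: complete all forests to cycles so that the added edges cancel.
  Deleting \<open>\<omega>\<close> afterwards opens the cycles into the desired paths. The obstacle
  is the linking: an assigned end must not be an inner vertex of its forest, and the two assigned
  ends must not be the ends of one path. Hence two-factors are split into matchings, except that
  each odd cycle needs one inner vertex. Four assigned ends per two-factor are possible because four
  vertices cannot contain two disjoint odd cycles. Forests whose ends are all new cancel these ends
  among themselves, so there must not be exactly one of them; this is why the bound
  \<open>2 \<le> la_max d\<close> is proved for \<open>d \<ge> 2\<close>.\<close>

lemma path_edges_Nil [simp]: "path_edges [] = {}"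
  and path_edges_single [simp]: "path_edges [x] = {}"
  by (auto simp: path_edges_def)

lemma path_edges_Cons2 [simp]: "path_edges (x # y # zs) = insert {x, y} (path_edges (y # zs))"
proof -
  have "e \<in> path_edges (x # y # zs) \<longleftrightarrow> e \<in> insert {x, y} (path_edges (y # zs))" for e
  proof
    assume "e \<in> path_edges (x # y # zs)"
    then obtain i where i: "Suc i < length (x # y # zs)"
      "e = {(x # y # zs) ! i, (x # y # zs) ! Suc i}"
      by (auto simp: path_edges_def)
    then show "e \<in> insert {x, y} (path_edges (y # zs))"
      by (cases i) (auto simp: path_edges_def)
  next
    assume "e \<in> insert {x, y} (path_edges (y # zs))"
    then consider "e = {x, y}" | i where "Suc i < length (y # zs)"
      "e = {(y # zs) ! i, (y # zs) ! Suc i}"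
      by (auto simp: path_edges_def)
    then show "e \<in> path_edges (x # y # zs)"
    proof cases
      case 1
      then show ?thesis by (auto simp: path_edges_def intro!: exI[of _ 0])
    next
      case 2
      then show ?thesis
        by (auto simp: path_edges_def intro!: exI[of _ "Suc i"])
    qed
  qed
  then show ?thesis by blast
qed

lemma path_edges_append:
  assumes "xs \<noteq> []" "ys \<noteq> []"
  shows "path_edges (xs @ ys) = insert {last xs, hd ys} (path_edges xs \<union> path_edges ys)"
  using assms
proof (induction xs)
  case (Cons x xs)
  show ?case
  proof (cases xs)
    case Nil
    then show ?thesis using Cons.prems by (cases ys) auto
  next
    case (Cons x' xs')
    then show ?thesis using Cons.IH Cons.prems Cons by auto
  qed
qed simp

lemma path_edges_rev [simp]: "path_edges (rev xs) = path_edges xs"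
proof (induction xs)
  case (Cons x xs)
  show ?case
  proof (cases xs)
    case (Cons y ys)
    then have "path_edges (rev (x # xs)) = insert {last (rev xs), x} (path_edges (rev xs))"
      using path_edges_append[of "rev xs" "[x]"] by simp
    then show ?thesis
      using Cons.IH Cons by (auto simp: insert_commute)
  qed simp
qed simp

lemma path_edges_subset: "e \<in> path_edges xs \<Longrightarrow> e \<subseteq> set xs"
  by (auto simp: path_edges_def)

lemma path_edges_card: "distinct xs \<Longrightarrow> e \<in> path_edges xs \<Longrightarrow> card e = 2"
  by (auto simp: path_edges_def nth_eq_iff_index_eq)

lemma finite_path_edges [simp]: "finite (path_edges xs)"
  by (induction xs rule: induct_list012) auto

lemma path_edges_cover: "2 \<le> length xs \<Longrightarrow> v \<in> set xs \<Longrightarrow> \<exists>e\<in>path_edges xs. v \<in> e"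
proof (induction xs rule: induct_list012)
  case (3 x y zs)
  then show ?case by (cases zs) auto
qed auto

lemma path_edges_nonempty: "e \<in> path_edges xs \<Longrightarrow> e \<noteq> {}"
  by (auto simp: path_edges_def)

text \<open>This is a linear forest without its isolated vertices, each path being listed in one of
  its two directions. Requiring an edge in every path makes the vertex set recoverable from the edge
  set and gives ends degree 1, inner vertices degree 2.\<close>

definition psys :: "'v list set \<Rightarrow> bool" where
  "psys P \<longleftrightarrow> finite P \<and> (\<forall>p\<in>P. distinct p \<and> 2 \<le> length p) \<and>
     (\<forall>p\<in>P. \<forall>r\<in>P. p \<noteq> r \<longrightarrow> set p \<inter> set r = {})"

definition pedges :: "'v list set \<Rightarrow> 'v set set" where
  "pedges P = \<Union>(path_edges ` P)"

definition pverts :: "'v list set \<Rightarrow> 'v set" where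
  "pverts P = \<Union>(set ` P)"

definition pends :: "'v list set \<Rightarrow> 'v set" where
  "pends P = (\<Union>p\<in>P. {hd p, last p})"

definition pinner :: "'v list set \<Rightarrow> 'v set" where
  "pinner P = pverts P - pends P"

text \<open>Mates are the pair of ends that must not be linked: a link would close a cycle, whereas
  linking two other ends merges two paths.\<close>

definition mates :: "'v list set \<Rightarrow> 'v \<Rightarrow> 'v \<Rightarrow> bool" where
  "mates P u w \<longleftrightarrow> (\<exists>p\<in>P. (u = hd p \<and> w = last p) \<or> (w = hd p \<and> u = last p))"

lemma psysD:
  assumes "psys P"
  shows "finite P" "p \<in> P \<Longrightarrow> distinct p" "p \<in> P \<Longrightarrow> 2 \<le> length p"
    "p \<in> P \<Longrightarrow> p \<noteq> []" "p \<in> P \<Longrightarrow> hd p \<in> set p" "p \<in> P \<Longrightarrow> last p \<in> set p"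
    "p \<in> P \<Longrightarrow> hd p \<noteq> last p"
    "p \<in> P \<Longrightarrow> r \<in> P \<Longrightarrow> x \<in> set p \<Longrightarrow> x \<in> set r \<Longrightarrow> p = r"
proof -
  show "finite P" "p \<in> P \<Longrightarrow> distinct p" and len: "p \<in> P \<Longrightarrow> 2 \<le> length p"
    "p \<in> P \<Longrightarrow> r \<in> P \<Longrightarrow> x \<in> set p \<Longrightarrow> x \<in> set r \<Longrightarrow> p = r"
    using assms unfolding psys_def by blast+
  show ne: "p \<in> P \<Longrightarrow> p \<noteq> []" using len by force
  then show "p \<in> P \<Longrightarrow> hd p \<in> set p" "p \<in> P \<Longrightarrow> last p \<in> set p" by auto
  show "hd p \<noteq> last p" if "p \<in> P"
  proof -
    have "distinct p" "2 \<le> length p" using assms that unfolding psys_def by blast+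
    then show ?thesis by (cases p; cases "tl p") auto
  qed
qed

lemma psys_empty [simp]: "psys {}"
  by (simp add: psys_def)

lemma pedges_empty [simp]: "pedges {} = {}" and pverts_empty [simp]: "pverts {} = {}"
  and pends_empty [simp]: "pends {} = {}" and pinner_empty [simp]: "pinner {} = {}"
  and mates_empty [simp]: "\<not> mates {} u w"
  by (auto simp: pedges_def pverts_def pends_def pinner_def mates_def)

lemma pedges_insert [simp]: "pedges (insert p P) = path_edges p \<union> pedges P"
  and pverts_insert [simp]: "pverts (insert p P) = set p \<union> pverts P"
  and pends_insert [simp]: "pends (insert p P) = {hd p, last p} \<union> pends P"
  by (auto simp: pedges_def pverts_def pends_def)

lemma mates_insert [simp]:
  "mates (insert p P) u w \<longleftrightarrow>
     (u = hd p \<and> w = last p) \<or> (w = hd p \<and> u = last p) \<or> mates P u w"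
  by (auto simp: mates_def)

lemma mates_sym: "mates P u w \<longleftrightarrow> mates P w u"
  by (auto simp: mates_def)

lemma psys_insert:
  assumes "p \<notin> P"
  shows "psys (insert p P) \<longleftrightarrow> psys P \<and> distinct p \<and> 2 \<le> length p \<and> set p \<inter> pverts P = {}"
proof -
  have "set p \<inter> pverts P = {} \<longleftrightarrow> (\<forall>r\<in>P. set p \<inter> set r = {})"
    by (auto simp: pverts_def)
  moreover have "p \<noteq> r" if "r \<in> P" for r using assms that by blast
  ultimately show ?thesis unfolding psys_def by (simp add: Int_commute) blast
qed

lemma psys_insertI:
  assumes "psys P" "distinct p" "2 \<le> length p" "set p \<inter> pverts P = {}"
  shows "psys (insert p P)"
  using assms psys_insert[of p P] by (cases "p \<in> P") (simp_all add: insert_absorb)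

lemma psys_subset: "psys P \<Longrightarrow> Q \<subseteq> P \<Longrightarrow> psys Q"
  unfolding psys_def using finite_subset by blast

lemma finite_pedges: "psys P \<Longrightarrow> finite (pedges P)"
  by (auto simp: psys_def pedges_def)

lemma finite_pverts: "psys P \<Longrightarrow> finite (pverts P)"
  by (auto simp: psys_def pverts_def)

lemma pends_subset: "psys P \<Longrightarrow> pends P \<subseteq> pverts P"
  using psysD(5,6) unfolding pends_def pverts_def by fast

lemma finite_pends: "psys P \<Longrightarrow> finite (pends P)"
  using finite_pverts pends_subset finite_subset by blast

lemma pedges_verts: "e \<in> pedges P \<Longrightarrow> e \<subseteq> pverts P"
  using path_edges_subset unfolding pedges_def pverts_def by blast

lemma pedges_card: "psys P \<Longrightarrow> e \<in> pedges P \<Longrightarrow> card e = 2"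
  using path_edges_card psysD(2) unfolding pedges_def by blast

lemma pverts_pedges: "psys P \<Longrightarrow> pverts P = \<Union>(pedges P)"
proof
  assume P: "psys P"
  show "pverts P \<subseteq> \<Union>(pedges P)"
  proof
    fix v assume "v \<in> pverts P"
    then obtain p where p: "p \<in> P" "v \<in> set p" by (auto simp: pverts_def)
    then show "v \<in> \<Union>(pedges P)"
      using path_edges_cover[OF psysD(3)[OF P p(1)] p(2)] by (auto simp: pedges_def)
  qed
  show "\<Union>(pedges P) \<subseteq> pverts P" using pedges_verts by blast
qed

lemma mates_pends: "mates P u w \<Longrightarrow> u \<in> pends P \<and> w \<in> pends P"
  by (auto simp: mates_def pends_def)

lemma pends_mate:
  assumes "psys P" "u \<in> pends P"
  obtains w where "mates P u w" "w \<noteq> u" "w \<in> pends P"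
  using assms psysD(7)[OF assms(1)] unfolding mates_def pends_def by auto metis+

lemma mates_unique:
  assumes "psys P" "mates P u w" "mates P u w'"
  shows "w = w'"
proof -
  obtain p where p: "p \<in> P" "(u = hd p \<and> w = last p) \<or> (w = hd p \<and> u = last p)"
    using assms by (auto simp: mates_def)
  obtain r where r: "r \<in> P" "(u = hd r \<and> w' = last r) \<or> (w' = hd r \<and> u = last r)"
    using assms by (auto simp: mates_def)
  have "p = r" using psysD(5,6,8)[OF assms(1)] p r by metis
  then show ?thesis using p r psysD(7)[OF assms(1)] by metis
qed

text \<open>A path may be replaced by its reversal, so a given end can be taken to be the last vertex.\<close>

lemma psys_orient:
  assumes "psys P" "u \<in> pends P"
  obtains p Q where "psys (insert p Q)" "p \<notin> Q" "last p = u" "card (insert p Q) = card P"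
    "pedges (insert p Q) = pedges P" "pverts (insert p Q) = pverts P"
    "pends (insert p Q) = pends P" "mates (insert p Q) = mates P"
    "Q \<subseteq> P" "psys Q"
proof -
  obtain r where r: "r \<in> P" "u = hd r \<or> u = last r" using assms(2) by (auto simp: pends_def)
  define Q where "Q = P - {r}"
  have P: "P = insert r Q" "r \<notin> Q" using r by (auto simp: Q_def)
  have finQ: "finite Q" using psysD(1)[OF assms(1)] by (simp add: Q_def)
  show thesis
  proof (cases "u = last r")
    case True
    then show ?thesis using that[of r Q] P assms(1) psys_subset[OF assms(1), of Q] by auto
  next
    case False
    then have u: "u = hd r" using r by simp
    have rr: "distinct r" "2 \<le> length r" "set r \<inter> pverts Q = {}" "psys Q"
      using assms(1) P psys_insert[OF P(2)] by auto
    have rn: "r \<noteq> []" using rr by auto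
    have nQ: "rev r \<notin> Q"
    proof
      assume "rev r \<in> Q"
      then have "set (rev r) \<subseteq> pverts Q" by (auto simp: pverts_def)
      then have "set r = {}" using rr(3) by (metis Int_absorb2 set_rev)
      then show False using rn by auto
    qed
    show ?thesis
    proof (rule that[of "rev r" Q])
      show "psys (insert (rev r) Q)" using rr by (intro psys_insertI) auto
      show "rev r \<notin> Q" by fact
      show "last (rev r) = u" using u rn by (simp add: last_rev)
      show "card (insert (rev r) Q) = card P" using P nQ finQ by simp
      show "pedges (insert (rev r) Q) = pedges P" "pverts (insert (rev r) Q) = pverts P"
        "pends (insert (rev r) Q) = pends P"
        using P rn by (auto simp: hd_rev last_rev)
      show "mates (insert (rev r) Q) = mates P"
        using P rn by (auto simp: hd_rev last_rev fun_eq_iff)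
      show "Q \<subseteq> P" "psys Q" using P rr by blast+
    qed
  qed
qed

section \<open>Adding an edge to a path system\<close>

lemma psys_attach_end:
  assumes P: "psys P" and u: "u \<in> pends P" and x: "x \<notin> pverts P"
  obtains P' where "psys P'" "pedges P' = insert {u, x} (pedges P)"
    "pverts P' = insert x (pverts P)" "pends P' = insert x (pends P - {u})"
    "card P' = card P" "\<And>z. mates P' x z \<longleftrightarrow> mates P u z"
proof -
  obtain p Q where pQ: "psys (insert p Q)" "p \<notin> Q" "last p = u" "card (insert p Q) = card P"
    "pedges (insert p Q) = pedges P" "pverts (insert p Q) = pverts P"
    "pends (insert p Q) = pends P" "mates (insert p Q) = mates P" "psys Q"
    using psys_orient[OF P u] by metis
  have p: "distinct p" "2 \<le> length p" "set p \<inter> pverts Q = {}" "psys Q"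
    using pQ(1) psys_insert[OF pQ(2)] by auto
  have pn: "p \<noteq> []" using p by auto
  have hp: "hd p \<noteq> last p" using psysD(7)[OF pQ(1)] by auto
  have up: "u \<in> set p" "hd p \<in> set p" using pQ(3) pn by auto
  have xs: "x \<notin> set p" "x \<notin> pverts Q" using x pQ(6) by auto
  have eQ: "pends Q \<subseteq> pverts Q" using pends_subset[OF p(4)] .
  have uQ: "u \<notin> pends Q" "hd p \<notin> pends Q" "x \<notin> pends Q" using eQ up p(3) xs by auto
  have nm: "\<not> mates Q u z" "\<not> mates Q x z" "\<not> mates Q z x" for z
    using uQ mates_pends by metis+
  have nQ: "p @ [x] \<notin> Q" using xs by (auto simp: pverts_def)
  show thesis
  proof (rule that[of "insert (p @ [x]) Q"])
    show "psys (insert (p @ [x]) Q)" using p xs by (intro psys_insertI) auto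
    show "pedges (insert (p @ [x]) Q) = insert {u, x} (pedges P)"
      using pQ(3,5) pn by (auto simp: path_edges_append)
    show "pverts (insert (p @ [x]) Q) = insert x (pverts P)" using pQ(6) by auto
    show "pends (insert (p @ [x]) Q) = insert x (pends P - {u})"
      unfolding pQ(7)[symmetric] using pQ(3) pn uQ hp by auto
    show "card (insert (p @ [x]) Q) = card P"
      using pQ(2,4) nQ psysD(1)[OF p(4)] by simp
    show "mates (insert (p @ [x]) Q) x z \<longleftrightarrow> mates P u z" for z
      unfolding pQ(8)[symmetric] using nm pQ(3) pn up xs hp by auto
  qed
qed

lemma psys_new_edge:
  assumes P: "psys P" and u: "u \<notin> pverts P" and x: "x \<notin> pverts P" and ne: "u \<noteq> x"
  shows "psys (insert [u, x] P)" "pedges (insert [u, x] P) = insert {u, x} (pedges P)"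
    "pverts (insert [u, x] P) = insert u (insert x (pverts P))"
    "pends (insert [u, x] P) = insert u (insert x (pends P))"
    "mates (insert [u, x] P) x z \<longleftrightarrow> z = u"
proof -
  show "psys (insert [u, x] P)" using assms by (intro psys_insertI) auto
  have "x \<notin> pends P" using pends_subset[OF P] x by blast
  then have "\<not> mates P x z" using mates_pends by metis
  then show "mates (insert [u, x] P) x z \<longleftrightarrow> z = u" using ne by auto
qed auto

text \<open>Both paths are turned so that \<open>u\<close> and \<open>w\<close> come last, and are
  glued as \<open>p @ rev r\<close>. Since \<open>u\<close> and \<open>w\<close> are not mates, two
  different paths are involved, so the number of paths drops; this drop is the source of progress in
  the cycle completion.\<close>

lemma psys_join:
  assumes P: "psys P" and u: "u \<in> pends P" and w: "w \<in> pends P" and uw: "u \<noteq> w" "\<not> mates P u w"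
  obtains P' where "psys P'" "pedges P' = insert {u, w} (pedges P)"
    "pverts P' = pverts P" "pends P' = pends P - {u, w}" "Suc (card P') = card P"
proof -
  obtain p Q where pQ: "psys (insert p Q)" "p \<notin> Q" "last p = u" "card (insert p Q) = card P"
    "pedges (insert p Q) = pedges P" "pverts (insert p Q) = pverts P"
    "pends (insert p Q) = pends P" "mates (insert p Q) = mates P" "psys Q"
    using psys_orient[OF P u] by metis
  have p: "distinct p" "2 \<le> length p" "set p \<inter> pverts Q = {}" "psys Q"
    using pQ(1) psys_insert[OF pQ(2)] by auto
  have pn: "p \<noteq> []" using p by auto
  have hp: "hd p \<noteq> u" using psysD(7)[OF pQ(1), of p] pQ(3) by auto
  have wh: "w \<noteq> hd p" using uw(2) unfolding pQ(8)[symmetric] using pQ(3) by auto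
  then have wQ: "w \<in> pends Q" using w uw(1) pQ(3) unfolding pQ(7)[symmetric] by auto
  obtain r S where rS: "psys (insert r S)" "r \<notin> S" "last r = w" "card (insert r S) = card Q"
    "pedges (insert r S) = pedges Q" "pverts (insert r S) = pverts Q"
    "pends (insert r S) = pends Q" "psys S" "S \<subseteq> Q"
    using psys_orient[OF p(4) wQ] by metis
  have r: "distinct r" "2 \<le> length r" "set r \<inter> pverts S = {}"
    using rS(1) psys_insert[OF rS(2)] by auto
  have rn: "r \<noteq> []" using r by auto
  have hr: "hd r \<noteq> w" using psysD(7)[OF rS(1), of r] rS(3) by auto
  have eS: "pends S \<subseteq> pverts S" using pends_subset[OF rS(8)] .
  have sub: "pverts S \<subseteq> pverts Q" "set r \<subseteq> pverts Q" using rS(6) by auto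
  have mem: "u \<in> set p" "hd p \<in> set p" "w \<in> set r" "hd r \<in> set r"
    using pQ(3) pn rS(3) rn by auto
  have nS: "u \<notin> pends S" "w \<notin> pends S" "u \<noteq> hd r" "w \<noteq> hd p"
    using mem sub p(3) r(3) eS wh by blast+
  have disj: "set (p @ rev r) \<inter> pverts S = {}" using p(3) r(3) sub by auto
  have nin: "p @ rev r \<notin> S"
  proof
    assume "p @ rev r \<in> S"
    then have "set (p @ rev r) \<subseteq> pverts S" by (auto simp: pverts_def)
    then have "set (p @ rev r) = {}" using disj by (metis Int_absorb2)
    then show False using pn by simp
  qed
  show thesis
  proof (rule that[of "insert (p @ rev r) S"])
    show "psys (insert (p @ rev r) S)"
      using p r disj rS(8) sub by (intro psys_insertI) auto
    show "pedges (insert (p @ rev r) S) = insert {u, w} (pedges P)"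
      using pQ(3,5) rS(3,5) pn rn by (auto simp: path_edges_append hd_rev)
    show "pverts (insert (p @ rev r) S) = pverts P" using pQ(6) rS(6) by auto
    show "pends (insert (p @ rev r) S) = pends P - {u, w}"
      unfolding pQ(7)[symmetric] using rS(7)[symmetric] pQ(3) rS(3) pn rn nS hp hr
      by (auto simp: last_rev)
    show "Suc (card (insert (p @ rev r) S)) = card P"
      using pQ(2,4) rS(2,4) nin psysD(1)[OF p(4)] psysD(1)[OF rS(8)] by simp
  qed
qed

lemma psys_mates_split:
  assumes P: "psys P" and m: "mates P u w"
  obtains p Q where "P = insert p Q" "p \<notin> Q" "psys Q" "distinct p" "2 \<le> length p"
    "set p \<inter> pverts Q = {}" "{hd p, last p} = {u, w}"
proof -
  obtain p where p: "p \<in> P" "{hd p, last p} = {u, w}" using m by (auto simp: mates_def)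
  have "P = insert p (P - {p})" "p \<notin> P - {p}" using p by auto
  then show thesis using that[of p "P - {p}"] P p psys_insert[of p "P - {p}"] by auto
qed

lemma card_pends: "psys P \<Longrightarrow> card (pends P) = 2 * card P"
proof -
  assume "psys P"
  then have "finite P" by (rule psysD)
  from this \<open>psys P\<close> show ?thesis
  proof (induction P)
    case (insert p P)
    have p: "psys P" "distinct p" "2 \<le> length p" "set p \<inter> pverts P = {}"
      using insert.prems insert.hyps(2) psys_insert by auto
    have "hd p \<noteq> last p" using psysD(7)[OF insert.prems] by auto
    moreover have "{hd p, last p} \<inter> pends P = {}"
      using pends_subset[OF p(1)] p(3,4) psysD(5,6)[OF insert.prems, of p] by auto
    ultimately have "card ({hd p, last p} \<union> pends P) = 2 + card (pends P)"
      using finite_pends[OF p(1)] by (subst card_Un_disjoint) auto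
    then show ?case using insert p by simp
  qed simp
qed

section \<open>Degrees and their parity in a path system\<close>

definition edeg :: "'v set set \<Rightarrow> 'v \<Rightarrow> nat" where
  "edeg E v = card {e \<in> E. v \<in> e}"

lemma edeg_insert:
  "finite E \<Longrightarrow> e \<notin> E \<Longrightarrow> edeg (insert e E) v = edeg E v + (if v \<in> e then 1 else 0)"
proof -
  assume a: "finite E" "e \<notin> E"
  have "{e' \<in> insert e E. v \<in> e'} =
    (if v \<in> e then insert e {e' \<in> E. v \<in> e'} else {e' \<in> E. v \<in> e'})" by auto
  then show ?thesis using a by (auto simp: edeg_def)
qed

lemma edeg_Un: "finite A \<Longrightarrow> finite B \<Longrightarrow> A \<inter> B = {} \<Longrightarrow> edeg (A \<union> B) v = edeg A v + edeg B v"
proof -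
  assume a: "finite A" "finite B" "A \<inter> B = {}"
  have "{e \<in> A \<union> B. v \<in> e} = {e \<in> A. v \<in> e} \<union> {e \<in> B. v \<in> e}" by auto
  then show ?thesis using a unfolding edeg_def by (subst card_Un_disjoint[symmetric]) auto
qed

lemma edeg_mono: "finite B \<Longrightarrow> A \<subseteq> B \<Longrightarrow> edeg A v \<le> edeg B v"
  unfolding edeg_def by (rule card_mono) auto

lemma edeg_empty [simp]: "edeg {} v = 0"
  by (simp add: edeg_def)

lemma edeg_eq_0: "v \<notin> \<Union>E \<Longrightarrow> edeg E v = 0"
  unfolding edeg_def by (metis (no_types, lifting) UnionI card.empty empty_Collect_eq)

lemma edeg_path:
  assumes "distinct p" "2 \<le> length p"
  shows "edeg (path_edges p) v =
    (if v \<notin> set p then 0 else if v = hd p \<or> v = last p then 1 else 2)"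
  using assms
proof (induction p rule: induct_list012)
  case (3 x y zs)
  have new: "{x, y} \<notin> path_edges (y # zs)" using 3 path_edges_subset by fastforce
  show ?case
  proof (cases "zs = []")
    case True
    then show ?thesis by (auto simp: edeg_def Collect_conv_if)
  next
    case False
    then have "2 \<le> length (y # zs)" by (cases zs) auto
    then show ?thesis
      using 3 False new last_in_set[of zs] by (auto simp: edeg_insert)
  qed
qed auto

lemma edeg_psys:
  assumes "psys P"
  shows "edeg (pedges P) v = (if v \<in> pends P then 1 else if v \<in> pverts P then 2 else 0)"
proof -
  have "finite P" using assms by (rule psysD)
  from this assms show ?thesis
  proof (induction P)
    case (insert p P)
    have p: "psys P" "distinct p" "2 \<le> length p" "set p \<inter> pverts P = {}"
      using insert.prems insert.hyps(2) psys_insert by auto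
    have pp: "hd p \<in> set p" "last p \<in> set p" using p by (auto intro: hd_in_set last_in_set)
    have "path_edges p \<inter> pedges P = {}"
    proof (rule ccontr)
      assume "path_edges p \<inter> pedges P \<noteq> {}"
      then obtain e where "e \<in> path_edges p" "e \<in> pedges P" by auto
      then show False
        using path_edges_subset[of e p] pedges_verts[of e P] path_edges_nonempty[of e p] p(4) by blast
    qed
    then have "edeg (pedges (insert p P)) v = edeg (path_edges p) v + edeg (pedges P) v"
      using finite_pedges[OF p(1)] by (simp add: edeg_Un)
    then show ?case
      using insert.IH[OF p(1)] edeg_path[OF p(2,3), of v] p(4) pp pends_subset[OF p(1)] by auto
  qed (simp add: edeg_def)
qed

lemma odd_edeg_psys: "psys P \<Longrightarrow> odd (edeg (pedges P) v) \<longleftrightarrow> v \<in> pends P"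
  by (simp add: edeg_psys)

section \<open>Completing path systems to cycles\<close>

text \<open>This is a cycle only for at least three vertices: a single vertex would give the set
  \<open>{x}\<close> and two vertices a single edge. Every use as a cycle comes with three distinct
  vertices.\<close>

definition cycle_edges :: "'v list \<Rightarrow> 'v set set" where
  "cycle_edges c = insert {last c, hd c} (path_edges c)"

lemma even_card_xor:
  assumes "finite I" and "\<And>i. i \<in> I \<Longrightarrow> R i \<longleftrightarrow> (P i \<noteq> Q i)"
  shows "even (card {i\<in>I. R i}) \<longleftrightarrow> (even (card {i\<in>I. P i}) \<longleftrightarrow> even (card {i\<in>I. Q i}))"
proof -
  have fin: "finite {i\<in>I. S i}" for S using assms(1) by simp
  have "card {i\<in>I. P i} = card {i\<in>I. P i \<and> Q i} + card {i\<in>I. P i \<and> \<not> Q i}"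
    by (subst card_Un_disjoint[symmetric]) (auto simp: fin intro!: arg_cong[where f=card])
  moreover have "card {i\<in>I. Q i} = card {i\<in>I. P i \<and> Q i} + card {i\<in>I. \<not> P i \<and> Q i}"
    by (subst card_Un_disjoint[symmetric]) (auto simp: fin intro!: arg_cong[where f=card])
  moreover have "card {i\<in>I. R i} = card {i\<in>I. P i \<and> \<not> Q i} + card {i\<in>I. \<not> P i \<and> Q i}"
    using assms(2)
    by (subst card_Un_disjoint[symmetric]) (auto simp: fin intro!: arg_cong[where f=card])
  ultimately show ?thesis by presburger
qed

lemma even_card_toggle:
  assumes "finite I" "even (card {i\<in>I. P i})" "even (card {i\<in>I. Q i})"
    and "\<And>i. i \<in> I \<Longrightarrow> R i \<longleftrightarrow> (P i \<noteq> Q i)"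
  shows "even (card {i\<in>I. R i})"
  using even_card_xor[OF assms(1,4)] assms(2,3) by simp

text \<open>One colour of an improvement step: the path system \<open>P\<close> receives the new edges \<open>D\<close>, all
  incident with the fresh vertex \<open>x\<close>, which changes its set of ends by \<open>T\<close>.\<close>

definition grows :: "'v \<Rightarrow> 'v list set \<Rightarrow> 'v set set \<Rightarrow> 'v set \<Rightarrow> 'v list set \<Rightarrow> bool" where
  "grows x P D T P' \<longleftrightarrow> psys P' \<and> P' \<noteq> {} \<and> pedges P' = pedges P \<union> D \<and>
     pedges P \<inter> D = {} \<and> pends P' = sym_diff (pends P) T \<and>
     pverts P' \<subseteq> insert x (pverts P) \<and> card P' \<le> card P"

text \<open>The final outcome for a colour: the new edges complete it to a cycle. No end survives,
  hence the toggled set \<open>T\<close> is the whole of \<open>pends P\<close>, and the colour can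
  leave the induction.\<close>

definition closes :: "'v \<Rightarrow> 'v list set \<Rightarrow> 'v set set \<Rightarrow> 'v set \<Rightarrow> 'v list \<Rightarrow> bool" where
  "closes x P D T c \<longleftrightarrow> distinct c \<and> c \<noteq> [] \<and> cycle_edges c = pedges P \<union> D \<and>
     pedges P \<inter> D = {} \<and> pends P = T \<and> set c \<subseteq> insert x (pverts P)"

text \<open>Mates may be linked only when theirs is the last path of the colour, because the link
  then produces the final cycle; otherwise it would cut off a cycle too early.\<close>

definition joinable :: "'v list set \<Rightarrow> 'v \<Rightarrow> 'v \<Rightarrow> bool" where
  "joinable P u w \<longleftrightarrow> u \<noteq> w \<and> u \<in> pends P \<and> w \<in> pends P \<and> (mates P u w \<longrightarrow> card P = 1)"

lemma fresh_edges: "x \<notin> pverts P \<Longrightarrow> \<forall>e\<in>D. x \<in> e \<Longrightarrow> pedges P \<inter> D = {}"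
  using pedges_verts by blast

lemma grows_refl: "psys P \<Longrightarrow> P \<noteq> {} \<Longrightarrow> grows x P {} {} P"
  by (auto simp: grows_def)

lemma grows_attach:
  assumes "psys P" "u \<in> pends P" "x \<notin> pverts P"
  shows "\<exists>P'. grows x P {{u, x}} {u, x} P'"
proof -
  obtain P' where P': "psys P'" "pedges P' = insert {u, x} (pedges P)"
    "pverts P' = insert x (pverts P)" "pends P' = insert x (pends P - {u})" "card P' = card P"
    using psys_attach_end[OF assms] by metis
  have "x \<notin> pends P" using assms pends_subset by blast
  moreover have "P' \<noteq> {}" using P' by auto
  ultimately show ?thesis
    using P' assms fresh_edges[OF assms(3), of "{{u, x}}"] unfolding grows_def
    by (intro exI[of _ P']) auto
qed

text \<open>If one path is left, the link through \<open>x\<close> turns it into a cycle. Otherwise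
  \<open>u\<close> and \<open>w\<close> end different paths; the first is prolonged to
  \<open>x\<close>, which inherits the mate of \<open>u\<close>, and \<open>x\<close> is then joined
  to \<open>w\<close>.\<close>

lemma grows_or_closes:
  assumes P: "psys P" and j: "joinable P u w" and x: "x \<notin> pverts P"
  shows "(\<exists>P'. grows x P {{u, x}, {x, w}} {u, w} P' \<and> card P' < card P) \<or>
    (\<exists>c. closes x P {{u, x}, {x, w}} {u, w} c)"
proof (cases "card P = 1")
  case True
  then obtain p where p: "P = {p}" using card_1_singletonE by blast
  have pp: "distinct p" "2 \<le> length p" "p \<noteq> []" using P p psysD by blast+
  have e: "{hd p, last p} = {u, w}" using j p by (auto simp: joinable_def)
  have "cycle_edges (p @ [x]) = pedges P \<union> {{u, x}, {x, w}}"
    using p pp(3) e by (auto simp: cycle_edges_def path_edges_append doubleton_eq_iff insert_commute)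
  then have "closes x P {{u, x}, {x, w}} {u, w} (p @ [x])"
    using p pp x e fresh_edges[OF x, of "{{u, x}, {x, w}}"] by (auto simp: closes_def)
  then show ?thesis by blast
next
  case False
  then have m: "u \<noteq> w" "u \<in> pends P" "w \<in> pends P" "\<not> mates P u w"
    using j by (auto simp: joinable_def)
  obtain P1 where P1: "psys P1" "pedges P1 = insert {u, x} (pedges P)"
    "pverts P1 = insert x (pverts P)" "pends P1 = insert x (pends P - {u})" "card P1 = card P"
    "\<And>z. mates P1 x z \<longleftrightarrow> mates P u z"
    using psys_attach_end[OF P m(2) x] by metis
  have xe: "x \<notin> pends P" using x pends_subset[OF P] by blast
  then have "x \<noteq> w" using m by auto
  moreover have "x \<in> pends P1" "w \<in> pends P1" "\<not> mates P1 x w" using P1 m by auto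
  ultimately obtain P2 where P2: "psys P2" "pedges P2 = insert {x, w} (pedges P1)"
    "pverts P2 = pverts P1" "pends P2 = pends P1 - {x, w}" "Suc (card P2) = card P1"
    using psys_join[OF P1(1), of x w] by metis
  have "card P \<noteq> 0" using m(2) psysD(1)[OF P] by (auto simp: pends_def)
  then have "card P2 \<noteq> 0" using False P2 P1 by linarith
  then have "P2 \<noteq> {}" by auto
  then have "grows x P {{u, x}, {x, w}} {u, w} P2 \<and> card P2 < card P"
    using P1 P2 m xe fresh_edges[OF x, of "{{u, x}, {x, w}}"] by (auto simp: grows_def)
  then show ?thesis by blast
qed

text \<open>This is how the parity invariant supplies the partner colours \<open>j\<close> and
  \<open>l\<close> of an improvement step.\<close>

lemma odd_other:
  assumes "finite I" "even (card {i\<in>I. Q i})" "i \<in> I" "Q i"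
  obtains j where "j \<in> I" "j \<noteq> i" "Q j"
proof -
  have "{i\<in>I. Q i} \<noteq> {i}" using assms(2) by auto
  then show thesis using that assms by auto
qed

text \<open>The colour \<open>i\<close> has the largest number of paths. If the end \<open>u\<close> cannot be treated together
  with two different colours, then all ends of \<open>i\<close> outside the path of \<open>u\<close> belong to the single
  colour \<open>j\<close>, and one of them is neither joined to \<open>u\<close> in \<open>i\<close> nor in \<open>j\<close>.\<close>

lemma improving_pair:
  assumes I: "finite I" and F: "\<And>i. i \<in> I \<Longrightarrow> psys (F i) \<and> F i \<noteq> {}"
    and par: "\<And>v. even (card {i\<in>I. v \<in> pends (F i)})"
    and i: "i \<in> I" and max: "\<And>k. k \<in> I \<Longrightarrow> card (F k) \<le> card (F i)"
  obtains u w j l where "joinable (F i) u w" "j \<in> I" "l \<in> I" "j \<noteq> i" "l \<noteq> i"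
    "u \<in> pends (F j)" "w \<in> pends (F l)" "j = l \<Longrightarrow> joinable (F j) u w"
proof -
  have Pi: "psys (F i)" "F i \<noteq> {}" using F i by auto
  obtain u where u: "u \<in> pends (F i)" using Pi by (auto simp: pends_def)
  obtain j where j: "j \<in> I" "j \<noteq> i" "u \<in> pends (F j)"
    using odd_other[OF I par i u] by metis
  have Pj: "psys (F j)" "F j \<noteq> {}" using F j by auto
  have cj: "card (F j) \<noteq> 0" using Pj psysD(1)[OF Pj(1)] by simp
  obtain u' where u': "mates (F i) u u'" "u' \<noteq> u" "u' \<in> pends (F i)"
    using pends_mate[OF Pi(1) u] by metis
  obtain u'' where u'': "mates (F j) u u''" using pends_mate[OF Pj(1) j(3)] by metis
  show thesis
  proof (cases "card (F i) = 1")
    case True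
    obtain l where l: "l \<in> I" "l \<noteq> i" "u' \<in> pends (F l)"
      using odd_other[OF I par i u'(3)] by metis
    \<comment> \<open>Maximality of \<open>i\<close> forces a single path in \<open>j\<close> as
      well, so being mates in \<open>j\<close> is no obstacle there.\<close>
    have "card (F j) = 1" using max[OF j(1)] True cj by simp
    then show ?thesis using that[of u u' j l] True u u' j l by (auto simp: joinable_def)
  next
    case False
    have "card (F i) \<noteq> 0" using Pi psysD(1)[OF Pi(1)] by simp
    then have "4 \<le> card (pends (F i))" using card_pends[OF Pi(1)] False by linarith
    moreover have "card {u, u', u''} \<le> 3" by (simp add: card_insert_if)
    moreover have "finite {u, u', u''}" by simp
    ultimately have "\<not> pends (F i) \<subseteq> {u, u', u''}"
      using card_mono[of "{u, u', u''}" "pends (F i)"] by linarith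
    then obtain w where w: "w \<in> pends (F i)" "w \<noteq> u" "w \<noteq> u'" "w \<noteq> u''" by blast
    obtain l where l: "l \<in> I" "l \<noteq> i" "w \<in> pends (F l)"
      using odd_other[OF I par i w(1)] by metis
    have "\<not> mates (F i) u w" "\<not> mates (F j) u w"
      using mates_unique[OF Pi(1) u'(1)] mates_unique[OF Pj(1) u''] w by auto
    then show ?thesis using that[of u w j l] u w j l by (auto simp: joinable_def)
  qed
qed

text \<open>Linking \<open>u\<close> and \<open>w\<close> through a fresh vertex \<open>x\<close> in colour \<open>i\<close> is compensated by the edge
  \<open>ux\<close> in colour \<open>j\<close> and the edge \<open>xw\<close> in colour \<open>l\<close>, where \<open>j = l\<close> is allowed.\<close>

lemma improvement_step:
  fixes F :: "'i \<Rightarrow> 'v list set"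
  assumes I: "finite I" "I \<noteq> {}" and F: "\<And>i. i \<in> I \<Longrightarrow> psys (F i) \<and> F i \<noteq> {}"
    and par: "\<And>v. even (card {i\<in>I. v \<in> pends (F i)})"
    and x: "\<And>i. i \<in> I \<Longrightarrow> x \<notin> pverts (F i)"
  obtains D T F' c Q where
    "\<And>v. even (card {i\<in>I. v \<in> T i})" "\<And>e. even (card {i\<in>I. e \<in> D i})"
    "Q \<subseteq> I" "\<And>i. i \<in> I - Q \<Longrightarrow> grows x (F i) (D i) (T i) (F' i)"
    "\<And>i. i \<in> Q \<Longrightarrow> closes x (F i) (D i) (T i) (c i)"
    "Q \<noteq> {} \<or> (\<exists>i\<in>I. card (F' i) < card (F i))"
proof -
  have "finite ((\<lambda>i. card (F i)) ` I)" "(\<lambda>i. card (F i)) ` I \<noteq> {}" using I by auto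
  then have "Max ((\<lambda>i. card (F i)) ` I) \<in> (\<lambda>i. card (F i)) ` I" by (rule Max_in)
  then obtain i where i: "i \<in> I" "card (F i) = Max ((\<lambda>i. card (F i)) ` I)" by auto
  have max: "card (F k) \<le> card (F i)" if "k \<in> I" for k using that I i by simp
  obtain u w j l where ch: "joinable (F i) u w" "j \<in> I" "l \<in> I" "j \<noteq> i" "l \<noteq> i"
    "u \<in> pends (F j)" "w \<in> pends (F l)" "j = l \<Longrightarrow> joinable (F j) u w"
    using improving_pair[OF I(1) F par i(1) max] by metis
  have uw: "u \<noteq> w" using ch(1) by (simp add: joinable_def)
  have xne: "x \<noteq> u" "x \<noteq> w"
    using ch(2,3,6,7) x F pends_subset by blast+
  define D where "D k = (if k = i then {{u, x}, {x, w}} else {}) \<union>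
    (if k = j then {{u, x}} else {}) \<union> (if k = l then {{x, w}} else {})" for k
  \<comment> \<open>In \<open>j\<close> the end \<open>u\<close> moves to \<open>x\<close>, in
    \<open>l\<close> the end \<open>w\<close> does. If \<open>j = l\<close>, the colour passes
    through \<open>x\<close>, which is then no end. Each vertex lies in none or exactly two of these
    sets, so the parity of ends is kept.\<close>
  define T where "T k = (if k = i \<or> k = j \<and> j = l then {u, w} else if k = j then {u, x}
    else if k = l then {x, w} else {})" for k
  have parD: "even (card {k\<in>I. e \<in> D k})" for e
  proof -
    have ne: "{u, x} \<noteq> {x, w}" using uw xne by (auto simp: doubleton_eq_iff)
    consider "e = {u, x}" | "e = {x, w}" | "e \<noteq> {u, x}" "e \<noteq> {x, w}" by blast
    then show ?thesis
    proof cases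
      case 1
      then have "{k\<in>I. e \<in> D k} = {i, j}" using ne i(1) ch by (auto simp: D_def)
      then show ?thesis using ch(4) by simp
    next
      case 2
      then have "{k\<in>I. e \<in> D k} = {i, l}" using ne i(1) ch by (auto simp: D_def)
      then show ?thesis using ch(5) by simp
    next
      case 3
      then have "{k\<in>I. e \<in> D k} = {}" by (auto simp: D_def)
      then show ?thesis by (simp only: card.empty even_zero)
    qed
  qed
  have parT: "even (card {k\<in>I. v \<in> T k})" for v
  proof -
    consider "v = u" | "v = w" | "v = x" "j \<noteq> l" | "v = x" "j = l" |
      "v \<noteq> u" "v \<noteq> w" "v \<noteq> x" by blast
    then show ?thesis
    proof cases
      case 1
      then have "{k\<in>I. v \<in> T k} = {i, j}" using uw xne i(1) ch by (auto simp: T_def)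
      then show ?thesis using ch(4) by simp
    next
      case 2
      then have "{k\<in>I. v \<in> T k} = {i, l}" using uw xne i(1) ch by (auto simp: T_def)
      then show ?thesis using ch(5) by simp
    next
      case 3
      then have "{k\<in>I. v \<in> T k} = {j, l}" using uw xne i(1) ch by (auto simp: T_def)
      then show ?thesis using 3 by simp
    next
      case 4
      then have "{k\<in>I. v \<in> T k} = {}" using uw xne by (auto simp: T_def)
      then show ?thesis by (simp only: card.empty even_zero)
    next
      case 5
      then have "{k\<in>I. v \<in> T k} = {}" by (auto simp: T_def)
      then show ?thesis by (simp only: card.empty even_zero)
    qed
  qed
  have all: "(\<exists>P'. grows x (F k) (D k) (T k) P' \<and> (k = i \<longrightarrow> card P' < card (F i))) \<or>
      (\<exists>c. closes x (F k) (D k) (T k) c)" if k: "k \<in> I" for k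
  proof -
    have Pk: "psys (F k)" "F k \<noteq> {}" "x \<notin> pverts (F k)" using F k x by auto
    consider "k = i" | "k = j" "j = l" | "k = j" "j \<noteq> l" | "k = l" "j \<noteq> l" |
      "k \<noteq> i" "k \<noteq> j" "k \<noteq> l" by blast
    then show ?thesis
    proof cases
      case 1
      then have "D k = {{u, x}, {x, w}}" "T k = {u, w}" using ch by (auto simp: D_def T_def)
      then show ?thesis using grows_or_closes[OF Pk(1) _ Pk(3)] ch(1) 1 by metis
    next
      case 2
      then have "D k = {{u, x}, {x, w}}" "T k = {u, w}" using ch by (auto simp: D_def T_def)
      then show ?thesis using grows_or_closes[OF Pk(1) _ Pk(3)] ch(4,8) 2 by metis
    next
      case 3
      then have "D k = {{u, x}}" "T k = {u, x}" using ch by (auto simp: D_def T_def)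
      then show ?thesis using grows_attach[OF Pk(1) _ Pk(3)] ch(4,6) 3 by metis
    next
      case 4
      then have "D k = {{w, x}}" "T k = {w, x}" using ch by (auto simp: D_def T_def)
      then show ?thesis using grows_attach[OF Pk(1) _ Pk(3)] ch(5,7) 4 by metis
    next
      case 5
      then have "D k = {}" "T k = {}" by (auto simp: D_def T_def)
      then show ?thesis using grows_refl[OF Pk(1,2)] 5 by metis
    qed
  qed
  \<comment> \<open>Colours that can be closed are closed and removed. If there are none, colour
    \<open>i\<close> has lost a path; in either case the total number of paths still to be treated
    decreases.\<close>
  define Q where "Q = {k\<in>I. \<exists>c. closes x (F k) (D k) (T k) c}"
  obtain F' where F': "\<And>k. k \<in> I - Q \<Longrightarrow>
      grows x (F k) (D k) (T k) (F' k) \<and> (k = i \<longrightarrow> card (F' k) < card (F i))"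
    using all unfolding Q_def by (metis (mono_tags, lifting) DiffE mem_Collect_eq)
  have "\<forall>k\<in>Q. \<exists>c. closes x (F k) (D k) (T k) c" by (auto simp: Q_def)
  then obtain c where c: "\<And>k. k \<in> Q \<Longrightarrow> closes x (F k) (D k) (T k) (c k)"
    using bchoice[of Q "\<lambda>k. closes x (F k) (D k) (T k)"] by blast
  show thesis
  proof (rule that[of T D Q F' c])
    show "Q \<noteq> {} \<or> (\<exists>i\<in>I. card (F' i) < card (F i))" using F' i(1) by blast
  qed (use parD parT F' c in \<open>auto simp: Q_def\<close>)
qed

text \<open>Induction on the total number of paths. Every step takes a vertex of \<open>Z\<close>
  outside all current systems, so its edges are new in every colour, and each of them is added to an
  even number of colours. Closed colours drop out without disturbing the parity of ends.\<close>

theorem cycle_completion: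
  fixes F :: "'i \<Rightarrow> 'v list set"
  assumes "finite I" and "\<And>i. i \<in> I \<Longrightarrow> psys (F i) \<and> F i \<noteq> {}"
    and "\<And>v. even (card {i\<in>I. v \<in> pends (F i)})" and Z: "infinite Z"
  shows "\<exists>c. (\<forall>i\<in>I. distinct (c i) \<and> c i \<noteq> [] \<and> set (c i) \<subseteq> pverts (F i) \<union> Z \<and>
      pedges (F i) \<subseteq> cycle_edges (c i)) \<and>
    (\<forall>e. even (card {i\<in>I. e \<in> cycle_edges (c i) - pedges (F i)}))"
  using assms(1-3)
proof (induction "\<Sum>i\<in>I. card (F i)" arbitrary: I F rule: less_induct)
  case (less I F)
  note I = less.prems(1) and F = less.prems(2) and par = less.prems(3)
  show ?case
  proof (cases "I = {}")
    case False
    have "finite (\<Union>i\<in>I. pverts (F i))" using I F finite_pverts by blast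
    then obtain x where x: "x \<in> Z" "x \<notin> (\<Union>i\<in>I. pverts (F i))"
      using Z by (meson finite_subset subsetI)
    have xx: "\<And>i. i \<in> I \<Longrightarrow> x \<notin> pverts (F i)" using x(2) by blast
    obtain D T F' c Q where st: "\<And>v. even (card {i\<in>I. v \<in> T i})"
      "\<And>e. even (card {i\<in>I. e \<in> D i})"
      "Q \<subseteq> I" "\<And>i. i \<in> I - Q \<Longrightarrow> grows x (F i) (D i) (T i) (F' i)"
      "\<And>i. i \<in> Q \<Longrightarrow> closes x (F i) (D i) (T i) (c i)"
      "Q \<noteq> {} \<or> (\<exists>i\<in>I. card (F' i) < card (F i))"
      by (rule improvement_step[OF I False F par xx]) (assumption | rule that; assumption)+
    define J where "J = I - Q"
    have J: "finite J" "J \<subseteq> I" using I by (auto simp: J_def)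
    have G: "grows x (F i) (D i) (T i) (F' i)" if "i \<in> J" for i using st(4) that J_def by auto
    have small: "(\<Sum>i\<in>J. card (F' i)) < (\<Sum>i\<in>I. card (F i))"
    proof (cases "Q = {}")
      case True
      then have "\<exists>i\<in>I. card (F' i) < card (F i)" using st(6) by blast
      moreover have "\<forall>i\<in>I. card (F' i) \<le> card (F i)" using st(4) True by (simp add: grows_def)
      ultimately show ?thesis using I True by (simp add: J_def sum_strict_mono_ex1)
    next
      case nQ: False
      have pos: "0 < card (F i)" if "i \<in> I" for i
        using F[OF that] psysD(1) by (auto simp: card_gt_0_iff)
      have "(\<Sum>i\<in>J. card (F' i)) \<le> (\<Sum>i\<in>J. card (F i))"
        using G by (intro sum_mono) (simp add: grows_def)
      also have "\<dots> < (\<Sum>i\<in>J. card (F i)) + (\<Sum>i\<in>Q. card (F i))"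
      proof -
        have "0 < (\<Sum>i\<in>Q. card (F i))"
          using nQ finite_subset[OF st(3) I] pos st(3) by (intro sum_pos) blast+
        then show ?thesis by simp
      qed
      also have "\<dots> = (\<Sum>i\<in>I. card (F i))"
        using st(3) I by (simp add: J_def sum.subset_diff[of Q I])
      finally show ?thesis .
    qed
    \<comment> \<open>For a closed colour toggling by \<open>T i\<close> removes all its ends, which
      agrees with leaving it out of \<open>J\<close>.\<close>
    have par': "even (card {i\<in>J. v \<in> pends (F' i)})" for v
    proof -
      have "even (card {i\<in>I. i \<in> J \<and> v \<in> pends (F' i)})"
      proof (rule even_card_toggle[OF I par st(1)])
        fix i assume "i \<in> I"
        then show "i \<in> J \<and> v \<in> pends (F' i) \<longleftrightarrow> (v \<in> pends (F i)) \<noteq> (v \<in> T i)"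
          using G[of i] st(5)[of i] by (auto simp: J_def grows_def closes_def)
      qed
      moreover have "{i\<in>I. i \<in> J \<and> v \<in> pends (F' i)} = {i\<in>J. v \<in> pends (F' i)}"
        using J by auto
      ultimately show ?thesis by simp
    qed
    have "\<exists>d. (\<forall>i\<in>J. distinct (d i) \<and> d i \<noteq> [] \<and> set (d i) \<subseteq> pverts (F' i) \<union> Z \<and>
        pedges (F' i) \<subseteq> cycle_edges (d i)) \<and>
      (\<forall>e. even (card {i\<in>J. e \<in> cycle_edges (d i) - pedges (F' i)}))"
      by (rule less.hyps[OF small J(1) _ par']) (use G in \<open>simp add: grows_def\<close>)
    then obtain d where d: "\<And>i. i \<in> J \<Longrightarrow> distinct (d i) \<and> d i \<noteq> [] \<and>
        set (d i) \<subseteq> pverts (F' i) \<union> Z \<and> pedges (F' i) \<subseteq> cycle_edges (d i)"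
      "\<And>e. even (card {i\<in>J. e \<in> cycle_edges (d i) - pedges (F' i)})"
      by blast
    define C where "C i = (if i \<in> Q then c i else d i)" for i
    show ?thesis
    proof (intro exI[of _ C] conjI ballI allI)
      fix i assume i: "i \<in> I"
      show "distinct (C i)" "C i \<noteq> []" "pedges (F i) \<subseteq> cycle_edges (C i)"
        using i st(5)[of i] d(1)[of i] G[of i]
        by (auto simp: C_def J_def grows_def closes_def)
      show "set (C i) \<subseteq> pverts (F i) \<union> Z"
      proof (cases "i \<in> Q")
        case True
        then have "set (c i) \<subseteq> insert x (pverts (F i))" using st(5) by (simp add: closes_def)
        then show ?thesis using True x(1) by (auto simp: C_def)
      next
        case False
        then have "i \<in> J" using i by (simp add: J_def)
        then have "set (d i) \<subseteq> pverts (F' i) \<union> Z" "pverts (F' i) \<subseteq> insert x (pverts (F i))"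
          using d(1) G by (simp_all add: grows_def)
        then have "set (d i) \<subseteq> pverts (F i) \<union> Z" using x(1) by blast
        then show ?thesis using False by (simp add: C_def)
      qed
    next
      fix e
      have "even (card {i\<in>I. i \<in> J \<and> e \<in> cycle_edges (d i) - pedges (F' i)})"
      proof -
        have "{i\<in>I. i \<in> J \<and> e \<in> cycle_edges (d i) - pedges (F' i)} =
          {i\<in>J. e \<in> cycle_edges (d i) - pedges (F' i)}" using J by auto
        then show ?thesis using d(2) by simp
      qed
      \<comment> \<open>An edge added to a colour is added either now or later, never both:
        \<open>D i\<close> is already part of \<open>pedges (F' i)\<close>. Hence the two parities
        add up.\<close>
      then show "even (card {i\<in>I. e \<in> cycle_edges (C i) - pedges (F i)})"
      proof (rule even_card_toggle[OF I _ st(2)])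
        fix i assume i: "i \<in> I"
        show "e \<in> cycle_edges (C i) - pedges (F i) \<longleftrightarrow>
          (i \<in> J \<and> e \<in> cycle_edges (d i) - pedges (F' i)) \<noteq> (e \<in> D i)"
          using i st(5)[of i] d(1)[of i] G[of i]
          by (auto simp: C_def J_def grows_def closes_def)
      qed
    qed
  qed simp
qed

section \<open>Two-factors\<close>

definition arcs :: "'v list \<Rightarrow> ('v \<times> 'v) list" where
  "arcs t = zip t (tl t)"

abbreviation unarc :: "'v \<times> 'v \<Rightarrow> 'v set" where
  "unarc a \<equiv> {fst a, snd a}"

lemma arcs_simps [simp]: "arcs [] = []" "arcs [x] = []" "arcs (x # y # zs) = (x, y) # arcs (y # zs)"
  by (auto simp: arcs_def)

lemma arcs_append:
  "t \<noteq> [] \<Longrightarrow> r \<noteq> [] \<Longrightarrow> last t = hd r \<Longrightarrow> arcs (t @ tl r) = arcs t @ arcs r"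
proof (induction t rule: induct_list012)
  case (2 x)
  then show ?case by (cases r) auto
qed auto

lemma arcs_snoc: "t \<noteq> [] \<Longrightarrow> arcs (t @ [x]) = arcs t @ [(last t, x)]"
  using arcs_append[of t "[last t, x]"] by simp

lemma mset_arcs_rev: "mset (map unarc (arcs (rev t))) = mset (map unarc (arcs t))"
proof (induction t rule: induct_list012)
  case (3 x y zs)
  have "arcs (rev (x # y # zs)) = arcs (rev (y # zs)) @ [(y, x)]"
    using arcs_snoc[of "rev (y # zs)" x] by simp
  then show ?case using 3(2) by (simp add: insert_commute)
qed auto

text \<open>Each passage through \<open>v\<close> in the interior of the list uses one arc into
  \<open>v\<close> and one out of it; only the two extremities can upset the balance.\<close>

lemma arcs_balance:
  "t \<noteq> [] \<Longrightarrow> length (filter (\<lambda>a. fst a = v) (arcs t)) + (if last t = v then 1 else 0) =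
    length (filter (\<lambda>a. snd a = v) (arcs t)) + (if hd t = v then 1 else 0)"
  by (induction t rule: induct_list012) auto

text \<open>Reversal does not change the underlying edges, so the common end can be placed at the
  end of one list and at the start of the other.\<close>

lemma join_trails:
  assumes "t \<noteq> []" "r \<noteq> []" "v \<in> {hd t, last t}" "v \<in> {hd r, last r}"
  shows "\<exists>s. s \<noteq> [] \<and> mset (map unarc (arcs s)) =
    mset (map unarc (arcs t)) + mset (map unarc (arcs r))"
proof -
  define t' where "t' = (if v = last t then t else rev t)"
  define r' where "r' = (if v = hd r then r else rev r)"
  have "t' \<noteq> []" "r' \<noteq> []" "last t' = v" "hd r' = v"
    using assms by (auto simp: t'_def r'_def last_rev hd_rev)
  moreover have "mset (map unarc (arcs t')) = mset (map unarc (arcs t))"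
    "mset (map unarc (arcs r')) = mset (map unarc (arcs r))"
    using mset_arcs_rev[of t] mset_arcs_rev[of r] by (auto simp: t'_def r'_def)
  ultimately show ?thesis
    by (intro exI[of _ "t' @ tl r'"]) (simp add: arcs_append)
qed

text \<open>Vertices may repeat within a list; it is the equality of multisets with
  \<open>mset_set E\<close> that makes every edge occur exactly once and thus makes the lists
  trails.\<close>

definition trail_decomp :: "'v set set \<Rightarrow> 'v list multiset \<Rightarrow> bool" where
  "trail_decomp E ts \<longleftrightarrow> (\<forall>t\<in>#ts. t \<noteq> []) \<and>
     (\<Sum>t\<in>#ts. mset (map unarc (arcs t))) = mset_set E"

lemma trail_decomp_exists:
  assumes "finite E" "\<forall>e\<in>E. card e = 2"
  shows "\<exists>ts. trail_decomp E ts"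
  using assms
proof (induction E)
  case empty
  then show ?case by (intro exI[of _ "{#}"]) (simp add: trail_decomp_def)
next
  case (insert e E)
  obtain u w where e: "e = {u, w}" using insert.prems by (auto simp: card_2_iff)
  obtain ts where "trail_decomp E ts" using insert by auto
  then have "trail_decomp (insert e E) (add_mset [u, w] ts)"
    using insert.hyps e by (simp add: trail_decomp_def)
  then show ?case by blast
qed

text \<open>In a decomposition into as few trails as possible no vertex is an end of two trails.
  Traversing the trails therefore balances in- and out-degrees up to 1.\<close>

lemma balanced_orientation:
  assumes E: "finite E" "\<forall>e\<in>E. card e = 2" and deg: "\<And>v. edeg E v \<le> 2 * s"
  obtains R where "finite R" "inj_on unarc R" "unarc ` R = E"
    "\<And>v. card {a\<in>R. fst a = v} \<le> s" "\<And>v. card {a\<in>R. snd a = v} \<le> s"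
proof -
  obtain ts where ts: "trail_decomp E ts"
    and min: "\<And>ts'. trail_decomp E ts' \<Longrightarrow> size ts \<le> size ts'"
    using ex_has_least_nat[of "trail_decomp E" _ size] trail_decomp_exists[OF E] by metis
  have ends: "v \<notin> {hd r, last r}"
    if sp: "ts = add_mset t (add_mset r ts')" and v: "v \<in> {hd t, last t}" for t r ts' v
  proof
    assume v': "v \<in> {hd r, last r}"
    have "t \<noteq> []" "r \<noteq> []" using ts sp by (auto simp: trail_decomp_def)
    then obtain s where s: "s \<noteq> []" "mset (map unarc (arcs s)) =
      mset (map unarc (arcs t)) + mset (map unarc (arcs r))"
      using join_trails[OF _ _ v v'] by blast
    have "trail_decomp E (add_mset s ts')"
      using ts s unfolding trail_decomp_def sp by (simp add: add.assoc)
    then show False using min[of "add_mset s ts'"] sp by simp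
  qed
  define h where "h v = (\<Sum>t\<in>#ts. if hd t = v then 1 else 0 :: nat)" for v
  define l where "l v = (\<Sum>t\<in>#ts. if last t = v then 1 else 0 :: nat)" for v
  have hl: "h v \<le> 1 \<and> l v \<le> 1" for v
  proof (cases "\<exists>t\<in>#ts. v \<in> {hd t, last t}")
    case True
    then obtain t ts' where t: "v \<in> {hd t, last t}" "ts = add_mset t ts'"
      by (meson multi_member_split)
    have "v \<notin> {hd r, last r}" if "r \<in># ts'" for r
      using ends[OF _ t(1)] t(2) that by (metis multi_member_split)
    then have z: "(\<Sum>t\<in>#ts'. if hd t = v then 1 else 0 :: nat) = 0"
      "(\<Sum>t\<in>#ts'. if last t = v then 1 else 0 :: nat) = 0"
      by (auto intro!: sum_mset.neutral)
    have hv: "h v = (if hd t = v then 1 else 0) + (\<Sum>t\<in>#ts'. if hd t = v then 1 else 0)"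
      "l v = (if last t = v then 1 else 0) + (\<Sum>t\<in>#ts'. if last t = v then 1 else 0)"
      unfolding h_def l_def t(2) by simp_all
    show ?thesis unfolding hv z by simp
  next
    case False
    then have "h v = 0" "l v = 0" by (auto simp: h_def l_def intro!: sum_mset.neutral)
    then show ?thesis by simp
  qed
  obtain L where L: "mset L = (\<Sum>t\<in>#ts. mset (arcs t))" using ex_mset by blast
  have "mset (map unarc L) = image_mset unarc (\<Sum>t\<in>#ts. mset (arcs t))" by (simp add: L)
  also have "\<dots> = (\<Sum>t\<in>#ts. mset (map unarc (arcs t)))"
    by (induction ts) auto
  also have "\<dots> = mset_set E" using ts by (simp add: trail_decomp_def)
  finally have mL: "mset (map unarc L) = mset_set E" .
  have sM: "set (map unarc L) = E"
    using arg_cong[OF mL, of set_mset] E(1) by (simp only: set_mset_mset finite_set_mset_mset_set)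
  have dL: "distinct (map unarc L)"
    unfolding distinct_count_atmost_1 sM mL using E(1) by simp
  have sL: "unarc ` set L = E" using sM by simp
  have bal: "length (filter (\<lambda>a. fst a = v) L) + l v = length (filter (\<lambda>a. snd a = v) L) + h v" for v
  proof -
    have "(\<forall>t\<in>#ts. t \<noteq> []) \<Longrightarrow> size (filter_mset (\<lambda>a. fst a = v) (\<Sum>t\<in>#ts. mset (arcs t))) + l v =
      size (filter_mset (\<lambda>a. snd a = v) (\<Sum>t\<in>#ts. mset (arcs t))) + h v"
      unfolding h_def l_def
    proof (induction ts)
      case (add t ts)
      have size_filter: "size (filter_mset Q (mset xs)) = length (filter Q xs)" for Q and xs :: "('v \<times> 'v) list"
        by (metis mset_filter size_mset)
      have "length (filter (\<lambda>a. fst a = v) (arcs t)) + (if last t = v then 1 else 0) =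
        length (filter (\<lambda>a. snd a = v) (arcs t)) + (if hd t = v then 1 else 0)"
        using add.prems arcs_balance[of t v] by simp
      then show ?case using add by (simp add: size_filter split del: if_split)
    qed simp
    then have "size (filter_mset (\<lambda>a. fst a = v) (mset L)) + l v =
      size (filter_mset (\<lambda>a. snd a = v) (mset L)) + h v"
      using ts L by (simp add: trail_decomp_def)
    then show ?thesis by (metis mset_filter size_mset)
  qed
  have dist: "distinct L" "inj_on unarc (set L)" using dL by (auto simp: distinct_map)
  have cnt: "length (filter Q L) = card {a\<in>set L. Q a}" for Q
    using dist(1) by (metis distinct_card distinct_filter set_filter)
  have io: "card {a\<in>set L. fst a = v} + card {a\<in>set L. snd a = v} \<le> 2 * s" for v
  proof -
    have ne: "fst a \<noteq> snd a" if "a \<in> set L" for a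
    proof
      assume "fst a = snd a"
      then have "card (unarc a) = 1" by simp
      moreover have "card (unarc a) = 2" using E(2) sL that by blast
      ultimately show False by simp
    qed
    have "card {a\<in>set L. fst a = v} + card {a\<in>set L. snd a = v} =
      card ({a\<in>set L. fst a = v} \<union> {a\<in>set L. snd a = v})"
      using ne by (subst card_Un_disjoint) fastforce+
    also have "\<dots> = card (unarc ` ({a\<in>set L. fst a = v} \<union> {a\<in>set L. snd a = v}))"
      using dist(2) by (intro card_image[symmetric]) (auto elim: inj_on_subset)
    also have "\<dots> \<le> edeg E v"
      unfolding edeg_def using E(1) sL by (intro card_mono) auto
    finally show ?thesis using deg[of v] by simp
  qed
  show thesis
  proof (rule that[of "set L"])
    \<comment> \<open>Out- and in-degree differ by at most 1 and sum to at most the even number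
      \<open>2 * s\<close>, so neither can reach \<open>s + 1\<close>.\<close>
    show "card {a\<in>set L. fst a = v} \<le> s" "card {a\<in>set L. snd a = v} \<le> s" for v
      using bal[of v] hl[of v] io[of v] unfolding cnt by linarith+
  qed (use dist sL in auto)
qed

text \<open>A Kempe chain. The arcs form a bipartite graph with a left copy of each tail and a right
  copy of each head; left vertices are left through colour \<open>\<beta>\<close> and right vertices
  through colour \<open>\<alpha>\<close>.\<close>

inductive alternating_reach :: "('a \<times> 'b) set \<Rightarrow> ('a \<times> 'b \<Rightarrow> 'c) \<Rightarrow> 'c \<Rightarrow> 'c \<Rightarrow> 'a \<Rightarrow> 'a + 'b \<Rightarrow> bool"
  for R f \<alpha> \<beta> u where
  start: "alternating_reach R f \<alpha> \<beta> u (Inl u)"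
| to_right: "alternating_reach R f \<alpha> \<beta> u (Inl l) \<Longrightarrow> (l, r) \<in> R \<Longrightarrow> f (l, r) = \<beta> \<Longrightarrow>
    alternating_reach R f \<alpha> \<beta> u (Inr r)"
| to_left: "alternating_reach R f \<alpha> \<beta> u (Inr r) \<Longrightarrow> (l, r) \<in> R \<Longrightarrow> f (l, r) = \<alpha> \<Longrightarrow>
    alternating_reach R f \<alpha> \<beta> u (Inl l)"

definition proper :: "('a \<times> 'b) set \<Rightarrow> ('a \<times> 'b \<Rightarrow> 'c) \<Rightarrow> bool" where
  "proper R f \<longleftrightarrow> (\<forall>a\<in>R. \<forall>b\<in>R. a \<noteq> b \<longrightarrow> fst a = fst b \<or> snd a = snd b \<longrightarrow> f a \<noteq> f b)"

text \<open>Exchanging the colours along the alternating chain that starts at \<open>u\<close>. It does not meet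
  \<open>v\<close> because it enters right vertices through arcs of colour \<open>\<beta>\<close> only.\<close>

lemma kempe_exchange:
  assumes pr: "proper R f" and u: "\<And>r. (u, r) \<in> R \<Longrightarrow> f (u, r) \<noteq> \<alpha>"
    and v: "\<And>l. (l, v) \<in> R \<Longrightarrow> f (l, v) \<noteq> \<beta>" and ne: "\<alpha> \<noteq> \<beta>"
  obtains g where "proper R g" "g ` R \<subseteq> f ` R \<union> {\<alpha>, \<beta>}"
    "\<And>r. (u, r) \<in> R \<Longrightarrow> g (u, r) \<noteq> \<beta>" "\<And>l. (l, v) \<in> R \<Longrightarrow> g (l, v) \<noteq> \<beta>"
proof -
  let ?K = "alternating_reach R f \<alpha> \<beta> u"
  have right: "\<exists>l. ?K (Inl l) \<and> (l, r) \<in> R \<and> f (l, r) = \<beta>" if "?K (Inr r)" for r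
    using that by cases auto
  have left: "l = u \<or> (\<exists>r. ?K (Inr r) \<and> (l, r) \<in> R \<and> f (l, r) = \<alpha>)" if "?K (Inl l)" for l
    using that by cases auto
  have uniq: "l = l'" if "(l, r) \<in> R" "(l', r) \<in> R" "f (l, r) = f (l', r)" for l l' r
    using pr that unfolding proper_def by (metis fst_conv snd_conv)
  have uniq': "r = r'" if "(l, r) \<in> R" "(l, r') \<in> R" "f (l, r) = f (l, r')" for l r r'
    using pr that unfolding proper_def by (metis fst_conv snd_conv)
  \<comment> \<open>The chain is a full component of the two-coloured subgraph: by properness a
    reached vertex was entered through its only arc of that colour, and the starting vertex
    \<open>u\<close> has no arc of colour \<open>\<alpha>\<close>.\<close>
  have closed: "?K (Inl l) \<longleftrightarrow> ?K (Inr r)" if "(l, r) \<in> R" "f (l, r) \<in> {\<alpha>, \<beta>}" for l r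
  proof (cases "f (l, r) = \<alpha>")
    case True
    then show ?thesis using that(1) u left uniq' to_left by metis
  next
    case False
    then have "f (l, r) = \<beta>" using that(2) by simp
    then show ?thesis using that(1) right uniq to_right by metis
  qed
  \<comment> \<open>Testing the left end suffices: for arcs of these two colours
    \<open>closed\<close> gives the same answer at the right end.\<close>
  define g where "g a = (if ?K (Inl (fst a)) \<and> f a = \<alpha> then \<beta>
    else if ?K (Inl (fst a)) \<and> f a = \<beta> then \<alpha> else f a)" for a
  have nv: "\<not> ?K (Inr v)" using right v by blast
  show thesis
  proof (rule that[of g])
    show "proper R g"
      unfolding proper_def
    proof (intro ballI impI)
      fix a b assume ab: "a \<in> R" "b \<in> R" "a \<noteq> b" "fst a = fst b \<or> snd a = snd b"
      then have fab: "f a \<noteq> f b" using pr by (auto simp: proper_def)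
      have K: "?K (Inl (fst a)) \<longleftrightarrow> ?K (Inl (fst b))" if "f a \<in> {\<alpha>, \<beta>}" "f b \<in> {\<alpha>, \<beta>}"
        using closed[of "fst a" "snd a"] closed[of "fst b" "snd b"] ab that by (metis prod.collapse)
      then show "g a \<noteq> g b" using fab ne unfolding g_def by (smt (verit) insert_iff)
    qed
    show "g ` R \<subseteq> f ` R \<union> {\<alpha>, \<beta>}" by (auto simp: g_def)
    show "g (u, r) \<noteq> \<beta>" if "(u, r) \<in> R" for r
      using u[OF that] ne alternating_reach.start[of R f \<alpha> \<beta> u] by (auto simp: g_def)
    show "g (l, v) \<noteq> \<beta>" if "(l, v) \<in> R" for l
      using v[OF that] ne nv closed[OF that] by (auto simp: g_def)
  qed
qed

lemma missing_colour:
  assumes "finite A" "card A < s"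
  obtains c where "c < s" "c \<notin> f ` A"
proof -
  have "card (f ` A) < card {..<s}" using card_image_le[OF assms(1), of f] assms(2) by simp
  then have "\<not> {..<s} \<subseteq> f ` A" using assms(1) by (meson card_mono finite_imageI not_le)
  then show thesis using that by blast
qed

text \<open>Arcs are inserted one at a time. Before the insertion of \<open>(u, v)\<close> some
  colour \<open>\<alpha>\<close> is free at \<open>u\<close> and some \<open>\<beta>\<close> is free
  at \<open>v\<close>; if they differ, an exchange along the chain from \<open>u\<close> frees
  \<open>\<beta>\<close> at both.\<close>

theorem koenig_edge_colouring:
  fixes R :: "('a \<times> 'b) set" and s :: nat
  assumes "finite R" "\<And>u. card {a\<in>R. fst a = u} \<le> s" "\<And>v. card {a\<in>R. snd a = v} \<le> s"
  shows "\<exists>f. proper R f \<and> f ` R \<subseteq> {..<s}"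
  using assms
proof (induction R)
  case empty
  then show ?case by (simp add: proper_def)
next
  case (insert a R)
  obtain u v where a: "a = (u, v)" by fastforce
  have sub: "card {b\<in>R. Q b} \<le> card {b\<in>insert a R. Q b}" for Q
    using insert.hyps by (intro card_mono) auto
  have "card {b\<in>R. fst b = x} \<le> s" "card {b\<in>R. snd b = y} \<le> s" for x y
    using sub[of "\<lambda>b. fst b = x"] sub[of "\<lambda>b. snd b = y"] insert.prems(1)[of x] insert.prems(2)[of y]
    by linarith+
  then obtain f where f: "proper R f" "f ` R \<subseteq> {..<s}" using insert.IH by blast
  have "{b\<in>insert a R. fst b = u} = insert a {b\<in>R. fst b = u}"
    "{b\<in>insert a R. snd b = v} = insert a {b\<in>R. snd b = v}" by (auto simp: a)
  then have lt: "card {b\<in>R. fst b = u} < s" "card {b\<in>R. snd b = v} < s"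
    using insert.prems(1)[of u] insert.prems(2)[of v] insert.hyps by simp_all
  obtain \<alpha> where \<alpha>: "\<alpha> < s" "\<alpha> \<notin> f ` {b\<in>R. fst b = u}"
    using missing_colour[OF _ lt(1)] insert.hyps by auto
  obtain \<beta> where \<beta>: "\<beta> < s" "\<beta> \<notin> f ` {b\<in>R. snd b = v}"
    using missing_colour[OF _ lt(2)] insert.hyps by auto
  have "\<exists>g. proper R g \<and> g ` R \<subseteq> {..<s} \<and> (\<forall>r. (u, r) \<in> R \<longrightarrow> g (u, r) \<noteq> \<beta>) \<and>
    (\<forall>l. (l, v) \<in> R \<longrightarrow> g (l, v) \<noteq> \<beta>)"
  proof (cases "\<alpha> = \<beta>")
    case True
    have "\<forall>r. (u, r) \<in> R \<longrightarrow> f (u, r) \<noteq> \<beta>" "\<forall>l. (l, v) \<in> R \<longrightarrow> f (l, v) \<noteq> \<beta>"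
      using \<alpha>(2) \<beta>(2) True by force+
    then show ?thesis using f by blast
  next
    case False
    have "\<And>r. (u, r) \<in> R \<Longrightarrow> f (u, r) \<noteq> \<alpha>" "\<And>l. (l, v) \<in> R \<Longrightarrow> f (l, v) \<noteq> \<beta>"
      using \<alpha>(2) \<beta>(2) by force+
    then obtain g where g: "proper R g" "g ` R \<subseteq> f ` R \<union> {\<alpha>, \<beta>}"
      "\<And>r. (u, r) \<in> R \<Longrightarrow> g (u, r) \<noteq> \<beta>" "\<And>l. (l, v) \<in> R \<Longrightarrow> g (l, v) \<noteq> \<beta>"
      using kempe_exchange[OF f(1) _ _ False] by metis
    have "f ` R \<union> {\<alpha>, \<beta>} \<subseteq> {..<s}" using f(2) \<alpha>(1) \<beta>(1) by simp
    then have "g ` R \<subseteq> {..<s}" using g(2) by (meson subset_trans)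
    then show ?thesis using g(1,3,4) by blast
  qed
  then obtain g where g: "proper R g" "g ` R \<subseteq> {..<s}"
    "\<And>r. (u, r) \<in> R \<Longrightarrow> g (u, r) \<noteq> \<beta>" "\<And>l. (l, v) \<in> R \<Longrightarrow> g (l, v) \<noteq> \<beta>" by blast
  have "proper (insert a R) (g(a := \<beta>))"
    using g(1,3,4) insert.hyps(2) unfolding proper_def a by (auto split: prod.splits) force+
  moreover have "(g(a := \<beta>)) ` insert a R \<subseteq> {..<s}" using g(2) \<beta>(1) by auto
  ultimately show ?case by blast
qed

text \<open>A colour class of the properly coloured arcs contains at most one arc out of and one arc
  into every vertex, hence has maximum degree at most 2. This is Petersen's two-factor theorem
  without regularity.\<close>

theorem two_factor_decomposition:
  assumes E: "finite E" "\<forall>e\<in>E. card e = 2" and deg: "\<And>v. edeg E v \<le> 2 * s"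
  obtains D :: "nat \<Rightarrow> 'v set set" where "(\<Union>c<s. D c) = E"
    "\<And>c c'. c < s \<Longrightarrow> c' < s \<Longrightarrow> c \<noteq> c' \<Longrightarrow> D c \<inter> D c' = {}" "\<And>c v. edeg (D c) v \<le> 2"
proof -
  obtain R where R: "finite R" "inj_on unarc R" "unarc ` R = E"
    "\<And>v. card {a\<in>R. fst a = v} \<le> s" "\<And>v. card {a\<in>R. snd a = v} \<le> s"
    using balanced_orientation[OF E deg] by blast
  obtain f where f: "proper R f" "f ` R \<subseteq> {..<s}" using koenig_edge_colouring[OF R(1,4,5)] by blast
  define D where "D c = unarc ` {a\<in>R. f a = c}" for c
  show thesis
  proof (rule that[of D])
    show "(\<Union>c<s. D c) = E" unfolding R(3)[symmetric] D_def using f(2) by auto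
    show "D c \<inter> D c' = {}" if "c \<noteq> c'" for c c'
      unfolding D_def using that
      by (subst inj_on_image_Int[OF R(2), symmetric]) auto
    show "edeg (D c) v \<le> 2" for c v
    proof -
      have eq: "a = b" if "a \<in> R" "b \<in> R" "f a = f b" "fst a = fst b \<or> snd a = snd b" for a b
        using f(1) that unfolding proper_def by metis
      have one: "card {a\<in>R. f a = c \<and> fst a = v} \<le> 1" "card {a\<in>R. f a = c \<and> snd a = v} \<le> 1"
        using R(1) by (simp_all add: card_le_Suc0_iff_eq) (metis eq fst_conv snd_conv)+
      have "edeg (D c) v \<le>
        card (unarc ` ({a\<in>R. f a = c \<and> fst a = v} \<union> {a\<in>R. f a = c \<and> snd a = v}))"
        unfolding edeg_def D_def using R(1) by (intro card_mono) auto
      also have "\<dots> \<le> card ({a\<in>R. f a = c \<and> fst a = v} \<union> {a\<in>R. f a = c \<and> snd a = v})"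
        using R(1) by (intro card_image_le) auto
      also have "\<dots> \<le> card {a\<in>R. f a = c \<and> fst a = v} + card {a\<in>R. f a = c \<and> snd a = v}"
        by (rule card_Un_le)
      also have "\<dots> \<le> 2" using one by simp
      finally show ?thesis .
    qed
  qed
qed

section \<open>Alternating decompositions of two-factors\<close>

lemma cycle_edges_rotate: "cycle_edges (xs @ ys) = cycle_edges (ys @ xs)"
  by (cases "xs = []"; cases "ys = []") (auto simp: cycle_edges_def path_edges_append)

lemma edeg_cycle:
  assumes c: "distinct c" "3 \<le> length c" and v: "v \<in> set c"
  shows "edeg (cycle_edges c) v = 2"
proof -
  obtain x y zs where c': "c = x # y # zs" "zs \<noteq> []"
    using c(2) by (cases c; cases "tl c"; cases "tl (tl c)") auto
  have "{last c, hd c} \<notin> path_edges c"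
  proof
    assume "{last c, hd c} \<in> path_edges c"
    then have "{last zs, x} = {x, y} \<or> {last zs, x} \<in> path_edges (y # zs)" using c' by simp
    moreover have "{last zs, x} \<notin> path_edges (y # zs)"
      using c(1) c' path_edges_subset by fastforce
    ultimately show False using c(1) c' last_in_set[OF c'(2)] by (auto simp: doubleton_eq_iff)
  qed
  then have "edeg (cycle_edges c) v = edeg (path_edges c) v + (if v \<in> {last c, hd c} then 1 else 0)"
    unfolding cycle_edges_def by (subst edeg_insert) auto
  then show ?thesis using edeg_path[OF c(1), of v] c(2) v by auto
qed

text \<open>Edges are inserted one at a time. By the degree bound an endpoint of the new edge lies
  on no cycle and, if it lies on a path, is an end of it. The edge thus starts, prolongs or merges
  paths, or it closes a path between mates to a cycle.\<close>

lemma max_degree_two_structure: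
  assumes "finite E" "\<forall>e\<in>E. card e = 2" "\<And>v. edeg E v \<le> 2"
  shows "\<exists>P Q. psys P \<and> finite Q \<and> (\<forall>c\<in>Q. distinct c \<and> 3 \<le> length c) \<and>
    (\<forall>c\<in>Q. \<forall>d\<in>Q. c \<noteq> d \<longrightarrow> set c \<inter> set d = {}) \<and> (\<forall>c\<in>Q. set c \<inter> pverts P = {}) \<and>
    E = pedges P \<union> \<Union>(cycle_edges ` Q)"
  using assms
proof (induction E)
  case empty
  show ?case by (rule exI[of _ "{}"], rule exI[of _ "{}"]) simp
next
  case (insert e E)
  obtain u w where e: "e = {u, w}" "u \<noteq> w" using insert.prems(1) by (auto simp: card_2_iff)
  have le: "edeg E v + (if v \<in> e then 1 else 0) \<le> 2" for v
    using insert.prems(2)[of v] insert.hyps by (simp add: edeg_insert)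
  then have "edeg E v \<le> 2" for v by (metis add_leD1)
  then obtain P Q where PQ: "psys P" "finite Q" "\<forall>c\<in>Q. distinct c \<and> 3 \<le> length c"
    "\<forall>c\<in>Q. \<forall>d\<in>Q. c \<noteq> d \<longrightarrow> set c \<inter> set d = {}" "\<forall>c\<in>Q. set c \<inter> pverts P = {}"
    "E = pedges P \<union> \<Union>(cycle_edges ` Q)"
    using insert.IH insert.prems(1) by auto
  have nQ: "v \<notin> set c" if "v \<in> e" "c \<in> Q" for v c
  proof
    assume "v \<in> set c"
    then have "edeg (cycle_edges c) v = 2" using edeg_cycle[of c v] PQ(3) that(2) by simp
    moreover have "edeg (cycle_edges c) v \<le> edeg E v"
      using PQ(6) that(2) insert.hyps(1) by (intro edeg_mono) auto
    ultimately show False using le[of v] that(1) by simp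
  qed
  have nI: "v \<in> pends P" if "v \<in> e" "v \<in> pverts P" for v
  proof (rule ccontr)
    assume "v \<notin> pends P"
    then have "edeg (pedges P) v = 2" using edeg_psys[OF PQ(1)] that by simp
    moreover have "edeg (pedges P) v \<le> edeg E v"
      using PQ(6) insert.hyps(1) by (intro edeg_mono) auto
    ultimately show False using le[of v] that(1) by simp
  qed
  have grow: ?case if P': "psys P'" "pedges P' = insert e (pedges P)"
    "pverts P' \<subseteq> pverts P \<union> e" for P'
  proof (rule exI[of _ P'], rule exI[of _ Q], intro conjI)
    show "\<forall>c\<in>Q. set c \<inter> pverts P' = {}" using PQ(5) nQ P'(3) by blast
    show "insert e E = pedges P' \<union> \<Union>(cycle_edges ` Q)" using PQ(6) P'(2) by auto
  qed (use PQ P' in auto)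
  consider "u \<notin> pverts P" "w \<notin> pverts P" | "u \<in> pends P" "w \<notin> pverts P"
    | "u \<notin> pverts P" "w \<in> pends P" | "u \<in> pends P" "w \<in> pends P" "\<not> mates P u w"
    | "mates P u w"
    using nI[of u] nI[of w] e by blast
  then show ?case
  proof cases
    case 1
    then show ?thesis using grow[of "insert [u, w] P"] psys_new_edge[OF PQ(1) 1 e(2)] e by auto
  next
    case 2
    obtain P' where "psys P'" "pedges P' = insert {u, w} (pedges P)" "pverts P' = insert w (pverts P)"
      using psys_attach_end[OF PQ(1) 2] by metis
    then show ?thesis using grow[of P'] e by auto
  next
    case 3
    obtain P' where "psys P'" "pedges P' = insert {w, u} (pedges P)" "pverts P' = insert u (pverts P)"
      using psys_attach_end[OF PQ(1) 3(2,1)] by metis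
    then show ?thesis using grow[of P'] e by (auto simp: insert_commute)
  next
    case 4
    obtain P' where "psys P'" "pedges P' = insert {u, w} (pedges P)" "pverts P' = pverts P"
      using psys_join[OF PQ(1) 4(1,2) e(2) 4(3)] by metis
    then show ?thesis using grow[of P'] e by auto
  next
    case 5
    obtain p R where p: "P = insert p R" "p \<notin> R" "psys R" "distinct p" "2 \<le> length p"
      "set p \<inter> pverts R = {}" "{hd p, last p} = {u, w}"
      using psys_mates_split[OF PQ(1) 5] by metis
    \<comment> \<open>A path of two vertices with these ends would already be the edge
      \<open>e\<close>, so the new cycle has at least three vertices.\<close>
    have "length p \<noteq> 2"
    proof
      assume "length p = 2"
      then obtain a b where "p = [a, b]" by (auto simp: length_Suc_conv numeral_2_eq_2)
      then have "e \<in> E" using p(1,7) e PQ(6) by auto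
      then show False using insert.hyps by simp
    qed
    then have len: "3 \<le> length p" using p(5) by simp
    have ce: "cycle_edges p = insert e (path_edges p)"
      using p(7) e by (simp add: cycle_edges_def insert_commute)
    show ?thesis
    proof (rule exI[of _ R], rule exI[of _ "insert p Q"], intro conjI)
      show "\<forall>c\<in>insert p Q. \<forall>d\<in>insert p Q. c \<noteq> d \<longrightarrow> set c \<inter> set d = {}"
        using PQ(4,5) p(1) by auto
      show "\<forall>c\<in>insert p Q. set c \<inter> pverts R = {}" using PQ(5) p(1,6) by auto
      show "insert e E = pedges R \<union> \<Union>(cycle_edges ` insert p Q)" using PQ(6) p(1) ce by auto
    qed (use PQ p len in auto)
  qed
qed

text \<open>Every second edge of the path, as a matching of two-vertex paths without inner vertices.
  The complementary edges are obtained from \<open>alt (tl p)\<close>.\<close>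

fun alt :: "'v list \<Rightarrow> 'v list list" where
  "alt (x # y # zs) = [x, y] # alt zs"
| "alt [x] = []"
| "alt [] = []"

lemma alt_elem: "q \<in> set (alt p) \<Longrightarrow> \<exists>x y. q = [x, y]"
  by (induction p rule: alt.induct) auto

lemma alt_pinner: "pinner (set (alt p)) = {}"
proof -
  have "v \<in> pends (set (alt p))" if v: "v \<in> pverts (set (alt p))" for v
  proof -
    obtain q where q: "q \<in> set (alt p)" "v \<in> set q" using v by (auto simp: pverts_def)
    obtain x y where "q = [x, y]" using alt_elem[OF q(1)] by blast
    then show ?thesis using q by (auto simp: pends_def intro!: bexI[of _ q])
  qed
  then show ?thesis by (auto simp: pinner_def)
qed

lemma alt_pverts: "pverts (set (alt p)) \<subseteq> set p"
  by (induction p rule: alt.induct) auto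

lemma psys_alt: "distinct p \<Longrightarrow> psys (set (alt p))"
proof (induction p rule: alt.induct)
  case (1 x y zs)
  then show ?case using alt_pverts[of zs] by (auto intro!: psys_insertI)
qed auto

lemma alt_edges: "pedges (set (alt p)) \<union> pedges (set (alt (tl p))) = path_edges p"
proof (induction p)
  case (Cons x q)
  then show ?case by (cases q) auto
qed simp

lemma alt_disjoint: "distinct p \<Longrightarrow> pedges (set (alt p)) \<inter> pedges (set (alt (tl p))) = {}"
proof (induction p)
  case (Cons x q)
  show ?case
  proof (cases q)
    case (Cons y zs)
    have "{x, y} \<notin> pedges (set (alt q))"
      using pedges_verts[of "{x, y}" "set (alt q)"] alt_pverts[of q] Cons.prems by auto
    then show ?thesis using Cons.IH Cons.prems Cons by auto
  qed simp
qed simp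

lemma alt_snoc_even: "even (length ms) \<Longrightarrow> alt (ms @ [b]) = alt ms"
  by (induction ms rule: alt.induct) auto

text \<open>The edges of a cycle are coloured alternately; a cycle of odd length has one vertex with two
  edges of the first colour, and this vertex can be prescribed.\<close>

lemma split_cycle:
  assumes c: "distinct c" "3 \<le> length c" and v: "v \<in> set c"
  shows "\<exists>A B. psys A \<and> psys B \<and> pverts A \<subseteq> set c \<and> pverts B \<subseteq> set c \<and>
    pedges A \<union> pedges B = cycle_edges c \<and> pedges A \<inter> pedges B = {} \<and>
    pinner A \<subseteq> {v} \<and> pinner B = {}"
proof -
  obtain xs ys where xy: "c = xs @ v # ys" using v split_list by metis
  define vs where "vs = ys @ xs"
  have ce: "cycle_edges c = cycle_edges (v # vs)"
    using cycle_edges_rotate[of xs "v # ys"] by (simp add: xy vs_def)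
  have d: "distinct (v # vs)" "set c = set (v # vs)" "2 \<le> length vs"
    using c by (auto simp: xy vs_def)
  have vsn: "vs \<noteq> []" using d by auto
  define b where "b = last vs"
  define ns where "ns = butlast vs"
  have "length ns = length vs - 1" by (simp add: ns_def)
  then have vs: "vs = ns @ [b]" "ns \<noteq> []"
    using vsn d(3) by (auto simp: b_def ns_def simp flip: length_greater_0_conv)
  have bv: "b \<noteq> v" "b \<notin> set ns" "v \<notin> set ns" "distinct ns" using d(1) vs by auto
  have cev: "cycle_edges (v # vs) = insert {b, v} (insert {v, hd vs} (path_edges vs))"
    using vs by (cases ns) (auto simp: cycle_edges_def)
  show ?thesis
  proof (cases "even (length ns)")
    case True
    \<comment> \<open>The cycle has even length \<open>length ns + 2\<close>: both classes are
      matchings.\<close>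
    define A where "A = insert [b, v] (set (alt ns))"
    define B where "B = set (alt (v # vs))"
    have altv: "alt vs = alt ns" using alt_snoc_even[OF True] vs by simp
    have "psys A" unfolding A_def
      using psys_alt[OF bv(4)] bv alt_pverts[of ns] by (intro psys_insertI) auto
    moreover have "psys B" unfolding B_def by (rule psys_alt[OF d(1)])
    moreover have "pverts A \<subseteq> set c" "pverts B \<subseteq> set c"
      using alt_pverts[of ns] alt_pverts[of "v # vs"] vs d(2) by (auto simp: A_def B_def)
    moreover have "pedges A \<union> pedges B = cycle_edges c"
    proof -
      have "pedges A = insert {b, v} (pedges (set (alt vs)))" by (simp add: A_def altv)
      moreover have "pedges B \<union> pedges (set (alt vs)) = path_edges (v # vs)"
        using alt_edges[of "v # vs"] by (simp only: B_def list.sel)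
      moreover have "cycle_edges c = insert {b, v} (path_edges (v # vs))"
        using vsn unfolding ce by (simp add: cycle_edges_def b_def)
      ultimately show ?thesis by blast
    qed
    moreover have "pedges A \<inter> pedges B = {}"
    proof -
      obtain y zs where y: "ns = y # zs" using vs(2) by (cases ns) auto
      have "{b, v} \<notin> pedges B"
      proof
        assume "{b, v} \<in> pedges B"
        then have "{b, v} = {v, y} \<or> {b, v} \<in> pedges (set (alt (zs @ [b])))"
          by (simp add: B_def vs(1) y)
        moreover have "{b, v} \<notin> pedges (set (alt (zs @ [b])))"
          using pedges_verts[of "{b, v}"] alt_pverts[of "zs @ [b]"] bv y by fastforce
        ultimately show False using bv y by (auto simp: doubleton_eq_iff)
      qed
      moreover have "pedges (set (alt ns)) \<inter> pedges B = {}"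
        using alt_disjoint[OF d(1)] altv by (auto simp: B_def)
      ultimately show ?thesis by (auto simp: A_def)
    qed
    moreover have "pinner A \<subseteq> {v}" "pinner B = {}"
      using alt_pinner[of ns] alt_pinner[of "v # vs"] by (auto simp: A_def B_def pinner_def)
    ultimately show ?thesis by blast
  next
    case False
    then obtain a ms where ms: "ns = a # ms" "even (length ms)" by (cases ns) auto
    \<comment> \<open>The cycle has odd length: both edges at \<open>v\<close> go into
      \<open>A\<close> as the path \<open>b - v - a\<close>, and the other edges alternate. Only
      \<open>v\<close> becomes an inner vertex.\<close>
    define A where "A = insert [b, v, a] (set (alt ms))"
    define B where "B = set (alt vs)"
    have altv: "alt (tl vs) = alt ms" using alt_snoc_even[OF ms(2)] vs ms by simp
    have "psys A" unfolding A_def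
      using psys_alt[of ms] bv alt_pverts[of ms] ms(1) by (intro psys_insertI) auto
    moreover have "psys B" unfolding B_def using psys_alt d(1) by auto
    moreover have "pverts A \<subseteq> set c" "pverts B \<subseteq> set c"
      using alt_pverts[of ms] alt_pverts[of "vs"] vs ms d(2) by (auto simp: A_def B_def)
    moreover have "pedges A \<union> pedges B = cycle_edges c"
    proof -
      have "pedges A = insert {b, v} (insert {v, hd vs} (pedges (set (alt (tl vs)))))"
        unfolding altv using vs ms by (simp add: A_def)
      moreover have "pedges B \<union> pedges (set (alt (tl vs))) = path_edges vs"
        using alt_edges[of vs] by (simp only: B_def)
      ultimately show ?thesis unfolding ce cev by blast
    qed
    moreover have "pedges A \<inter> pedges B = {}"
    proof -
      have "e \<notin> pedges B" if "v \<in> e" for e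
        using pedges_verts[of e B] alt_pverts[of vs] d(1) that by (auto simp: B_def)
      moreover have "pedges (set (alt ms)) \<inter> pedges B = {}"
        using alt_disjoint[of vs] altv d(1) by (auto simp: B_def)
      ultimately show ?thesis by (auto simp: A_def)
    qed
    moreover have "pinner A \<subseteq> {v}" "pinner B = {}"
      using alt_pinner[of ms] alt_pinner[of vs] by (auto simp: A_def B_def pinner_def)
    ultimately show ?thesis by blast
  qed
qed

lemma psys_UN:
  assumes "finite S" "\<And>z. z \<in> S \<Longrightarrow> psys (A z) \<and> pverts (A z) \<subseteq> V z"
    and "\<And>z z'. z \<in> S \<Longrightarrow> z' \<in> S \<Longrightarrow> z \<noteq> z' \<Longrightarrow> V z \<inter> V z' = {}"
  shows "psys (\<Union>z\<in>S. A z)"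
  unfolding psys_def
proof (intro conjI ballI impI)
  show "finite (\<Union>z\<in>S. A z)" using assms psysD(1) by blast
next
  fix p assume "p \<in> (\<Union>z\<in>S. A z)"
  then show "distinct p" "2 \<le> length p" using assms(2) psysD(2,3) by blast+
next
  fix p r assume "p \<in> (\<Union>z\<in>S. A z)" "r \<in> (\<Union>z\<in>S. A z)" and ne: "p \<noteq> r"
  then obtain z z' where z: "z \<in> S" "p \<in> A z" "z' \<in> S" "r \<in> A z'" by blast
  show "set p \<inter> set r = {}"
  proof (cases "z = z'")
    case True
    then have "psys (A z)" "r \<in> A z" using z assms(2) by auto
    then show ?thesis using z(2) ne unfolding psys_def by blast
  next
    case False
    have "set p \<subseteq> V z" "set r \<subseteq> V z'" using z assms(2) by (auto simp: pverts_def)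
    then show ?thesis using assms(3)[OF z(1,3) False] by blast
  qed
qed

lemma pedges_UN: "pedges (\<Union>z\<in>S. A z) = (\<Union>z\<in>S. pedges (A z))"
  by (auto simp: pedges_def)

lemma pinner_UN: "pinner (\<Union>z\<in>S. A z) \<subseteq> (\<Union>z\<in>S. pinner (A z))"
  by (auto simp: pinner_def pverts_def pends_def)

text \<open>\<open>X\<close> holds the prospective assigned ends. The vertex doubled on a cycle is
  taken outside \<open>X\<close> unless the whole cycle lies in \<open>X\<close>. Two disjoint
  cycles would need six vertices, so with \<open>card X \<le> 4\<close> at most one member of
  \<open>X\<close> becomes inner, and it does so in \<open>A\<close>.\<close>

theorem split_two_factor:
  assumes E: "finite E" "\<forall>e\<in>E. card e = 2" "\<And>v. edeg E v \<le> 2"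
    and X: "finite X" "card X \<le> 4"
  obtains A B where "psys A" "psys B" "pedges A \<union> pedges B = E" "pedges A \<inter> pedges B = {}"
    "pinner B = {}" "\<And>v v'. v \<in> X \<Longrightarrow> v' \<in> X \<Longrightarrow> v \<in> pinner A \<Longrightarrow> v' \<in> pinner A \<Longrightarrow> v = v'"
proof -
  obtain P Q where PQ: "psys P" "finite Q" "\<forall>c\<in>Q. distinct c \<and> 3 \<le> length c"
    "\<forall>c\<in>Q. \<forall>d\<in>Q. c \<noteq> d \<longrightarrow> set c \<inter> set d = {}" "\<forall>c\<in>Q. set c \<inter> pverts P = {}"
    "E = pedges P \<union> \<Union>(cycle_edges ` Q)"
    using max_degree_two_structure[OF E] by blast
  have PQ_disj: "P \<inter> Q = {}"
  proof -
    have "c \<notin> P" if "c \<in> Q" for c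
    proof
      assume "c \<in> P"
      then have "set c \<subseteq> pverts P" by (auto simp: pverts_def)
      moreover have "set c \<noteq> {}"
      proof -
        have "3 \<le> length c" using PQ(3) that by blast
        then show ?thesis by auto
      qed
      ultimately show False using PQ(5) that by (metis Int_absorb2)
    qed
    then show ?thesis by blast
  qed
  define ed where "ed z = (if z \<in> P then path_edges z else cycle_edges z)" for z
  have disj: "set z \<inter> set z' = {}" if zz: "z \<in> P \<union> Q" "z' \<in> P \<union> Q" "z \<noteq> z'" for z z'
  proof -
    consider "z \<in> P" "z' \<in> P" | "z \<in> P" "z' \<in> Q" | "z \<in> Q" "z' \<in> P" | "z \<in> Q" "z' \<in> Q"
      using zz(1,2) by blast
    then show ?thesis
    proof cases
      case 1
      then show ?thesis using PQ(1) zz(3) unfolding psys_def by blast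
    next
      case 2
      then show ?thesis using PQ(5) by (auto simp: pverts_def)
    next
      case 3
      then show ?thesis using PQ(5) by (auto simp: pverts_def)
    next
      case 4
      then show ?thesis using PQ(4) zz(3) by blast
    qed
  qed
  have "\<forall>z\<in>P \<union> Q. \<exists>AB. psys (fst AB) \<and> psys (snd AB) \<and>
    pverts (fst AB) \<subseteq> set z \<and> pverts (snd AB) \<subseteq> set z \<and>
    pedges (fst AB) \<union> pedges (snd AB) = ed z \<and> pedges (fst AB) \<inter> pedges (snd AB) = {} \<and>
    pinner (snd AB) = {} \<and>
    (\<forall>v\<in>pinner (fst AB). \<forall>v'\<in>pinner (fst AB). v = v') \<and>
    (\<forall>v\<in>pinner (fst AB). v \<in> X \<longrightarrow> 3 \<le> card (set z) \<and> set z \<subseteq> X)"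
  proof
    fix z assume z: "z \<in> P \<union> Q"
    show "\<exists>AB. psys (fst AB) \<and> psys (snd AB) \<and>
      pverts (fst AB) \<subseteq> set z \<and> pverts (snd AB) \<subseteq> set z \<and>
      pedges (fst AB) \<union> pedges (snd AB) = ed z \<and> pedges (fst AB) \<inter> pedges (snd AB) = {} \<and>
      pinner (snd AB) = {} \<and>
      (\<forall>v\<in>pinner (fst AB). \<forall>v'\<in>pinner (fst AB). v = v') \<and>
      (\<forall>v\<in>pinner (fst AB). v \<in> X \<longrightarrow> 3 \<le> card (set z) \<and> set z \<subseteq> X)"
    proof (cases "z \<in> P")
      case True
      have "distinct z" "distinct (tl z)" using psysD(2)[OF PQ(1) True] by (auto simp: distinct_tl)
      moreover have "set (tl z) \<subseteq> set z" by (cases z) auto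
      then have "pverts (set (alt (tl z))) \<subseteq> set z" using alt_pverts[of "tl z"] by blast
      ultimately show ?thesis
        using True alt_pverts[of z] psys_alt[of z] psys_alt[of "tl z"] alt_edges[of z]
          alt_disjoint[of z] alt_pinner[of z] alt_pinner[of "tl z"]
        by (intro exI[of _ "(set (alt z), set (alt (tl z)))"]) (simp add: ed_def)
    next
      case False
      then have zc: "z \<in> Q" "distinct z" "3 \<le> length z" using z PQ(3) by auto
      then have zn: "z \<noteq> []" by auto
      \<comment> \<open>Either some vertex of the cycle outside \<open>X\<close> is taken, or the
        cycle is contained in \<open>X\<close> and any vertex will do.\<close>
      obtain v where v: "v \<in> set z" "v \<in> X \<longrightarrow> set z \<subseteq> X"
        using zn by (metis hd_in_set subsetI)
      obtain A B where AB: "psys A" "psys B" "pverts A \<subseteq> set z" "pverts B \<subseteq> set z"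
        "pedges A \<union> pedges B = cycle_edges z" "pedges A \<inter> pedges B = {}"
        "pinner A \<subseteq> {v}" "pinner B = {}"
        using split_cycle[OF zc(2,3) v(1)] by blast
      have "3 \<le> card (set z)" using zc distinct_card by metis
      moreover have "\<forall>x\<in>pinner A. x = v" using AB(7) by blast
      ultimately show ?thesis
        using AB v False by (intro exI[of _ "(A, B)"]) (auto simp: ed_def)
    qed
  qed
  then obtain AB where AB: "\<And>z. z \<in> P \<union> Q \<Longrightarrow> psys (fst (AB z)) \<and> psys (snd (AB z)) \<and>
    pverts (fst (AB z)) \<subseteq> set z \<and> pverts (snd (AB z)) \<subseteq> set z \<and>
    pedges (fst (AB z)) \<union> pedges (snd (AB z)) = ed z \<and>
    pedges (fst (AB z)) \<inter> pedges (snd (AB z)) = {} \<and>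
    pinner (snd (AB z)) = {} \<and>
    (\<forall>v\<in>pinner (fst (AB z)). \<forall>v'\<in>pinner (fst (AB z)). v = v') \<and>
    (\<forall>v\<in>pinner (fst (AB z)). v \<in> X \<longrightarrow> 3 \<le> card (set z) \<and> set z \<subseteq> X)"
    by metis
  define A where "A z = fst (AB z)" for z
  define B where "B z = snd (AB z)" for z
  note AB' = AB[folded A_def B_def]
  have bad: "3 \<le> card (set z) \<and> set z \<subseteq> X" if "z \<in> P \<union> Q" "v \<in> pinner (A z)" "v \<in> X" for z v
    using AB'[OF that(1)] that(2,3) by metis
  have uniq: "v = v'" if "z \<in> P \<union> Q" "v \<in> pinner (A z)" "v' \<in> pinner (A z)" for z v v'
    using AB'[OF that(1)] that(2,3) by metis
  have fin: "finite (P \<union> Q)" using PQ(2) psysD(1)[OF PQ(1)] by simp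
  have ed: "(\<Union>z\<in>P \<union> Q. ed z) = E"
  proof -
    have "(\<Union>z\<in>P. ed z) = pedges P" by (auto simp: ed_def pedges_def)
    moreover have "(\<Union>z\<in>Q. ed z) = \<Union>(cycle_edges ` Q)" using PQ_disj by (auto simp: ed_def)
    ultimately show ?thesis using PQ(6) by (simp add: UN_Un)
  qed
  show thesis
  proof (rule that[of "\<Union>z\<in>P \<union> Q. A z" "\<Union>z\<in>P \<union> Q. B z"])
    show "psys (\<Union>z\<in>P \<union> Q. A z)" "psys (\<Union>z\<in>P \<union> Q. B z)"
      using AB' disj by (intro psys_UN[OF fin, of _ set]; blast)+
    show "pedges (\<Union>z\<in>P \<union> Q. A z) \<union> pedges (\<Union>z\<in>P \<union> Q. B z) = E"
    proof -
      have "pedges (\<Union>z\<in>P \<union> Q. A z) \<union> pedges (\<Union>z\<in>P \<union> Q. B z) =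
        (\<Union>z\<in>P \<union> Q. pedges (A z) \<union> pedges (B z))" unfolding pedges_UN by blast
      also have "\<dots> = (\<Union>z\<in>P \<union> Q. ed z)" using AB' by (intro SUP_cong) auto
      finally show ?thesis using ed by simp
    qed
    show "pedges (\<Union>z\<in>P \<union> Q. A z) \<inter> pedges (\<Union>z\<in>P \<union> Q. B z) = {}"
    proof (rule ccontr)
      assume "\<not> ?thesis"
      then obtain e z z' where e: "z \<in> P \<union> Q" "z' \<in> P \<union> Q" "e \<in> pedges (A z)" "e \<in> pedges (B z')"
        unfolding pedges_UN by blast
      have "e \<subseteq> set z" "e \<subseteq> set z'" "e \<noteq> {}"
        using AB'[OF e(1)] AB'[OF e(2)] e(3,4) pedges_verts[OF e(3)] pedges_verts[OF e(4)]
          pedges_card[OF _ e(3)] by auto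
      then have "z = z'" using disj[OF e(1,2)] by blast
      then show False using AB'[OF e(1)] e(3,4) by blast
    qed
    show "pinner (\<Union>z\<in>P \<union> Q. B z) = {}" using pinner_UN[of B "P \<union> Q"] AB' by blast
    fix v v' assume v: "v \<in> X" "v' \<in> X" "v \<in> pinner (\<Union>z\<in>P \<union> Q. A z)"
      "v' \<in> pinner (\<Union>z\<in>P \<union> Q. A z)"
    obtain z z' where z: "z \<in> P \<union> Q" "z' \<in> P \<union> Q" "v \<in> pinner (A z)" "v' \<in> pinner (A z')"
      using v(3,4) pinner_UN[of A "P \<union> Q"] by blast
    have c: "3 \<le> card (set z)" "set z \<subseteq> X" "3 \<le> card (set z')" "set z' \<subseteq> X"
      using bad[OF z(1,3) v(1)] bad[OF z(2,4) v(2)] by auto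
    have "z = z'"
    proof (rule ccontr)
      assume "z \<noteq> z'"
      then have "card (set z \<union> set z') = card (set z) + card (set z')"
        using disj[OF z(1,2)] by (intro card_Un_disjoint) auto
      moreover have "card (set z \<union> set z') \<le> card X" using c X(1) by (intro card_mono) auto
      ultimately show False using c X(2) by linarith
    qed
    then show "v = v'" using uniq[OF z(1,3)] z(4) by simp
  qed
qed

section \<open>Prescribed ends\<close>

abbreviation count_if :: "('b \<Rightarrow> bool) \<Rightarrow> 'b list \<Rightarrow> nat" where
  "count_if Q xs \<equiv> length (filter Q xs)"

text \<open>A colour is a path system that is to be turned into a single path with the two prescribed
  ends.\<close>

type_synonym 'v colour = "'v list set \<times> 'v \<times> 'v"

definition targets :: "'v colour \<Rightarrow> 'v set" where
  "targets c = {fst (snd c), snd (snd c)}"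

text \<open>These are the conditions under which \<open>a\<close> and \<open>b\<close> can be linked
  through a new vertex: an inner vertex has no room for another edge, and linking mates would close
  a cycle. Vertices outside the system are allowed as targets.\<close>

definition good :: "'v colour \<Rightarrow> bool" where
  "good c \<longleftrightarrow> (case c of (P, a, b) \<Rightarrow>
     psys P \<and> a \<noteq> b \<and> a \<notin> pinner P \<and> b \<notin> pinner P \<and> \<not> mates P a b)"

text \<open>The link \<open>a - \<omega> - b\<close> replaces the search for a path with two
  prescribed ends by the search for a cycle through \<open>\<omega>\<close> whose edges at
  \<open>\<omega>\<close> are already fixed. It toggles the end status of \<open>a\<close> and of
  \<open>b\<close>.\<close>

lemma close_targets:
  assumes "good (P, a, b)" and \<omega>: "\<omega> \<notin> pverts P" "\<omega> \<noteq> a" "\<omega> \<noteq> b"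
  obtains P' where "psys P'" "P' \<noteq> {}" "pedges P' = pedges P \<union> {{a, \<omega>}, {b, \<omega>}}"
    "pverts P' = pverts P \<union> {a, b, \<omega>}" "pends P' = sym_diff (pends P) {a, b}"
proof -
  have P: "psys P" and ab: "a \<noteq> b" "\<not> mates P a b"
    and a: "a \<in> pends P \<or> a \<notin> pverts P" and b: "b \<in> pends P \<or> b \<notin> pverts P"
    using assms(1) by (auto simp: good_def pinner_def)
  have sub: "pends P \<subseteq> pverts P" by (rule pends_subset[OF P])
  \<comment> \<open>First only \<open>a\<close> is linked, by prolonging its path or by a new one.
    The last conjunct records that \<open>\<omega>\<close> may still be joined to
    \<open>b\<close>.\<close>
  have "\<exists>P1. psys P1 \<and> pedges P1 = insert {a, \<omega>} (pedges P) \<and> pverts P1 = pverts P \<union> {a, \<omega>} \<and>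
      pends P1 = insert \<omega> (sym_diff (pends P) {a}) \<and> \<not> mates P1 \<omega> b"
    using a
  proof
    assume a: "a \<in> pends P"
    obtain P1 where P1: "psys P1" "pedges P1 = insert {a, \<omega>} (pedges P)"
      "pverts P1 = insert \<omega> (pverts P)" "pends P1 = insert \<omega> (pends P - {a})"
      "\<And>z. mates P1 \<omega> z \<longleftrightarrow> mates P a z"
      using psys_attach_end[OF P a \<omega>(1)] by metis
    have "sym_diff (pends P) {a} = pends P - {a}" using a by auto
    then show ?thesis using P1 ab a sub by (intro exI[of _ P1]) auto
  next
    assume a: "a \<notin> pverts P"
    have "sym_diff (pends P) {a} = insert a (pends P)" using a sub by auto
    then show ?thesis
      using psys_new_edge[OF P a \<omega>(1) \<omega>(2)[symmetric]] ab
      by (intro exI[of _ "insert [a, \<omega>] P"]) auto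
  qed
  then obtain P1 where P1: "psys P1" "pedges P1 = insert {a, \<omega>} (pedges P)"
    "pverts P1 = pverts P \<union> {a, \<omega>}" "pends P1 = insert \<omega> (sym_diff (pends P) {a})"
    "\<not> mates P1 \<omega> b" by blast
  have \<omega>1: "\<omega> \<in> pends P1" using P1(4) by simp
  have \<omega>n: "\<omega> \<notin> pends P" using \<omega>(1) sub by blast
  show thesis
    using b
  proof
    assume b: "b \<in> pends P"
    then have b1: "b \<in> pends P1" using P1(4) ab by auto
    obtain P2 where P2: "psys P2" "pedges P2 = insert {\<omega>, b} (pedges P1)"
      "pverts P2 = pverts P1" "pends P2 = pends P1 - {\<omega>, b}"
      using psys_join[OF P1(1) \<omega>1 b1 \<omega>(3) P1(5)] by metis
    show thesis
    proof (rule that[of P2])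
      show "pends P2 = sym_diff (pends P) {a, b}" using P2(4) P1(4) b ab \<omega>n \<omega> by auto
      show "P2 \<noteq> {}" using P2(2) by auto
      show "psys P2" by (rule P2(1))
      show "pedges P2 = pedges P \<union> {{a, \<omega>}, {b, \<omega>}}"
        unfolding P2(2) P1(2) by (simp add: insert_commute)
      show "pverts P2 = pverts P \<union> {a, b, \<omega>}" unfolding P2(3) P1(3) using b sub by auto
    qed
  next
    assume b: "b \<notin> pverts P"
    then have b1: "b \<notin> pverts P1" using P1(3) ab \<omega> by auto
    obtain P2 where P2: "psys P2" "pedges P2 = insert {\<omega>, b} (pedges P1)"
      "pverts P2 = insert b (pverts P1)" "pends P2 = insert b (pends P1 - {\<omega>})"
      using psys_attach_end[OF P1(1) \<omega>1 b1] by metis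
    show thesis
    proof (rule that[of P2])
      show "pends P2 = sym_diff (pends P) {a, b}" using P2(4) P1(4) b ab \<omega>n \<omega> sub by auto
      show "P2 \<noteq> {}" using P2(2) by auto
      show "psys P2" by (rule P2(1))
      show "pedges P2 = pedges P \<union> {{a, \<omega>}, {b, \<omega>}}"
        unfolding P2(2) P1(2) by (simp add: insert_commute)
      show "pverts P2 = pverts P \<union> {a, b, \<omega>}" unfolding P2(3) P1(3) using b sub by auto
    qed
  qed
qed

text \<open>This undoes \<open>close_targets\<close>: the two given edges are all the edges of the
  cycle at \<open>\<omega>\<close>, so deleting \<open>\<omega>\<close> leaves a path.\<close>

lemma open_cycle:
  assumes c: "distinct c" and e: "{a, \<omega>} \<in> cycle_edges c" "{b, \<omega>} \<in> cycle_edges c"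
    and ne: "a \<noteq> b" "\<omega> \<noteq> a" "\<omega> \<noteq> b"
  obtains p where "p \<noteq> []" "distinct p" "set p \<subseteq> set c - {\<omega>}"
    "cycle_edges c = path_edges p \<union> {{a, \<omega>}, {b, \<omega>}}"
proof -
  have cs: "cycle_edges c \<subseteq> Pow (set c)" if "c \<noteq> []"
    using that path_edges_subset by (auto simp: cycle_edges_def)
  have cn: "c \<noteq> []" using e ne by (auto simp: cycle_edges_def doubleton_eq_iff)
  then have m: "a \<in> set c" "\<omega> \<in> set c" using cs e by blast+
  then obtain xs ys where xy: "c = xs @ \<omega> # ys" using split_list by metis
  define p where "p = ys @ xs"
  have ce: "cycle_edges c = cycle_edges (\<omega> # p)"
    using cycle_edges_rotate[of xs "\<omega> # ys"] by (simp add: xy p_def)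
  have p: "distinct p" "set c = insert \<omega> (set p)" "\<omega> \<notin> set p" using c by (auto simp: xy p_def)
  then have pn: "p \<noteq> []" using m ne by auto
  have ce': "cycle_edges (\<omega> # p) = path_edges p \<union> {{hd p, \<omega>}, {last p, \<omega>}}"
    using pn by (cases p) (auto simp: cycle_edges_def)
  have "{x, \<omega>} \<notin> path_edges p" for x using path_edges_subset[of "{x, \<omega>}" p] p(3) by auto
  then have "{a, \<omega>} \<in> {{hd p, \<omega>}, {last p, \<omega>}}" "{b, \<omega>} \<in> {{hd p, \<omega>}, {last p, \<omega>}}"
    using e unfolding ce ce' by auto
  then have "{{hd p, \<omega>}, {last p, \<omega>}} = {{a, \<omega>}, {b, \<omega>}}"
    using ne by (auto simp: doubleton_eq_iff)
  then show thesis using that[of p] pn p ce ce' by auto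
qed

text \<open>After the targets are linked to a common \<open>\<omega>\<close>, the parity hypothesis
  becomes the evenness of ends required by \<open>cycle_completion\<close>. The edges at
  \<open>\<omega>\<close> count as given edges there, not as added ones, and disappear when the
  cycles are opened. What remains beyond the systems are added edges, each occurring evenly
  often.\<close>

theorem paths_from_colours:
  fixes cs :: "'v colour list"
  assumes good: "\<And>c. c \<in> set cs \<Longrightarrow> good c"
    and par: "\<And>v. even (count_if (\<lambda>c. v \<in> pends (fst c)) cs) \<longleftrightarrow>
      even (count_if (\<lambda>c. v \<in> targets c) cs)"
    and Z: "infinite Z"
  shows "\<exists>ps. length ps = length cs \<and>
    (\<forall>p\<in>set ps. p \<noteq> [] \<and> distinct p \<and>
       set p \<subseteq> (\<Union>c\<in>set cs. pverts (fst c) \<union> targets c) \<union> Z) \<and>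
    (\<forall>e. even (count_if (\<lambda>p. e \<in> path_edges p) ps) \<longleftrightarrow>
       even (count_if (\<lambda>c. e \<in> pedges (fst c)) cs))"
proof -
  let ?V = "\<Union>c\<in>set cs. pverts (fst c) \<union> targets c"
  have gs: "psys (fst c)" if "c \<in> set cs" for c
    using good[OF that] by (auto simp: good_def split: prod.splits)
  have "finite ?V" using gs finite_pverts by (auto simp: targets_def)
  then obtain \<omega> where \<omega>: "\<omega> \<in> Z" "\<omega> \<notin> ?V" using Z by (meson finite_subset subsetI)
  define I where "I = {..<length cs}"
  define a where "a i = fst (snd (cs ! i))" for i
  define b where "b i = snd (snd (cs ! i))" for i
  define P where "P i = fst (cs ! i)" for i
  have I: "cs ! i \<in> set cs" "good (P i, a i, b i)" "targets (cs ! i) = {a i, b i}"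
    if "i \<in> I" for i
    using that good[of "cs ! i"] by (auto simp: I_def P_def a_def b_def targets_def)
  have cnt: "count_if Q cs = card {i\<in>I. Q (cs ! i)}" for Q
    unfolding I_def by (simp add: length_filter_conv_card)
  have \<omega>i: "\<omega> \<notin> pverts (P i)" "\<omega> \<noteq> a i" "\<omega> \<noteq> b i" if "i \<in> I" for i
    using I(1,3)[OF that] \<omega>(2) unfolding P_def by blast+
  have "\<forall>i\<in>I. \<exists>P'. psys P' \<and> P' \<noteq> {} \<and> pedges P' = pedges (P i) \<union> {{a i, \<omega>}, {b i, \<omega>}} \<and>
    pverts P' = pverts (P i) \<union> {a i, b i, \<omega>} \<and> pends P' = sym_diff (pends (P i)) {a i, b i}"
  proof
    fix i assume i: "i \<in> I"
    show "\<exists>P'. psys P' \<and> P' \<noteq> {} \<and> pedges P' = pedges (P i) \<union> {{a i, \<omega>}, {b i, \<omega>}} \<and>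
      pverts P' = pverts (P i) \<union> {a i, b i, \<omega>} \<and> pends P' = sym_diff (pends (P i)) {a i, b i}"
      by (rule close_targets[OF I(2)[OF i] \<omega>i[OF i]]) blast
  qed
  then obtain F where F: "\<And>i. i \<in> I \<Longrightarrow> psys (F i) \<and> F i \<noteq> {} \<and>
    pedges (F i) = pedges (P i) \<union> {{a i, \<omega>}, {b i, \<omega>}} \<and>
    pverts (F i) = pverts (P i) \<union> {a i, b i, \<omega>} \<and> pends (F i) = sym_diff (pends (P i)) {a i, b i}"
    by metis
  have finI: "finite I" by (simp add: I_def)
  have "even (card {i\<in>I. v \<in> pends (F i)})" for v
  proof -
    have eq: "{i\<in>I. v \<in> targets (cs ! i)} = {i\<in>I. v \<in> {a i, b i}}" using I(3) by auto
    have "even (card {i\<in>I. v \<in> pends (P i)}) \<longleftrightarrow> even (card {i\<in>I. v \<in> {a i, b i}})"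
      using par[of v] unfolding cnt eq P_def .
    moreover have "even (card {i\<in>I. v \<in> pends (F i)}) \<longleftrightarrow>
      (even (card {i\<in>I. v \<in> pends (P i)}) \<longleftrightarrow> even (card {i\<in>I. v \<in> {a i, b i}}))"
      by (rule even_card_xor[OF finI]) (use F in auto)
    ultimately show ?thesis by simp
  qed
  then have "\<exists>c. (\<forall>i\<in>I. distinct (c i) \<and> c i \<noteq> [] \<and> set (c i) \<subseteq> pverts (F i) \<union> Z \<and>
      pedges (F i) \<subseteq> cycle_edges (c i)) \<and>
    (\<forall>e. even (card {i\<in>I. e \<in> cycle_edges (c i) - pedges (F i)}))"
    using F by (intro cycle_completion[OF finI _ _ Z]) auto
  then obtain c where c: "\<And>i. i \<in> I \<Longrightarrow> distinct (c i) \<and> c i \<noteq> [] \<and>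
      set (c i) \<subseteq> pverts (F i) \<union> Z \<and> pedges (F i) \<subseteq> cycle_edges (c i)"
    "\<And>e. even (card {i\<in>I. e \<in> cycle_edges (c i) - pedges (F i)})" by blast
  have "\<forall>i\<in>I. \<exists>p. p \<noteq> [] \<and> distinct p \<and> set p \<subseteq> set (c i) - {\<omega>} \<and>
    cycle_edges (c i) = path_edges p \<union> {{a i, \<omega>}, {b i, \<omega>}}"
  proof
    fix i assume i: "i \<in> I"
    have "{a i, \<omega>} \<in> cycle_edges (c i)" "{b i, \<omega>} \<in> cycle_edges (c i)" "a i \<noteq> b i"
      using c(1)[OF i] F[OF i] I(2)[OF i] by (auto simp: good_def)
    then show "\<exists>p. p \<noteq> [] \<and> distinct p \<and> set p \<subseteq> set (c i) - {\<omega>} \<and>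
      cycle_edges (c i) = path_edges p \<union> {{a i, \<omega>}, {b i, \<omega>}}"
      using open_cycle[of "c i" "a i" \<omega> "b i"] c(1)[OF i] \<omega>i[OF i] by metis
  qed
  then obtain p where p: "\<And>i. i \<in> I \<Longrightarrow> p i \<noteq> [] \<and> distinct (p i) \<and> set (p i) \<subseteq> set (c i) - {\<omega>} \<and>
    cycle_edges (c i) = path_edges (p i) \<union> {{a i, \<omega>}, {b i, \<omega>}}" by metis
  show ?thesis
  proof (intro exI[of _ "map p [0..<length cs]"] conjI ballI allI)
    fix q assume "q \<in> set (map p [0..<length cs])"
    then obtain i where i: "i \<in> I" "q = p i" by (auto simp: I_def)
    show "q \<noteq> []" "distinct q" using p[OF i(1)] i(2) by auto
    have "set q \<subseteq> pverts (F i) \<union> Z - {\<omega>}" using p[OF i(1)] c(1)[OF i(1)] i(2) by blast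
    also have "\<dots> \<subseteq> ?V \<union> Z" using F[OF i(1)] I(1,3)[OF i(1)] unfolding P_def by blast
    finally show "set q \<subseteq> ?V \<union> Z" .
  next
    fix e
    have notin: "e \<notin> pedges (P i)" "e \<notin> path_edges (p i)" if "\<omega> \<in> e" "i \<in> I" for i
      using that \<omega>i[OF that(2)] p[OF that(2)] pedges_verts[of e "P i"]
        path_edges_subset[of e "p i"] by auto
    have "count_if (\<lambda>p. e \<in> path_edges p) (map p [0..<length cs]) =
      card {i\<in>I. e \<in> path_edges (p i)}"
      unfolding length_filter_conv_card I_def
      by (rule arg_cong[where f=card]) auto
    moreover have "even (card {i\<in>I. e \<in> path_edges (p i)}) \<longleftrightarrow> even (card {i\<in>I. e \<in> pedges (P i)})"
    proof -
      have "even (card {i\<in>I. e \<in> path_edges (p i)}) \<longleftrightarrow> (even (card {i\<in>I. e \<in> pedges (P i)}) \<longleftrightarrow>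
        even (card {i\<in>I. e \<in> cycle_edges (c i) - pedges (F i)}))"
      proof (rule even_card_xor[OF finI])
        fix i assume i: "i \<in> I"
        have "pedges (F i) \<subseteq> cycle_edges (c i)" using c(1)[OF i] by simp
        moreover have ce: "cycle_edges (c i) = path_edges (p i) \<union> {{a i, \<omega>}, {b i, \<omega>}}"
          using p[OF i] by simp
        moreover have fe: "pedges (F i) = pedges (P i) \<union> {{a i, \<omega>}, {b i, \<omega>}}"
          using F[OF i] by simp
        ultimately have sub: "e \<in> pedges (P i) \<Longrightarrow>
          e \<in> path_edges (p i) \<or> e = {a i, \<omega>} \<or> e = {b i, \<omega>}" by blast
        have "e \<in> pedges (P i) \<Longrightarrow> e \<in> path_edges (p i)"
          using sub notin(1)[OF _ i] by blast
        moreover have "e \<in> path_edges (p i) \<Longrightarrow> e \<noteq> {a i, \<omega>} \<and> e \<noteq> {b i, \<omega>}"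
          using notin(2)[OF _ i] by blast
        ultimately show "e \<in> path_edges (p i) \<longleftrightarrow>
          (e \<in> pedges (P i)) \<noteq> (e \<in> cycle_edges (c i) - pedges (F i))"
          unfolding ce fe by blast
      qed
      then show ?thesis using c(2) by simp
    qed
    ultimately show "even (count_if (\<lambda>p. e \<in> path_edges p) (map p [0..<length cs])) \<longleftrightarrow>
       even (count_if (\<lambda>c. e \<in> pedges (fst c)) cs)"
      unfolding cnt P_def by simp
  qed simp
qed


section \<open>Assigning ends to two-factors\<close>

lemma card_4_split:
  assumes "card X = 4" "b \<in> X"
  obtains x y z where "X = {b, x, y, z}" "distinct [b, x, y, z]"
proof -
  have "card (X - {b}) = 3" using assms by (simp add: card_gt_0_iff)
  then obtain x y z where "X - {b} = {x, y, z}" "x \<noteq> y" "x \<noteq> z" "y \<noteq> z"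
    by (auto simp: card_3_iff)
  then show thesis using that[of x y z] assms(2) by auto
qed

text \<open>The only vertex \<open>b\<close> of \<open>X\<close> that may be inner in
  \<open>A\<close> becomes a target of \<open>B\<close>, where nothing is inner. It remains to
  choose its partner so that neither pair consists of mates.\<close>

lemma four_targets:
  assumes D: "finite D" "\<forall>e\<in>D. card e = 2" "\<And>v. edeg D v \<le> 2" and X: "card X = 4"
  shows "\<exists>c c'. good c \<and> good c' \<and> targets c \<union> targets c' = X \<and> targets c \<inter> targets c' = {} \<and>
    pedges (fst c) \<union> pedges (fst c') = D \<and> pedges (fst c) \<inter> pedges (fst c') = {}"
proof -
  have "finite X" using X by (simp add: card_ge_0_finite)
  then obtain A B where AB: "psys A" "psys B" "pedges A \<union> pedges B = D" "pedges A \<inter> pedges B = {}"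
    "pinner B = {}" "\<And>v v'. v \<in> X \<Longrightarrow> v' \<in> X \<Longrightarrow> v \<in> pinner A \<Longrightarrow> v' \<in> pinner A \<Longrightarrow> v = v'"
    using split_two_factor[OF D, of X] X by (metis order_refl)
  obtain b where b: "b \<in> X" "\<And>v. v \<in> X \<Longrightarrow> v \<noteq> b \<Longrightarrow> v \<notin> pinner A"
  proof (cases "\<exists>b\<in>X. b \<in> pinner A")
    case True
    then show ?thesis using that AB(6) by metis
  next
    case False
    moreover have "X \<noteq> {}" using X by auto
    ultimately show ?thesis using that by blast
  qed
  obtain x y z where X': "X = {b, x, y, z}" and d: "distinct [b, x, y, z]"
    using card_4_split[OF X b(1)] by metis
  have A1: "mates A u v \<Longrightarrow> mates A u v' \<Longrightarrow> v = v'" "mates A v u \<Longrightarrow> mates A u v'  \<Longrightarrow> v = v'"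
    "mates A v u \<Longrightarrow> mates A v' u \<Longrightarrow> v = v'" for u v v'
    using mates_unique[OF AB(1)] mates_sym by metis+
  have B1: "mates B u v \<Longrightarrow> mates B u v' \<Longrightarrow> v = v'" for u v v'
    using mates_unique[OF AB(2)] by metis
  \<comment> \<open>Of the three possible partners of \<open>b\<close>, at most one is its mate in
    \<open>B\<close>, and at most one leaves a pair of mates for \<open>A\<close>, since
    \<open>x\<close>, \<open>y\<close>, \<open>z\<close> contain at most one such pair. So one
    choice is left.\<close>
  have "(\<not> mates A x y \<and> \<not> mates B b z) \<or> (\<not> mates A x z \<and> \<not> mates B b y) \<or>
    (\<not> mates A y z \<and> \<not> mates B b x)"
    using A1 B1 d by (metis distinct_length_2_or_more)
  then obtain u v w where uvw: "\<not> mates A u v" "\<not> mates B b w" "X = {b, u, v, w}" "distinct [b, u, v, w]"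
  proof (elim disjE conjE, goal_cases)
    case 1
    then show ?case using that[of x y z] X' d by blast
  next
    case 2
    then show ?case using that[of x z y] X' d by auto
  next
    case 3
    then show ?case using that[of y z x] X' d by auto
  qed
  have "good (A, u, v)" "good (B, b, w)"
    using uvw AB(1,2,5) b(2)[of u] b(2)[of v] by (auto simp: good_def)
  moreover have "targets (A, u, v) \<union> targets (B, b, w) = X"
    "targets (A, u, v) \<inter> targets (B, b, w) = {}"
    using uvw(3,4) by (auto simp: targets_def)
  ultimately show ?thesis
    using AB(3,4) by (intro exI[of _ "(A, u, v)"] exI[of _ "(B, b, w)"]) simp
qed

text \<open>With only two odd vertices available, the fresh vertex \<open>z\<close> is a target of
  both forests and cancels in the parity count. If \<open>a\<close> is inner in \<open>A\<close>, it
  is moved to \<open>B\<close>.\<close>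

lemma two_targets:
  assumes D: "finite D" "\<forall>e\<in>D. card e = 2" "\<And>v. edeg D v \<le> 2"
    and ab: "a \<noteq> b" and z: "z \<notin> \<Union>D" "z \<noteq> a" "z \<noteq> b"
  shows "\<exists>c c'. good c \<and> good c' \<and> {targets c, targets c'} = {{a, z}, {b, z}} \<and>
    pedges (fst c) \<union> pedges (fst c') = D \<and> pedges (fst c) \<inter> pedges (fst c') = {}"
proof -
  have ab4: "finite {a, b}" "card {a, b} \<le> 4" using ab by auto
  obtain A B where AB: "psys A" "psys B" "pedges A \<union> pedges B = D" "pedges A \<inter> pedges B = {}"
    "pinner B = {}" "\<And>v v'. v \<in> {a, b} \<Longrightarrow> v' \<in> {a, b} \<Longrightarrow> v \<in> pinner A \<Longrightarrow> v' \<in> pinner A \<Longrightarrow> v = v'"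
    using split_two_factor[OF D ab4] by blast
  have zz: "z \<notin> pverts A" "z \<notin> pverts B" using pverts_pedges AB(1-3) z by blast+
  have nz: "\<not> mates A u z" "\<not> mates B u z" "z \<notin> pinner A" for u
    using zz mates_pends[of _ u z] pends_subset[OF AB(1)] pends_subset[OF AB(2)]
    by (auto simp: pinner_def)
  show ?thesis
  proof (cases "a \<in> pinner A")
    case True
    then have "b \<notin> pinner A" using AB(6) ab by blast
    then have "good (A, b, z)" "good (B, a, z)" using AB(1,2,5) nz z ab by (auto simp: good_def)
    moreover have "{targets (A, b, z), targets (B, a, z)} = {{a, z}, {b, z}}"
      unfolding targets_def by auto
    ultimately show ?thesis
      using AB(3,4) by (intro exI[of _ "(A, b, z)"] exI[of _ "(B, a, z)"] conjI) simp_all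
  next
    case False
    then have "good (A, a, z)" "good (B, b, z)" using AB(1,2,5) nz z ab by (auto simp: good_def)
    moreover have "{targets (A, a, z), targets (B, b, z)} = {{a, z}, {b, z}}"
      unfolding targets_def by simp
    ultimately show ?thesis
      using AB(3,4) by (intro exI[of _ "(A, a, z)"] exI[of _ "(B, b, z)"] conjI) simp_all
  qed
qed

text \<open>Surplus pairs of odd vertices are given to empty systems, which later become paths
  consisting of added edges only.\<close>

lemma trivial_colours:
  assumes "finite X" "card X = 2 * q"
  shows "\<exists>cs. length cs = q \<and> (\<forall>c\<in>set cs. good c \<and> targets c \<subseteq> X) \<and>
    (\<forall>e. count_if (\<lambda>c. e \<in> pedges (fst c)) cs = 0) \<and>
    (\<forall>v. odd (count_if (\<lambda>c. v \<in> targets c) cs) \<longleftrightarrow> v \<in> X)"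
  using assms
proof (induction q arbitrary: X)
  case 0
  then show ?case by auto
next
  case (Suc q)
  obtain a where a: "a \<in> X" using Suc.prems by fastforce
  have c1: "card (X - {a}) = Suc (2 * q)" using Suc.prems a by simp
  then have "X - {a} \<noteq> {}" by (metis card.empty nat.distinct(1))
  then obtain b where b: "b \<in> X - {a}" by blast
  have "card (X - {a} - {b}) = 2 * q" using c1 b Suc.prems(1) by (subst card_Diff_singleton) auto
  from Suc.IH[OF _ this] Suc.prems(1) obtain cs where cs: "length cs = q"
    "\<forall>c\<in>set cs. good c \<and> targets c \<subseteq> X - {a} - {b}"
    "\<forall>e. count_if (\<lambda>c. e \<in> pedges (fst c)) cs = 0"
    "\<forall>v. odd (count_if (\<lambda>c. v \<in> targets c) cs) \<longleftrightarrow> v \<in> X - {a} - {b}"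
    by auto
  have "good ({}, a, b)" using b by (auto simp: good_def)
  then show ?case
    using cs a b by (intro exI[of _ "({}, a, b) # cs"]) (auto simp: targets_def)
qed

text \<open>Each two-factor consumes four odd vertices for two forests. The slack in
  \<open>2 * length Ds \<le> q + 1\<close> lets the last two-factor find only two, and a surplus of
  odd vertices goes to empty systems; this explains the maximum in the length.\<close>

lemma grouped_colours:
  fixes Ds :: "'v set set list"
  assumes D: "\<And>D. D \<in> set Ds \<Longrightarrow> finite D \<and> (\<forall>e\<in>D. card e = 2) \<and> (\<forall>v. edeg D v \<le> 2)"
    and X: "finite X" "card X = 2 * q" "2 * length Ds \<le> q + 1" and Z: "infinite Z"
  shows "\<exists>cs. length cs = max (2 * length Ds) q \<and> (\<forall>c\<in>set cs. good c \<and> targets c \<subseteq> X \<union> Z) \<and>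
    (\<forall>e. count_if (\<lambda>c. e \<in> pedges (fst c)) cs = count_if (\<lambda>D. e \<in> D) Ds) \<and>
    (\<forall>v. odd (count_if (\<lambda>c. v \<in> targets c) cs) \<longleftrightarrow> v \<in> X)"
  using D X
proof (induction Ds arbitrary: X q)
  case Nil
  obtain cs where "length cs = q" "\<forall>c\<in>set cs. good c \<and> targets c \<subseteq> X"
    "\<forall>e. count_if (\<lambda>c. e \<in> pedges (fst c)) cs = 0"
    "\<forall>v. odd (count_if (\<lambda>c. v \<in> targets c) cs) \<longleftrightarrow> v \<in> X"
    using trivial_colours[OF Nil.prems(2,3)] by blast
  then show ?case by (intro exI[of _ cs]) auto
next
  case (Cons D Ds)
  have D: "finite D" "\<forall>e\<in>D. card e = 2" "\<And>v. edeg D v \<le> 2" using Cons.prems(1)[of D] by auto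
  show ?case
  \<comment> \<open>Two odd vertices and, by the bound, a single two-factor are left.\<close>
  proof (cases "q = 1")
    case True
    then have Ds: "Ds = []" using Cons.prems(4) by simp
    obtain a b where ab: "X = {a, b}" "a \<noteq> b" using Cons.prems(3) True by (auto simp: card_2_iff)
    have "finite (\<Union>D)"
    proof -
      have "finite e" if "e \<in> D" for e using D(2) that by (metis card.infinite zero_neq_numeral)
      then show ?thesis using D(1) by blast
    qed
    then have "finite ({a, b} \<union> \<Union>D)" by simp
    then obtain z where z: "z \<in> Z" "z \<notin> {a, b} \<union> \<Union>D" using Z by (meson finite_subset subsetI)
    obtain c c' where c: "good c" "good c'" "{targets c, targets c'} = {{a, z}, {b, z}}"
      "pedges (fst c) \<union> pedges (fst c') = D" "pedges (fst c) \<inter> pedges (fst c') = {}"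
      using two_targets[OF D ab(2), of z] z(2) by blast
    have t: "targets c = {a, z} \<and> targets c' = {b, z} \<or> targets c = {b, z} \<and> targets c' = {a, z}"
      using c(3) by (metis doubleton_eq_iff)
    show ?thesis
    proof (intro exI[of _ "[c, c']"] conjI allI ballI)
      show "targets d \<subseteq> X \<union> Z" if "d \<in> set [c, c']" for d using that t z(1) ab(1) by auto
      show "odd (count_if (\<lambda>c. v \<in> targets c) [c, c']) \<longleftrightarrow> v \<in> X" for v
        using t z(2) ab by auto
      show "count_if (\<lambda>c. e \<in> pedges (fst c)) [c, c'] = count_if (\<lambda>D. e \<in> D) (D # Ds)" for e
        using c(4,5) Ds by auto
    qed (use c Ds True in auto)
  next
    case False
    then have q: "2 \<le> q" using Cons.prems(4) by simp
    have "4 \<le> card X" using q Cons.prems(3) by simp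
    then obtain Y where Y: "Y \<subseteq> X" "card Y = 4" "finite Y"
      using obtain_subset_with_card_n by metis
    obtain c c' where c: "good c" "good c'" "targets c \<union> targets c' = Y" "targets c \<inter> targets c' = {}"
      "pedges (fst c) \<union> pedges (fst c') = D" "pedges (fst c) \<inter> pedges (fst c') = {}"
      using four_targets[OF D Y(2)] by blast
    have XY: "card (X - Y) = 2 * (q - 2)" using Y Cons.prems(3) by (simp add: card_Diff_subset)
    have XY': "finite (X - Y)" "2 * length Ds \<le> (q - 2) + 1" using Cons.prems q by auto
    have Ds: "finite D \<and> (\<forall>e\<in>D. card e = 2) \<and> (\<forall>v. edeg D v \<le> 2)" if "D \<in> set Ds" for D
      using Cons.prems(1)[of D] that by simp
    obtain cs where cs: "length cs = max (2 * length Ds) (q - 2)"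
      "\<forall>c\<in>set cs. good c \<and> targets c \<subseteq> X - Y \<union> Z"
      "\<forall>e. count_if (\<lambda>c. e \<in> pedges (fst c)) cs = count_if (\<lambda>D. e \<in> D) Ds"
      "\<forall>v. odd (count_if (\<lambda>c. v \<in> targets c) cs) \<longleftrightarrow> v \<in> X - Y"
      using Cons.IH[OF Ds XY'(1) XY XY'(2)] by blast
    show ?thesis
    proof (intro exI[of _ "c # c' # cs"] conjI allI ballI)
      show "length (c # c' # cs) = max (2 * length (D # Ds)) q" using cs(1) q by auto
      show "good d" if "d \<in> set (c # c' # cs)" for d using that c cs(2) by auto
      show "targets d \<subseteq> X \<union> Z" if "d \<in> set (c # c' # cs)" for d
        using that c(3) cs(2) Y(1) by fastforce
      show "count_if (\<lambda>c. e \<in> pedges (fst c)) (c # c' # cs) = count_if (\<lambda>D. e \<in> D) (D # Ds)" for e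
        using c(5,6) cs(3) by auto
      show "odd (count_if (\<lambda>c. v \<in> targets c) (c # c' # cs)) \<longleftrightarrow> v \<in> X" for v
        using c(3,4) cs(4) Y(1) by auto
    qed
  qed
qed

lemma good_fresh: "psys P \<Longrightarrow> a \<noteq> b \<Longrightarrow> a \<notin> pverts P \<Longrightarrow> b \<notin> pverts P \<Longrightarrow> good (P, a, b)"
  using mates_pends[of P a b] pends_subset[of P] by (auto simp: good_def pinner_def)

lemma obtain_three_fresh:
  assumes "infinite Z" "finite V"
  obtains x y z where "{x, y, z} \<subseteq> Z - V" "distinct [x, y, z]"
proof -
  have "infinite (Z - V)" using assms by simp
  then obtain T where T: "T \<subseteq> Z - V" "finite T" "card T = 3"
    using infinite_arbitrarily_large by metis
  then obtain x y z where "T = {x, y, z}" "x \<noteq> y" "x \<noteq> z" "y \<noteq> z" by (auto simp: card_3_iff)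
  then show thesis using that[of x y z] T by auto
qed

text \<open>Two systems share a pair of fresh targets, so these cancel; a final group of three takes
  the sides of a triangle. A single system would have no partner, whence the condition on the
  length.\<close>

lemma free_colours:
  assumes "\<And>P. P \<in> set Ps \<Longrightarrow> psys P" "length Ps \<noteq> 1" "infinite Z"
  shows "\<exists>cs. map fst cs = Ps \<and> (\<forall>c\<in>set cs. good c \<and> targets c \<subseteq> Z) \<and>
    (\<forall>v. even (count_if (\<lambda>c. v \<in> targets c) cs))"
  using assms(1,2)
proof (induction "length Ps" arbitrary: Ps rule: less_induct)
  case less
  show ?case
  proof (cases Ps)
    case (Cons P Ps')
    then obtain Q R where Ps: "Ps = P # Q # R" using less.prems(2) by (cases Ps') auto
    have fin: "finite (\<Union>(pverts ` set Ps))" using less.prems(1) finite_pverts by blast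
    obtain x y z where xyz: "{x, y, z} \<subseteq> Z - \<Union>(pverts ` set Ps)" "distinct [x, y, z]"
      using obtain_three_fresh[OF assms(3) fin] by metis
    have g: "good (S, a, b)" if "S \<in> set Ps" "{a, b} \<subseteq> {x, y, z}" "a \<noteq> b" for S a b
      using good_fresh[of S a b] less.prems(1)[OF that(1)] that xyz by blast
    show ?thesis
    \<comment> \<open>Splitting off two of three systems would leave one alone, so all three are
      treated together.\<close>
    proof (cases "length R = 1")
      case True
      then obtain S where R: "R = [S]" by (auto simp: length_Suc_conv)
      show ?thesis
        using g[of P x y] g[of Q y z] g[of S x z] Ps R xyz
        by (intro exI[of _ "[(P, x, y), (Q, y, z), (S, x, z)]"]) (auto simp: targets_def)
    next
      case False
      obtain cs where cs: "map fst cs = R" "\<forall>c\<in>set cs. good c \<and> targets c \<subseteq> Z"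
        "\<forall>v. even (count_if (\<lambda>c. v \<in> targets c) cs)"
        using less.hyps[of R] less.prems(1) Ps False by auto
      show ?thesis
        using g[of P x y] g[of Q x y] Ps cs xyz
        by (intro exI[of _ "(P, x, y) # (Q, x, y) # cs"]) (auto simp: targets_def)
    qed
  qed simp
qed

section \<open>Partitions of the edge set\<close>

text \<open>Counting over a list permits repeated empty classes, and makes counts additive under
  concatenation.\<close>

definition partitions :: "'v set set \<Rightarrow> 'v set set list \<Rightarrow> bool" where
  "partitions E Ds \<longleftrightarrow> (\<forall>e. count_if (\<lambda>D. e \<in> D) Ds = (if e \<in> E then 1 else 0))"

lemma partitions_Union: "partitions E Ds \<Longrightarrow> \<Union>(set Ds) = E"
proof -
  assume p: "partitions E Ds"
  have "e \<in> \<Union>(set Ds) \<longleftrightarrow> e \<in> E" for e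
  proof -
    have c: "count_if (\<lambda>D. e \<in> D) Ds = (if e \<in> E then 1 else 0)"
      using p by (simp only: partitions_def)
    have "e \<in> \<Union>(set Ds) \<longleftrightarrow> count_if (\<lambda>D. e \<in> D) Ds \<noteq> 0" by (auto simp: filter_empty_conv)
    then show ?thesis unfolding c by simp
  qed
  then show ?thesis by blast
qed

lemma partitions_Cons:
  "partitions E (D # Ds) \<longleftrightarrow> D \<subseteq> E \<and> partitions (E - D) Ds"
proof
  assume p: "partitions E (D # Ds)"
  then have sub: "D \<subseteq> E" using partitions_Union by fastforce
  have "count_if (\<lambda>D. e \<in> D) Ds = (if e \<in> E - D then 1 else 0)" for e
  proof -
    have "count_if (\<lambda>D. e \<in> D) (D # Ds) = (if e \<in> E then 1 else 0)"
      using p by (simp only: partitions_def)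
    then show ?thesis using sub by (auto split: if_splits)
  qed
  then show "D \<subseteq> E \<and> partitions (E - D) Ds" using sub by (simp add: partitions_def)
next
  assume p: "D \<subseteq> E \<and> partitions (E - D) Ds"
  have "count_if (\<lambda>D. e \<in> D) (D # Ds) = (if e \<in> E then 1 else 0)" for e
  proof -
    have "count_if (\<lambda>D. e \<in> D) Ds = (if e \<in> E - D then 1 else 0)"
      using p by (simp only: partitions_def)
    then show ?thesis using p by auto
  qed
  then show "partitions E (D # Ds)" by (simp add: partitions_def)
qed

lemma partitions_Nil [simp]: "partitions E [] \<longleftrightarrow> E = {}"
  by (auto simp: partitions_def)

text \<open>This connects the counting form with the pairwise disjointness used in
  \<open>linear_forest_decomposition\<close>.\<close>

lemma partitions_nth:
  "partitions E Ds \<longleftrightarrow> \<Union>(set Ds) = E \<and>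
    (\<forall>i<length Ds. \<forall>j<length Ds. i \<noteq> j \<longrightarrow> Ds ! i \<inter> Ds ! j = {})"
proof (induction Ds arbitrary: E)
  case (Cons D Ds)
  have "(\<forall>i<length (D # Ds). \<forall>j<length (D # Ds). i \<noteq> j \<longrightarrow> (D # Ds) ! i \<inter> (D # Ds) ! j = {}) \<longleftrightarrow>
    (\<forall>j<length Ds. D \<inter> Ds ! j = {}) \<and>
    (\<forall>i<length Ds. \<forall>j<length Ds. i \<noteq> j \<longrightarrow> Ds ! i \<inter> Ds ! j = {})"
    unfolding length_Cons All_less_Suc2 by (simp add: Int_commute) blast
  moreover have "(\<forall>j<length Ds. D \<inter> Ds ! j = {}) \<longleftrightarrow> D \<inter> \<Union>(set Ds) = {}"
  proof -
    have "(\<forall>j<length Ds. D \<inter> Ds ! j = {}) \<longleftrightarrow> (\<forall>D'\<in>set Ds. D \<inter> D' = {})"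
      by (simp add: all_set_conv_all_nth)
    then show ?thesis by blast
  qed
  moreover have "D \<subseteq> E \<and> \<Union>(set Ds) = E - D \<longleftrightarrow> D \<union> \<Union>(set Ds) = E \<and> D \<inter> \<Union>(set Ds) = {}"
    by blast
  ultimately show ?case
    unfolding partitions_Cons Cons.IH list.set(2) Union_insert by argo
qed auto

lemma partitions_append:
  "partitions E (Ds @ Ds') \<longleftrightarrow> \<Union>(set Ds) \<subseteq> E \<and> partitions (\<Union>(set Ds)) Ds \<and>
    partitions (E - \<Union>(set Ds)) Ds'"
proof (induction Ds arbitrary: E)
  case (Cons D Ds)
  have eq: "E - D - \<Union>(set Ds) = E - \<Union>(set (D # Ds))" by auto
  have a: "partitions (D \<union> \<Union>(set Ds) - D) Ds \<longleftrightarrow> D \<inter> \<Union>(set Ds) = {} \<and> partitions (\<Union>(set Ds)) Ds"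
  proof -
    have "D \<inter> \<Union>(set Ds) = {} \<Longrightarrow> D \<union> \<Union>(set Ds) - D = \<Union>(set Ds)" by blast
    moreover have "D \<inter> \<Union>(set Ds) = {}" if "partitions (D \<union> \<Union>(set Ds) - D) Ds"
      using partitions_Union[OF that] by blast
    ultimately show ?thesis by metis
  qed
  show ?case using Cons.IH[of "E - D"] a eq by (auto simp: partitions_Cons)
qed simp

lemma edeg_partition:
  assumes "finite E" "partitions E Ds"
  shows "edeg E v = (\<Sum>D\<leftarrow>Ds. edeg D v)"
  using assms
proof (induction Ds arbitrary: E)
  case (Cons D Ds)
  then have "D \<subseteq> E" "partitions (E - D) Ds" by (auto simp: partitions_Cons)
  moreover from this have "edeg (D \<union> (E - D)) v = edeg D v + edeg (E - D) v"
    using Cons.prems(1) by (intro edeg_Un) (auto intro: finite_subset)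
  ultimately show ?case using Cons.IH[of "E - D"] Cons.prems(1) by (simp add: Un_absorb1)
qed simp

lemma two_factor_list:
  assumes E: "finite E" "\<forall>e\<in>E. card e = 2" and deg: "\<And>v. edeg E v \<le> 2 * s"
  obtains Ds where "length Ds = s" "partitions E Ds" "\<And>D v. D \<in> set Ds \<Longrightarrow> edeg D v \<le> 2"
proof -
  obtain D :: "nat \<Rightarrow> 'a set set" where D: "(\<Union>c<s. D c) = E"
    "\<And>c c'. c < s \<Longrightarrow> c' < s \<Longrightarrow> c \<noteq> c' \<Longrightarrow> D c \<inter> D c' = {}" "\<And>c v. edeg (D c) v \<le> 2"
    using two_factor_decomposition[OF E deg] by blast
  show thesis
  proof (rule that[of "map D [0..<s]"])
    show "partitions E (map D [0..<s])"
      unfolding partitions_nth using D(1,2) by (auto simp: atLeast0LessThan)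
  qed (use D in auto)
qed

lemma split_list_two_factors:
  assumes "\<And>D. D \<in> set Ds \<Longrightarrow> finite D \<and> (\<forall>e\<in>D. card e = 2) \<and> (\<forall>v. edeg D v \<le> 2)"
    and "partitions E Ds"
  shows "\<exists>Ps. length Ps = 2 * length Ds \<and> (\<forall>P\<in>set Ps. psys P) \<and> partitions E (map pedges Ps)"
  using assms
proof (induction Ds arbitrary: E)
  case (Cons D Ds)
  have D: "finite D" "\<forall>e\<in>D. card e = 2" "\<And>v. edeg D v \<le> 2" using Cons.prems(1)[of D] by auto
  have part: "D \<subseteq> E" "partitions (E - D) Ds" using Cons.prems(2) by (auto simp: partitions_Cons)
  obtain Ps where Ps: "length Ps = 2 * length Ds" "\<forall>P\<in>set Ps. psys P"
    "partitions (E - D) (map pedges Ps)"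
    using Cons.IH[OF _ part(2)] Cons.prems(1) by (metis list.set_intros(2))
  \<comment> \<open>The ends of these forests will be fresh vertices, so no vertex has to be kept
    from becoming inner and \<open>X\<close> is empty.\<close>
  have "finite ({} :: 'a set)" "card ({} :: 'a set) \<le> 4" by auto
  from split_two_factor[OF D this] obtain A B where AB: "psys A" "psys B" "pedges A \<union> pedges B = D" "pedges A \<inter> pedges B = {}"
    by blast
  have "E - pedges A - pedges B = E - D" using AB(3) by blast
  then have "partitions E (map pedges (A # B # Ps))"
    using Ps(3) AB part(1) by (auto simp: partitions_Cons)
  then show ?case using Ps AB by (intro exI[of _ "A # B # Ps"]) auto
qed (auto simp: partitions_Cons)

subsection \<open>Linear forests\<close>

lemma equiv_reachable: "equiv (verts F) (reachable F)"
proof (rule equivI)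
  show "refl_on (verts F) (reachable F)"
    by (auto simp: reachable_def refl_on_def)
  have s: "sym ({(u, v). {u, v} \<in> edges F}\<^sup>*)"
    by (intro sym_rtrancl) (auto simp: sym_def insert_commute)
  show "sym (reachable F)" using s by (auto simp: reachable_def sym_def)
  show "trans (reachable F)"
    by (auto simp: reachable_def trans_def intro: rtrancl_trans)
  show "reachable F \<subseteq> verts F \<times> verts F" by (auto simp: reachable_def)
qed

text \<open>The components are the paths; those with one vertex carry no edge and are
  dropped.\<close>

lemma linear_forest_psys:
  assumes F: "linear_forest F"
  obtains P where "psys P" "pedges P = edges F"
proof -
  let ?r = "reachable F" let ?Q = "verts F // reachable F"
  have sg: "simple_graph F" using F by (simp add: linear_forest_def)
  have "\<forall>C\<in>?Q. \<exists>xs. distinct xs \<and> set xs = C \<and> path_edges xs = {e\<in>edges F. e \<subseteq> C}"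
  proof
    fix C assume "C \<in> ?Q"
    then have "is_path_graph (induced F C)"
      using F by (auto simp: linear_forest_def components_def)
    then show "\<exists>xs. distinct xs \<and> set xs = C \<and> path_edges xs = {e\<in>edges F. e \<subseteq> C}"
      by (auto simp: is_path_graph_def induced_def path_on_def)
  qed
  then obtain xs where xs: "\<And>C. C \<in> ?Q \<Longrightarrow> distinct (xs C) \<and> set (xs C) = C \<and>
    path_edges (xs C) = {e\<in>edges F. e \<subseteq> C}" by metis
  define P where "P = {p \<in> xs ` ?Q. 2 \<le> length p}"
  have "finite ?Q" using sg by (auto simp: simple_graph_def reachable_def intro!: finite_quotient)
  then have "finite P" by (simp add: P_def)
  moreover have "set p \<inter> set q = {}" if pq: "p \<in> P" "q \<in> P" "p \<noteq> q" for p q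
  proof -
    obtain C C' where C: "C \<in> ?Q" "p = xs C" "C' \<in> ?Q" "q = xs C'" using pq by (auto simp: P_def)
    then have "C \<inter> C' = {}" using quotient_disj[OF equiv_reachable C(1,3)] pq(3) by blast
    then show ?thesis using xs C by simp
  qed
  moreover have "distinct p \<and> 2 \<le> length p" if "p \<in> P" for p using that xs by (auto simp: P_def)
  ultimately have "psys P" unfolding psys_def by blast
  moreover have "pedges P = edges F"
  proof
    show "pedges P \<subseteq> edges F" using xs by (auto simp: pedges_def P_def)
    show "edges F \<subseteq> pedges P"
    proof
      fix e assume e: "e \<in> edges F"
      obtain a b where ab: "e = {a, b}" "a \<in> verts F" "b \<in> verts F"
        using sg e by (auto simp: simple_graph_def card_2_iff)
      have "(a, b) \<in> ?r" using ab e by (auto simp: reachable_def)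
      define C where "C = ?r `` {a}"
      have "C \<in> ?Q" using ab by (auto simp: C_def intro: quotientI)
      moreover have "e \<subseteq> C"
        using ab \<open>(a, b) \<in> ?r\<close> equiv_class_self[OF equiv_reachable ab(2)] by (auto simp: C_def)
      ultimately have m: "e \<in> path_edges (xs C)" using xs e by simp
      then have "2 \<le> length (xs C)" by (auto simp: path_edges_def)
      then show "e \<in> pedges P" using m \<open>C \<in> ?Q\<close> by (auto simp: pedges_def P_def)
    qed
  qed
  ultimately show thesis by (rule that)
qed

lemma path_connected:
  assumes "path_edges p \<subseteq> E" "x \<in> set p"
  shows "(hd p, x) \<in> {(u, v). {u, v} \<in> E}\<^sup>* \<and> (x, hd p) \<in> {(u, v). {u, v} \<in> E}\<^sup>*"
  using assms
proof (induction p rule: induct_list012)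
  case (3 y z zs)
  have yz: "(y, z) \<in> {(u, v). {u, v} \<in> E}" "(z, y) \<in> {(u, v). {u, v} \<in> E}"
    using 3(3) by (auto simp: insert_commute)
  show ?case
  proof (cases "x = y")
    case False
    then have "(z, x) \<in> {(u, v). {u, v} \<in> E}\<^sup>*" "(x, z) \<in> {(u, v). {u, v} \<in> E}\<^sup>*"
      using 3 by auto
    then show ?thesis
      using converse_rtrancl_into_rtrancl[OF yz(1), of x] rtrancl_into_rtrancl[OF _ yz(2), of x]
      by simp
  qed simp
qed auto

text \<open>No edge leaves the vertex set of a path and the path is connected, so the components are
  exactly the vertex sets of the paths.\<close>

lemma psys_linear_forest:
  assumes P: "psys P"
  shows "linear_forest \<lparr>verts = pverts P, edges = pedges P\<rparr>"
proof -
  let ?F = "\<lparr>verts = pverts P, edges = pedges P\<rparr>"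
  let ?R = "{(u, v). {u, v} \<in> pedges P}"
  have closed: "y \<in> set p" if p: "p \<in> P" "x \<in> set p" "{x, y} \<in> pedges P" for p x y
  proof -
    obtain q where q: "q \<in> P" "{x, y} \<in> path_edges q" using p(3) by (auto simp: pedges_def)
    then have "x \<in> set q" "y \<in> set q" using path_edges_subset[of "{x, y}" q] by auto
    then show ?thesis using psysD(8)[OF P p(1) q(1) p(2)] by simp
  qed
  have "is_path_graph (induced ?F C)" if C: "C \<in> pverts P // reachable ?F" for C
  proof -
    obtain v where v: "v \<in> pverts P" "C = reachable ?F `` {v}" using C by (rule quotientE)
    obtain p where p: "p \<in> P" "v \<in> set p" using v by (auto simp: pverts_def)
    have sub: "path_edges p \<subseteq> pedges P" using p by (auto simp: pedges_def)
    have "y \<in> set p" if "(v, y) \<in> ?R\<^sup>*" for y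
      using that by (induction rule: rtrancl_induct) (use p closed[OF p(1)] in auto)
    moreover have "(v, y) \<in> ?R\<^sup>*" if "y \<in> set p" for y
      using path_connected[OF sub p(2)] path_connected[OF sub that] by (meson rtrancl_trans)
    moreover have "set p \<subseteq> pverts P" using p by (auto simp: pverts_def)
    ultimately have Cp: "C = set p" using v by (auto simp: reachable_def)
    have "e \<in> path_edges p" if e: "e \<in> pedges P" "e \<subseteq> set p" for e
    proof -
      obtain q where q: "q \<in> P" "e \<in> path_edges q" using e(1) by (auto simp: pedges_def)
      obtain x where "x \<in> e" using path_edges_nonempty[OF q(2)] by blast
      then have "p = q" using psysD(8)[OF P p(1) q(1)] e(2) path_edges_subset[OF q(2)] by blast
      then show ?thesis using q by simp
    qed
    then have "{e \<in> pedges P. e \<subseteq> set p} = path_edges p"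
      using sub path_edges_subset by blast
    then show ?thesis
      using psysD(2,4)[OF P p(1)] unfolding is_path_graph_def path_on_def induced_def Cp
      by (intro exI[of _ p]) simp
  qed
  moreover have "simple_graph ?F"
    using finite_pverts[OF P] pedges_verts[of _ P] pedges_card[OF P] by (auto simp: simple_graph_def)
  ultimately show ?thesis by (auto simp: linear_forest_def components_def)
qed

lemma decomposition_from_psys:
  assumes H: "simple_graph H" and Ps: "\<forall>P\<in>set Ps. psys P" "partitions (edges H) (map pedges Ps)"
  shows "linear_forest_decomposition H (map (\<lambda>P. \<lparr>verts = pverts P, edges = pedges P\<rparr>) Ps)"
proof -
  have lf: "\<forall>P\<in>set Ps. linear_forest \<lparr>verts = pverts P, edges = pedges P\<rparr>"
    using Ps(1) psys_linear_forest by blast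
  have un: "\<Union>(set (map pedges Ps)) = edges H" using partitions_Union[OF Ps(2)] .
  have "pverts P \<subseteq> verts H" if "P \<in> set Ps" for P
  proof -
    have "pverts P = \<Union>(pedges P)" using pverts_pedges Ps(1) that by blast
    moreover have "pedges P \<subseteq> edges H" using un that by auto
    ultimately show ?thesis using H by (auto simp: simple_graph_def)
  qed
  moreover have "\<forall>i<length Ps. \<forall>j<length Ps. i \<noteq> j \<longrightarrow> pedges (Ps ! i) \<inter> pedges (Ps ! j) = {}"
    using Ps(2) unfolding partitions_nth by simp
  ultimately show ?thesis
    using un lf unfolding linear_forest_decomposition_def by auto
qed

lemma psys_from_decomposition:
  assumes "linear_forest_decomposition H Fs"
  obtains Ps where "length Ps = length Fs" "\<forall>P\<in>set Ps. psys P" "partitions (edges H) (map pedges Ps)"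
proof -
  have "\<forall>F\<in>set Fs. \<exists>P. psys P \<and> pedges P = edges F"
    using assms linear_forest_psys unfolding linear_forest_decomposition_def by metis
  then obtain f where f: "\<And>F. F \<in> set Fs \<Longrightarrow> psys (f F) \<and> pedges (f F) = edges F" by metis
  have "map pedges (map f Fs) = map edges Fs" using f by simp
  moreover have "partitions (edges H) (map edges Fs)"
    using assms unfolding linear_forest_decomposition_def partitions_nth by simp
  ultimately have "partitions (edges H) (map pedges (map f Fs))" by (simp only:)
  then show thesis using f by (intro that[of "map f Fs"]) auto
qed

section \<open>Existence and boundedness of linear arboricity\<close>

lemma degree_edeg: "degree G v = edeg (edges G) v"
  by (simp add: degree_def edeg_def)

lemma finite_edges: "simple_graph G \<Longrightarrow> finite (edges G)"
  using finite_subset[of "edges G" "Pow (verts G)"] by (auto simp: simple_graph_def)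

lemma edeg_le_max_degree:
  assumes "simple_graph G"
  shows "edeg (edges G) v \<le> max_degree G"
proof (cases "v \<in> verts G")
  case True
  have "finite (insert 0 (degree G ` verts G))" using assms by (simp add: simple_graph_def)
  then show ?thesis using True unfolding max_degree_def degree_edeg[symmetric] by (intro Max_ge) auto
next
  case False
  then have "v \<notin> \<Union>(edges G)" using assms by (auto simp: simple_graph_def)
  then show ?thesis by (simp add: edeg_eq_0)
qed

lemma psys_decomposition_exists:
  assumes E: "finite E" "\<forall>e\<in>E. card e = 2" and deg: "\<And>v. edeg E v \<le> 2 * s"
  obtains Ps where "length Ps = 2 * s" "\<forall>P\<in>set Ps. psys P" "partitions E (map pedges Ps)"
proof -
  obtain Ds where Ds: "length Ds = s" "partitions E Ds" "\<And>D v. D \<in> set Ds \<Longrightarrow> edeg D v \<le> 2"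
    using two_factor_list[OF E deg] by blast
  have "finite D \<and> (\<forall>e\<in>D. card e = 2) \<and> (\<forall>v. edeg D v \<le> 2)" if "D \<in> set Ds" for D
  proof -
    have "D \<subseteq> E" using partitions_Union[OF Ds(2)] that by blast
    then show ?thesis using E Ds(3)[OF that] finite_subset by blast
  qed
  from split_list_two_factors[OF this Ds(2)] show thesis using that Ds(1) by auto
qed

text \<open>The crude bound shows that the minimum defining \<open>la\<close> is attained, and that
  the values collected in \<open>la_max\<close> are bounded, so that their \<open>Max\<close> is
  taken over a finite set.\<close>

lemma la_decomposition:
  assumes H: "simple_graph H"
  obtains Fs where "linear_forest_decomposition H Fs" "length Fs = la H" "la H \<le> 2 * max_degree H"
proof -
  have E: "finite (edges H)" "\<forall>e\<in>edges H. card e = 2"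
    using H finite_edges by (auto simp: simple_graph_def)
  have "edeg (edges H) v \<le> 2 * max_degree H" for v using edeg_le_max_degree[OF H, of v] by simp
  then obtain Ps where Ps: "length Ps = 2 * max_degree H" "\<forall>P\<in>set Ps. psys P"
    "partitions (edges H) (map pedges Ps)"
    using psys_decomposition_exists[OF E] by blast
  have ex: "\<exists>Fs. linear_forest_decomposition H Fs \<and> length Fs = 2 * max_degree H"
    using decomposition_from_psys[OF H Ps(2,3)] Ps(1) by (metis length_map)
  have "la H \<le> 2 * max_degree H" unfolding la_def by (rule Least_le) (rule ex)
  moreover have "\<exists>Fs. linear_forest_decomposition H Fs \<and> length Fs = la H"
    unfolding la_def 
    by (rule LeastI[of "\<lambda>k. \<exists>Fs. linear_forest_decomposition H Fs \<and> length Fs = k", OF ex])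
  ultimately show thesis using that by blast
qed

lemma la_le_la_max:
  fixes H :: "nat ugraph"
  assumes "simple_graph H" "max_degree H = d"
  shows "la H \<le> la_max d"
proof -
  have "{la H | H :: nat ugraph. simple_graph H \<and> max_degree H = d} \<subseteq> {..2 * d}"
    using la_decomposition by auto
  then have "finite {la H | H :: nat ugraph. simple_graph H \<and> max_degree H = d}"
    by (rule finite_subset) simp
  then show ?thesis unfolding la_max_def using assms by (intro Max_ge) auto
qed

section \<open>The maximum linear arboricity\<close>

lemma path_edges_map: "path_edges (map f p) = image f ` path_edges p"
  by (induction p rule: induct_list012) auto

lemma pedges_map: "pedges (map f ` P) = image f ` pedges P"
  by (auto simp: pedges_def path_edges_map)

lemma psys_map:
  assumes P: "psys P" and f: "inj_on f (pverts P)"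
  shows "psys (map f ` P)"
  unfolding psys_def
proof (intro conjI ballI impI)
  show "finite (map f ` P)" using psysD(1)[OF P] by simp
next
  fix q assume "q \<in> map f ` P"
  then obtain p where p: "p \<in> P" "q = map f p" by blast
  have "set p \<subseteq> pverts P" using p by (auto simp: pverts_def)
  then show "distinct q" "2 \<le> length q"
    using psysD(2,3)[OF P p(1)] p(2) inj_on_subset[OF f] by (auto simp: distinct_map)
next
  fix q q' assume "q \<in> map f ` P" "q' \<in> map f ` P" and ne: "q \<noteq> q'"
  then obtain p p' where p: "p \<in> P" "q = map f p" "p' \<in> P" "q' = map f p'" by blast
  have sub: "set p \<subseteq> pverts P" "set p' \<subseteq> pverts P" using p by (auto simp: pverts_def)
  have "p \<noteq> p'" using p ne by blast
  then have "set p \<inter> set p' = {}" using P p(1,3) by (simp add: psys_def)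
  then show "set q \<inter> set q' = {}"
    using p(2,4) inj_on_image_Int[OF f sub] by simp
qed

text \<open>Consecutive edges share a vertex, so the side of one edge propagates along the
  path.\<close>

lemma path_on_one_side:
  assumes "\<forall>e\<in>path_edges p. e \<subseteq> A \<or> e \<inter> A = {}" "p \<noteq> []"
  shows "set p \<subseteq> A \<or> set p \<inter> A = {}"
  using assms
proof (induction p rule: induct_list012)
  case (3 x y zs)
  then have IH: "set (y # zs) \<subseteq> A \<or> set (y # zs) \<inter> A = {}" by simp
  have xy: "{x, y} \<subseteq> A \<or> {x, y} \<inter> A = {}" using 3(3) by simp
  show ?case
  proof (cases "y \<in> A")
    case True
    then have "x \<in> A" "set (y # zs) \<subseteq> A" using xy IH by auto
    then show ?thesis by simp
  next
    case False
    then have "x \<notin> A" "set (y # zs) \<inter> A = {}" using xy IH by auto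
    then show ?thesis by simp
  qed
qed auto

lemma psys_restrict:
  assumes P: "psys P" and A: "\<forall>e\<in>pedges P. e \<subseteq> A \<or> e \<inter> A = {}"
  shows "psys {p\<in>P. set p \<subseteq> A}" "pedges {p\<in>P. set p \<subseteq> A} = {e\<in>pedges P. e \<subseteq> A}"
proof -
  show "psys {p\<in>P. set p \<subseteq> A}" by (rule psys_subset[OF P]) auto
  have "set p \<subseteq> A" if p: "p \<in> P" "e \<in> path_edges p" "e \<subseteq> A" for p e
  proof -
    have "\<forall>e\<in>path_edges p. e \<subseteq> A \<or> e \<inter> A = {}" using A p(1) by (auto simp: pedges_def)
    then have "set p \<subseteq> A \<or> set p \<inter> A = {}"
      by (rule path_on_one_side[OF _ psysD(4)[OF P p(1)]])
    moreover have "e \<noteq> {}" "e \<subseteq> set p"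
      using path_edges_nonempty[OF p(2)] path_edges_subset[OF p(2)] by auto
    ultimately show ?thesis using p(3) by blast
  qed
  moreover have "e \<subseteq> A" if "e \<in> path_edges p" "set p \<subseteq> A" for p e
    using path_edges_subset that by blast
  ultimately have "(e \<in> pedges {p\<in>P. set p \<subseteq> A}) = (e \<in> {e\<in>pedges P. e \<subseteq> A})" for e
    unfolding pedges_def by (simp only: Union_iff mem_Collect_eq bex_simps image_iff) metis
  then show "pedges {p\<in>P. set p \<subseteq> A} = {e\<in>pedges P. e \<subseteq> A}" by blast
qed

definition complete_edges :: "'v set \<Rightarrow> 'v set set" where
  "complete_edges B = {e. e \<subseteq> B \<and> card e = 2}"

lemma edeg_complete_edges:
  assumes "finite B" "v \<in> B"
  shows "edeg (complete_edges B) v = card B - 1"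
proof -
  have "{e \<in> complete_edges B. v \<in> e} = (\<lambda>j. {v, j}) ` (B - {v})"
    using assms(2) by (auto simp: complete_edges_def card_2_iff)
  moreover have "inj_on (\<lambda>j. {v, j}) (B - {v})" by (auto simp: inj_on_def doubleton_eq_iff)
  ultimately show ?thesis unfolding edeg_def using assms by (simp add: card_image)
qed

lemma edeg_image:
  assumes f: "inj_on f (\<Union>E)" and u: "u \<in> \<Union>E"
  shows "edeg (image f ` E) (f u) = edeg E u"
proof -
  have "{e \<in> image f ` E. f u \<in> e} = image f ` {e \<in> E. u \<in> e}"
  proof
    show "{e \<in> image f ` E. f u \<in> e} \<subseteq> image f ` {e \<in> E. u \<in> e}"
    proof
      fix e assume "e \<in> {e \<in> image f ` E. f u \<in> e}"
      then obtain e' w where e': "e' \<in> E" "e = f ` e'" "w \<in> e'" "f u = f w" by blast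
      then have "u = w" using f u by (meson UnionI inj_onD)
      then show "e \<in> image f ` {e \<in> E. u \<in> e}" using e' by blast
    qed
  qed blast
  moreover have "inj_on (image f) {e \<in> E. u \<in> e}"
    using f inj_on_image_eq_iff[OF f] by (intro inj_onI) (metis (mono_tags, lifting) Union_upper mem_Collect_eq)
  ultimately show ?thesis unfolding edeg_def by (simp add: card_image)
qed

text \<open>The set of edges is copied to the natural numbers and a disjoint complete graph on \<open>d + 1\<close>
  vertices is added. This makes the maximum degree equal to \<open>d\<close> and the linear arboricity at
  least 2.\<close>

theorem la_max_decomposition:
  fixes E :: "'v set set"
  assumes E: "finite E" "\<forall>e\<in>E. card e = 2" and deg: "\<And>v. edeg E v \<le> d" and d: "2 \<le> d"
  obtains Ps where "length Ps = la_max d" "2 \<le> la_max d" "\<forall>P\<in>set Ps. psys P"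
    "partitions E (map pedges Ps)"
proof -
  let ?V = "\<Union>E"
  have fe: "finite e" if "e \<in> E" for e using E(2) that by (metis card.infinite zero_neq_numeral)
  then have "finite ?V" using E(1) by blast
  then obtain g :: "'v \<Rightarrow> nat" and n where g: "g ` ?V = {..<n}" "inj_on g ?V"
    using finite_imp_inj_to_nat_seg[of ?V] by (metis lessThan_def)
  define B where "B = {n..n + d}"
  define H where "H = \<lparr>verts = {..n + d}, edges = image g ` E \<union> complete_edges B\<rparr>"
  have B: "finite B" "card B = d + 1" "B \<inter> {..<n} = {}" by (auto simp: B_def)
  have gE: "e \<subseteq> {..<n} \<and> card e = 2" if eE: "e \<in> image g ` E" for e
  proof -
    obtain e' where e': "e' \<in> E" "e = g ` e'" using eE by blast
    have "inj_on g e'" using inj_on_subset[OF g(2) Union_upper[OF e'(1)]] .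
    then have "card e = 2" using e' E(2) by (simp add: card_image)
    moreover have "e \<subseteq> {..<n}"
      unfolding g(1)[symmetric] e'(2) using Union_upper[OF e'(1)] by (rule image_mono)
    ultimately show ?thesis by simp
  qed
  have fK: "finite (complete_edges B)"
    by (rule finite_subset[of _ "Pow B"]) (auto simp: complete_edges_def B(1))
  have disj: "image g ` E \<inter> complete_edges B = {}"
  proof -
    have "e \<notin> complete_edges B" if "e \<in> image g ` E" for e
    proof
      assume "e \<in> complete_edges B"
      then have "e \<subseteq> B \<inter> {..<n}" "card e = 2" using gE[OF that] by (auto simp: complete_edges_def)
      then show False using B(3) by auto
    qed
    then show ?thesis by blast
  qed
  have sH: "simple_graph H"
  proof -
    have "e \<subseteq> {..n + d} \<and> card e = 2" if "e \<in> edges H" for e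
    proof (cases "e \<in> image g ` E")
      case True
      then show ?thesis using gE[OF True] by auto
    next
      case False
      then show ?thesis using that by (auto simp: H_def complete_edges_def B_def)
    qed
    then show ?thesis by (simp add: simple_graph_def H_def)
  qed
  have dH: "edeg (edges H) v = edeg (image g ` E) v + edeg (complete_edges B) v" for v
    unfolding H_def using E(1) fK disj by (simp add: edeg_Un)
  have dB: "edeg (edges H) v = d" if "v \<in> B" for v
  proof -
    have "v \<notin> \<Union>(image g ` E)" using gE B(3) that by blast
    then show ?thesis using dH[of v] edeg_complete_edges[OF B(1) that] B(2) by (simp add: edeg_eq_0)
  qed
  have dA: "edeg (edges H) v \<le> d" if "v < n" for v
  proof -
    have "v \<in> g ` ?V" unfolding g(1) using that by simp
    then obtain u where u: "v = g u" "u \<in> ?V" by blast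
    have "v \<notin> \<Union>(complete_edges B)" using that by (auto simp: complete_edges_def B_def)
    then have "edeg (edges H) v = edeg E u"
      using dH[of v] edeg_image[OF g(2) u(2)] u(1) by (simp add: edeg_eq_0)
    then show ?thesis using deg by simp
  qed
  have "max_degree H = d"
    unfolding max_degree_def
  proof (rule Max_eqI)
    show "finite (insert 0 (degree H ` verts H))" by (simp add: H_def)
    have "n \<in> B" by (simp add: B_def)
    then have "degree H n = d" using dB by (simp add: degree_edeg)
    moreover have "n \<in> verts H" by (simp add: H_def)
    ultimately show "d \<in> insert 0 (degree H ` verts H)" by blast
    fix y assume "y \<in> insert 0 (degree H ` verts H)"
    then consider "y = 0" | v where "v \<in> verts H" "y = degree H v" by blast
    then show "y \<le> d"
    proof cases
      case 2
      then have "v < n \<or> v \<in> B" by (auto simp: H_def B_def)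
      then show ?thesis using dA dB 2(2) by (auto simp: degree_edeg)
    qed simp
  qed
  then have la: "la H \<le> la_max d" using la_le_la_max[OF sH] by blast
  obtain Fs where Fs: "linear_forest_decomposition H Fs" "length Fs = la H"
    using la_decomposition[OF sH] by metis
  obtain Ps where Ps: "length Ps = la H" "\<forall>P\<in>set Ps. psys P"
    "partitions (edges H) (map pedges Ps)"
    using psys_from_decomposition[OF Fs(1)] Fs(2) by metis
  have PH: "pedges P \<subseteq> edges H" if "P \<in> set Ps" for P
    using partitions_Union[OF Ps(3)] that by auto
  have side: "e \<subseteq> {..<n} \<or> e \<inter> {..<n} = {}" if "e \<in> edges H" for e
    using that gE[of e] B(3) by (auto simp: H_def complete_edges_def)
  \<comment> \<open>This bound is what \<open>free_colours\<close> will need. A single forest would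
    contain a path through \<open>n\<close>, lying entirely in \<open>B\<close>; its end would have
    degree 1, but every vertex of \<open>B\<close> has degree \<open>d \<ge> 2\<close>.\<close>
  have "2 \<le> la H"
  proof (rule ccontr)
    assume "\<not> 2 \<le> la H"
    then consider "Ps = []" | P where "Ps = [P]"
      using Ps(1) by (cases Ps; cases "tl Ps") auto
    then show False
    proof cases
      case 1
      then have "edges H = {}" using Ps(3) by simp
      then have "edeg (edges H) n = 0" by simp
      then show False using dB[of n] d by (simp add: B_def)
    next
      case 2
      then have P: "psys P" "pedges P = edges H" using Ps(2,3) partitions_Union[OF Ps(3)] by auto
      have "edeg (pedges P) n \<noteq> 0" using dB[of n] d P(2) by (simp add: B_def)
      then have "n \<in> pverts P" using edeg_psys[OF P(1), of n] pends_subset[OF P(1)] by (auto split: if_splits)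
      then obtain p where p: "p \<in> P" "n \<in> set p" by (auto simp: pverts_def)
      have "\<forall>e\<in>path_edges p. e \<subseteq> {..<n} \<or> e \<inter> {..<n} = {}"
        using side P(2) p(1) by (auto simp: pedges_def)
      then have "set p \<subseteq> {..<n} \<or> set p \<inter> {..<n} = {}"
        by (rule path_on_one_side[OF _ psysD(4)[OF P(1) p(1)]])
      then have "set p \<inter> {..<n} = {}" using p(2) by auto
      moreover have hp: "hd p \<in> set p" using psysD(5)[OF P(1) p(1)] .
      moreover have "hd p \<in> pverts P" using p(1) hp by (auto simp: pverts_def)
      then have "hd p \<in> verts H"
        using pverts_pedges[OF P(1)] P(2) sH by (auto simp: simple_graph_def)
      ultimately have "hd p \<in> B" by (auto simp: H_def B_def)
      then have "edeg (pedges P) (hd p) = d" using dB P(2) by simp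
      moreover have "hd p \<in> pends P" using p(1) by (auto simp: pends_def)
      then have "edeg (pedges P) (hd p) = 1" using edeg_psys[OF P(1)] by simp
      ultimately show False using d by simp
    qed
  qed
  define h where "h = inv_into ?V g"
  have hg: "h (g u) = u" if "u \<in> ?V" for u using g(2) that by (simp add: h_def)
  have injh: "inj_on h {..<n}" unfolding h_def g(1)[symmetric] by (rule inj_on_inv_into) simp
  \<comment> \<open>The paths inside the auxiliary complete graph are discarded and the others are
    renamed back to the original vertices.\<close>
  define R where "R P = map h ` {p\<in>P. set p \<subseteq> {..<n}}" for P
  have R: "psys (R P)" "pedges (R P) = image h ` {e\<in>pedges P. e \<subseteq> {..<n}}" if "P \<in> set Ps" for P
  proof -
    have P: "psys P" "\<forall>e\<in>pedges P. e \<subseteq> {..<n} \<or> e \<inter> {..<n} = {}"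
      using Ps(2) that side PH by blast+
    have "pverts {p\<in>P. set p \<subseteq> {..<n}} \<subseteq> {..<n}" by (auto simp: pverts_def)
    then show "psys (R P)" unfolding R_def
      using psys_map psys_restrict(1)[OF P] inj_on_subset[OF injh] by blast
    show "pedges (R P) = image h ` {e\<in>pedges P. e \<subseteq> {..<n}}"
      unfolding R_def pedges_map psys_restrict(2)[OF P] ..
  qed
  have part: "partitions E (map pedges (map R Ps))"
    unfolding partitions_nth
  proof (intro conjI allI impI)
    have "\<Union>(set (map pedges (map R Ps))) = (\<Union>P\<in>set Ps. image h ` {e\<in>pedges P. e \<subseteq> {..<n}})"
      using R(2) by simp
    also have "\<dots> = image h ` {e\<in>\<Union>(set (map pedges Ps)). e \<subseteq> {..<n}}" by auto
    also have "{e\<in>\<Union>(set (map pedges Ps)). e \<subseteq> {..<n}} = image g ` E"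
    proof -
      have "\<not> e \<subseteq> {..<n}" if "e \<in> complete_edges B" for e
      proof
        assume "e \<subseteq> {..<n}"
        then have "e \<subseteq> B \<inter> {..<n}" "card e = 2" using that by (auto simp: complete_edges_def)
        then show False using B(3) by auto
      qed
      then show ?thesis unfolding partitions_Union[OF Ps(3)] H_def using gE by auto
    qed
    also have "image h ` (image g ` E) = E"
    proof -
      have "h ` g ` e = e" if "e \<in> E" for e
      proof -
        have "h ` g ` e = (\<lambda>u. h (g u)) ` e" by (simp add: image_image)
        also have "\<dots> = (\<lambda>u. u) ` e" using hg that by (intro image_cong) auto
        finally show ?thesis by simp
      qed
      then show ?thesis by (simp add: image_image)
    qed
    finally show "\<Union>(set (map pedges (map R Ps))) = E" .
  next
    fix i j assume ij: "i < length (map pedges (map R Ps))" "j < length (map pedges (map R Ps))" "i \<noteq> j"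
    then have len: "i < length Ps" "j < length Ps" by auto
    have "pedges (Ps ! i) \<inter> pedges (Ps ! j) = {}"
      using Ps(3) len ij(3) unfolding partitions_nth by simp
    then have "{e\<in>pedges (Ps ! i). e \<subseteq> {..<n}} \<inter> {e\<in>pedges (Ps ! j). e \<subseteq> {..<n}} = {}" by blast
    moreover have "inj_on (image h) (Pow {..<n})" using injh by (rule inj_on_image_Pow)
    ultimately have "image h ` {e\<in>pedges (Ps ! i). e \<subseteq> {..<n}} \<inter>
        image h ` {e\<in>pedges (Ps ! j). e \<subseteq> {..<n}} = {}"
      by (subst inj_on_image_Int[symmetric, of _ "Pow {..<n}"]) auto
    then show "map pedges (map R Ps) ! i \<inter> map pedges (map R Ps) ! j = {}"
      using R(2) len by simp
  qed
  \<comment> \<open>Since \<open>la H\<close> may be smaller than \<open>la_max d\<close>, empty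
    systems fill the list up to the exact length.\<close>
  have pad: "partitions E (map pedges (map R Ps @ replicate m {}))" for m
  proof -
    have "count_if (\<lambda>D. e \<in> D) (map pedges (replicate m {})) = 0" for e :: "'v set"
      by (induction m) auto
    then show ?thesis using part by (simp add: partitions_def)
  qed
  show thesis
  proof (rule that[of "map R Ps @ replicate (la_max d - la H) {}"])
    show "2 \<le> la_max d" using la \<open>2 \<le> la H\<close> by simp
    show "length (map R Ps @ replicate (la_max d - la H) {}) = la_max d" using la Ps(1) by simp
    show "\<forall>P\<in>set (map R Ps @ replicate (la_max d - la H) {}). psys P" using R(1) by auto
  qed (rule pad)
qed

section \<open>Path odd-covers\<close>

text \<open>Handshaking, in incremental form: a new edge toggles the parity of exactly two
  vertices.\<close>

lemma even_card_odd_degree: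
  assumes "finite V" "finite E" "\<forall>e\<in>E. card e = 2 \<and> e \<subseteq> V"
  shows "even (card {v\<in>V. odd (edeg E v)})"
  using assms(2,3)
proof (induction E)
  case (insert e E)
  have e: "even (card {v\<in>V. v \<in> e})"
  proof -
    have "{v\<in>V. v \<in> e} = e" using insert.prems by auto
    then show ?thesis using insert.prems by simp
  qed
  have IH: "even (card {v\<in>V. odd (edeg E v)})" using insert.IH insert.prems by blast
  show ?case
    by (rule even_card_toggle[OF assms(1) IH e]) (simp add: edeg_insert insert.hyps)
qed simp

text \<open>The ends of a path system are its vertices of odd degree, and degrees add up over the
  classes.\<close>

lemma odd_edeg_partition:
  assumes "finite E" "partitions E (map pedges Ps)" "\<forall>P\<in>set Ps. psys P"
  shows "odd (edeg E v) \<longleftrightarrow> odd (count_if (\<lambda>P. v \<in> pends P) Ps)"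
proof -
  have "\<forall>P\<in>set Ps. psys P \<Longrightarrow>
    odd (\<Sum>D\<leftarrow>map pedges Ps. edeg D v) \<longleftrightarrow> odd (count_if (\<lambda>P. v \<in> pends P) Ps)"
  proof (induction Ps)
    case (Cons P Ps)
    then show ?case using odd_edeg_psys[of P v] by auto
  qed simp
  then show ?thesis using edeg_partition[OF assms(1,2)] assms(3) by simp
qed

lemma paths_from_decomposition:
  fixes cs :: "'v colour list"
  assumes E: "finite E" and good: "\<And>c. c \<in> set cs \<Longrightarrow> good c"
    and part: "partitions E (map pedges (map fst cs))"
    and tg: "\<And>v. odd (count_if (\<lambda>c. v \<in> targets c) cs) \<longleftrightarrow> odd (edeg E v)"
    and tZ: "\<And>c. c \<in> set cs \<Longrightarrow> targets c \<subseteq> \<Union>E \<union> Z" and Z: "infinite Z"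
  obtains ps where "length ps = length cs"
    "\<And>p. p \<in> set ps \<Longrightarrow> p \<noteq> [] \<and> distinct p \<and> set p \<subseteq> \<Union>E \<union> Z"
    "\<And>e. odd (count_if (\<lambda>p. e \<in> path_edges p) ps) \<longleftrightarrow> e \<in> E"
proof -
  have ps: "psys (fst c)" if "c \<in> set cs" for c
    using good[OF that] by (auto simp: good_def split: prod.splits)
  have cm: "count_if Q (map f cs) = count_if (\<lambda>c. Q (f c)) cs" for Q and f :: "'v colour \<Rightarrow> 'b"
    by (simp add: filter_map comp_def)
  have "even (count_if (\<lambda>c. v \<in> pends (fst c)) cs) \<longleftrightarrow> even (count_if (\<lambda>c. v \<in> targets c) cs)" for v
    using odd_edeg_partition[OF E part, of v] ps tg[of v] unfolding cm by simp
  from paths_from_colours[OF good this Z] obtain ps where P: "length ps = length cs"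
    "\<forall>p\<in>set ps. p \<noteq> [] \<and> distinct p \<and>
       set p \<subseteq> (\<Union>c\<in>set cs. pverts (fst c) \<union> targets c) \<union> Z"
    "\<forall>e. even (count_if (\<lambda>p. e \<in> path_edges p) ps) \<longleftrightarrow>
       even (count_if (\<lambda>c. e \<in> pedges (fst c)) cs)" by blast
  have "pverts (fst c) \<subseteq> \<Union>E" if "c \<in> set cs" for c
  proof -
    have "pedges (fst c) \<subseteq> E" using partitions_Union[OF part] that by auto
    then show ?thesis using pverts_pedges[OF ps[OF that]] by auto
  qed
  then have sub: "(\<Union>c\<in>set cs. pverts (fst c) \<union> targets c) \<union> Z \<subseteq> \<Union>E \<union> Z" using tZ by blast
  have cnt: "count_if (\<lambda>c. e \<in> pedges (fst c)) cs = (if e \<in> E then 1 else 0)" for e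
    using part unfolding partitions_def map_map cm comp_def by blast
  show thesis
  proof (rule that[of ps])
    show "p \<noteq> [] \<and> distinct p \<and> set p \<subseteq> \<Union>E \<union> Z" if "p \<in> set ps" for p
      using P(2) that sub by blast
    show "odd (count_if (\<lambda>p. e \<in> path_edges p) ps) \<longleftrightarrow> e \<in> E" for e
    proof -
      have "even (count_if (\<lambda>p. e \<in> path_edges p) ps) \<longleftrightarrow>
        even (count_if (\<lambda>c. e \<in> pedges (fst c)) cs)" using P(3) by blast
      then show ?thesis unfolding cnt by simp
    qed
  qed (rule P(1))
qed

lemma two_factor_set:
  assumes E: "finite E" "\<forall>e\<in>E. card e = 2" and "partitions E Ds"
    and "\<And>D v. D \<in> set Ds \<Longrightarrow> edeg D v \<le> 2"
  shows "\<And>D. D \<in> set Ds \<Longrightarrow> finite D \<and> (\<forall>e\<in>D. card e = 2) \<and> (\<forall>v. edeg D v \<le> 2)"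
proof -
  fix D assume D: "D \<in> set Ds"
  then have "D \<subseteq> E" using partitions_Union[OF assms(3)] by blast
  then show "finite D \<and> (\<forall>e\<in>D. card e = 2) \<and> (\<forall>v. edeg D v \<le> 2)"
    using E assms(4)[OF D] finite_subset by blast
qed

lemma odd_degree_subset: "{v. odd (edeg E v)} \<subseteq> \<Union>E"
proof
  fix v assume "v \<in> {v. odd (edeg E v)}"
  then show "v \<in> \<Union>E" using edeg_eq_0[of v E] by (cases "v \<in> \<Union>E") simp_all
qed

text \<open>From \<open>2 * s \<le> q\<close> there are four odd vertices for each of the
  \<open>s\<close> two-factors. The other \<open>q - 2 * s\<close> pairs go to empty systems, so
  there is one path per pair.\<close>

theorem odd_cover_small_degree:
  assumes E: "finite E" "\<forall>e\<in>E. card e = 2" and deg: "\<And>v. edeg E v \<le> 2 * s"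
    and X: "finite {v. odd (edeg E v)}" "card {v. odd (edeg E v)} = 2 * q"
    and sq: "2 * s \<le> q" and Z: "infinite Z"
  obtains ps where "length ps = q"
    "\<And>p. p \<in> set ps \<Longrightarrow> p \<noteq> [] \<and> distinct p \<and> set p \<subseteq> \<Union>E \<union> Z"
    "\<And>e. odd (count_if (\<lambda>p. e \<in> path_edges p) ps) \<longleftrightarrow> e \<in> E"
proof -
  obtain Ds where Ds: "length Ds = s" "partitions E Ds" "\<And>D v. D \<in> set Ds \<Longrightarrow> edeg D v \<le> 2"
    using two_factor_list[OF E deg] by blast
  have len: "2 * length Ds \<le> q + 1" using Ds(1) sq by simp
  obtain cs where cs: "length cs = max (2 * length Ds) q"
    "\<forall>c\<in>set cs. good c \<and> targets c \<subseteq> {v. odd (edeg E v)} \<union> Z"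
    "\<forall>e. count_if (\<lambda>c. e \<in> pedges (fst c)) cs = count_if (\<lambda>D. e \<in> D) Ds"
    "\<forall>v. odd (count_if (\<lambda>c. v \<in> targets c) cs) \<longleftrightarrow> v \<in> {v. odd (edeg E v)}"
    using grouped_colours[OF two_factor_set[OF E Ds(2,3)] X len Z] by blast
  have part: "partitions E (map pedges (map fst cs))"
    using cs(3) Ds(2) by (simp add: partitions_def filter_map comp_def)
  have tg: "targets c \<subseteq> \<Union>E \<union> Z" if c: "c \<in> set cs" for c
  proof -
    have "targets c \<subseteq> {v. odd (edeg E v)} \<union> Z" using cs(2) c by blast
    also have "\<dots> \<subseteq> \<Union>E \<union> Z" using odd_degree_subset by (rule Un_mono) simp
    finally show ?thesis .
  qed
  have g: "good c" if "c \<in> set cs" for c using cs(2) that by blast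
  have par: "odd (count_if (\<lambda>c. v \<in> targets c) cs) \<longleftrightarrow> odd (edeg E v)" for v
    using cs(4) by simp
  obtain ps where ps: "length ps = length cs"
    "\<And>p. p \<in> set ps \<Longrightarrow> p \<noteq> [] \<and> distinct p \<and> set p \<subseteq> \<Union>E \<union> Z"
    "\<And>e. odd (count_if (\<lambda>p. e \<in> path_edges p) ps) \<longleftrightarrow> e \<in> E"
    using paths_from_decomposition[OF E(1) g part par tg Z] by blast
  have "length ps = q" using ps(1) cs(1) Ds(1) sq by simp
  then show thesis using ps(2,3) by (rule that)
qed

lemma sum_list_le_const: "(\<And>x. x \<in> set xs \<Longrightarrow> f x \<le> k) \<Longrightarrow> (\<Sum>x\<leftarrow>xs. f x) \<le> k * length xs"
  for f :: "'b \<Rightarrow> nat"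
  by (induction xs) (auto simp: add_mono)

text \<open>The bounds make \<open>p\<close> half of \<open>q\<close>, rounded up, so
  \<open>p\<close> two-factors use up all odd vertices and yield \<open>2 * p\<close> forests.
  Another \<open>t - p\<close> are split with fresh ends, and the remaining \<open>s - t\<close> are
  merged into a graph of maximum degree at most \<open>2 * (s - t)\<close>, which is decomposed
  afresh.\<close>

theorem odd_cover_large_degree:
  assumes E: "finite E" "\<forall>e\<in>E. card e = 2" and deg: "\<And>v. edeg E v \<le> 2 * s"
    and X: "finite {v. odd (edeg E v)}" "card {v. odd (edeg E v)} = 2 * q"
    and p: "q \<le> 2 * p" "2 * p \<le> q + 1" "p \<le> t" "t \<le> s" and Z: "infinite Z"
  obtains ps where "length ps \<le> 2 * t + la_max (2 * (s - t))"
    "\<And>p. p \<in> set ps \<Longrightarrow> p \<noteq> [] \<and> distinct p \<and> set p \<subseteq> \<Union>E \<union> Z"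
    "\<And>e. odd (count_if (\<lambda>p. e \<in> path_edges p) ps) \<longleftrightarrow> e \<in> E"
proof -
  obtain Ds where Ds: "length Ds = s" "partitions E Ds" "\<And>D v. D \<in> set Ds \<Longrightarrow> edeg D v \<le> 2"
    using two_factor_list[OF E deg] by blast
  note tf = two_factor_set[OF E Ds(2,3)]
  define A where "A = take p Ds"
  define B where "B = take (t - p) (drop p Ds)"
  define C where "C = drop t Ds"
  have C: "C = drop (t - p) (drop p Ds)" using p(3) by (simp add: C_def)
  have ABC: "Ds = A @ B @ C" unfolding A_def B_def C by (simp only: append_take_drop_id)
  have len: "length A = p" "length B = t - p" "length C = s - t"
    using Ds(1) p by (auto simp: A_def B_def C_def)
  define EB where "EB = \<Union>(set B)"
  define EC where "EC = E - \<Union>(set A) - EB"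
  have parts: "partitions EB B" "partitions EC C"
    using Ds(2) unfolding ABC EC_def EB_def partitions_append by blast+
  have lenA: "2 * length A \<le> q + 1" using len(1) p(2) by simp
  have tfA: "finite D \<and> (\<forall>e\<in>D. card e = 2) \<and> (\<forall>v. edeg D v \<le> 2)" if "D \<in> set A" for D
    using tf[of D] that ABC by simp
  have tfB: "finite D \<and> (\<forall>e\<in>D. card e = 2) \<and> (\<forall>v. edeg D v \<le> 2)" if "D \<in> set B" for D
    using tf[of D] that ABC by simp
  obtain cs where cs: "length cs = max (2 * length A) q"
    "\<forall>c\<in>set cs. good c \<and> targets c \<subseteq> {v. odd (edeg E v)} \<union> Z"
    "\<forall>e. count_if (\<lambda>c. e \<in> pedges (fst c)) cs = count_if (\<lambda>D. e \<in> D) A"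
    "\<forall>v. odd (count_if (\<lambda>c. v \<in> targets c) cs) \<longleftrightarrow> v \<in> {v. odd (edeg E v)}"
    using grouped_colours[OF tfA X lenA Z] by blast
  obtain PB where PB: "length PB = 2 * length B" "\<forall>P\<in>set PB. psys P" "partitions EB (map pedges PB)"
    using split_list_two_factors[OF tfB parts(1)] by blast
  \<comment> \<open>For \<open>s = t\<close> no edge remains and the empty list serves; otherwise
    there are at least two systems. As \<open>PB\<close> has even length, the fresh-ended systems
    together never number exactly one.\<close>
  obtain PC where PC: "length PC \<le> la_max (2 * (s - t))" "length PC \<noteq> 1" "\<forall>P\<in>set PC. psys P"
    "partitions EC (map pedges PC)"
  proof (cases "s = t")
    case True
    then have "C = []" using len(3) by simp
    then have "partitions EC (map pedges [])" using parts(2) by simp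
    then show thesis using that[of "[]"] by simp
  next
    case False
    have fEC: "finite EC" "\<forall>e\<in>EC. card e = 2" using E by (auto simp: EC_def)
    have d: "2 \<le> 2 * (s - t)" using False p(4) by simp
    have "edeg EC v \<le> 2 * (s - t)" for v
    proof -
      have "D \<in> set C \<Longrightarrow> edeg D v \<le> 2" for D using Ds(3) ABC by simp
      then have "(\<Sum>D\<leftarrow>C. edeg D v) \<le> 2 * length C" by (rule sum_list_le_const)
      then show ?thesis using edeg_partition[OF fEC(1) parts(2)] len(3) by simp
    qed
    from la_max_decomposition[OF fEC this d] obtain PC where "length PC = la_max (2 * (s - t))"
      "2 \<le> la_max (2 * (s - t))" "\<forall>P\<in>set PC. psys P" "partitions EC (map pedges PC)" by blast
    then show thesis using that[of PC] by simp
  qed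
  have psBC: "psys P" if "P \<in> set (PB @ PC)" for P using that PB(2) PC(3) by auto
  have "length (PB @ PC) \<noteq> 1" using PB(1) PC(2) by simp presburger
  then obtain ds where ds: "map fst ds = PB @ PC" "\<forall>c\<in>set ds. good c \<and> targets c \<subseteq> Z"
    "\<forall>v. even (count_if (\<lambda>c. v \<in> targets c) ds)"
    using free_colours[OF psBC _ Z] by blast
  have part: "partitions E (map pedges (map fst (cs @ ds)))"
    unfolding partitions_def
  proof
    fix e
    have "count_if (\<lambda>D. e \<in> D) (map pedges (map fst cs)) = count_if (\<lambda>D. e \<in> D) A"
      using cs(3) by (simp add: filter_map comp_def)
    moreover have "count_if (\<lambda>D. e \<in> D) (map pedges PB) = count_if (\<lambda>D. e \<in> D) B"
      using PB(3) parts(1) by (simp only: partitions_def)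
    moreover have "count_if (\<lambda>D. e \<in> D) (map pedges PC) = count_if (\<lambda>D. e \<in> D) C"
      using PC(4) parts(2) by (simp only: partitions_def)
    moreover have "map pedges (map fst (cs @ ds)) =
      map pedges (map fst cs) @ map pedges PB @ map pedges PC"
      using ds(1) by (metis map_append append_assoc)
    ultimately have "count_if (\<lambda>D. e \<in> D) (map pedges (map fst (cs @ ds))) = count_if (\<lambda>D. e \<in> D) Ds"
      unfolding ABC by simp
    then show "count_if (\<lambda>D. e \<in> D) (map pedges (map fst (cs @ ds))) = (if e \<in> E then 1 else 0)"
      using Ds(2) by (simp only: partitions_def)
  qed
  have tg: "targets c \<subseteq> \<Union>E \<union> Z" if c: "c \<in> set (cs @ ds)" for c
  proof -
    have "targets c \<subseteq> {v. odd (edeg E v)} \<union> Z" using cs(2) ds(2) c by auto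
    also have "\<dots> \<subseteq> \<Union>E \<union> Z" using odd_degree_subset by (rule Un_mono) simp
    finally show ?thesis .
  qed
  have g: "good c" if "c \<in> set (cs @ ds)" for c using cs(2) ds(2) that by auto
  have par: "odd (count_if (\<lambda>c. v \<in> targets c) (cs @ ds)) \<longleftrightarrow> odd (edeg E v)" for v
    using cs(4) ds(3) by simp
  have "length (cs @ ds) = length cs + length (map fst ds)" by simp
  also have "\<dots> \<le> 2 * t + la_max (2 * (s - t))"
    unfolding ds(1) using cs(1) PB(1) PC(1) len p by simp
  finally have L: "length (cs @ ds) \<le> 2 * t + la_max (2 * (s - t))" .
  obtain ps where ps: "length ps = length (cs @ ds)"
    "\<And>p. p \<in> set ps \<Longrightarrow> p \<noteq> [] \<and> distinct p \<and> set p \<subseteq> \<Union>E \<union> Z"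
    "\<And>e. odd (count_if (\<lambda>p. e \<in> path_edges p) ps) \<longleftrightarrow> e \<in> E"
    using paths_from_decomposition[OF E(1) g part par tg Z] by blast
  have "length ps \<le> 2 * t + la_max (2 * (s - t))" using ps(1) L by simp
  then show thesis using ps(2,3) by (rule that)
qed

lemma foldr_sym_diff:
  "e \<in> foldr sym_diff (map f ps) {} \<longleftrightarrow> odd (count_if (\<lambda>p. e \<in> f p) ps)"
  by (induction ps) auto

lemma p2_iso_le:
  fixes G :: "'a ugraph" and ps :: "('a + nat) list list"
  assumes ps: "\<And>p. p \<in> set ps \<Longrightarrow> p \<noteq> [] \<and> distinct p \<and> set p \<subseteq> Inl ` verts G \<union> range Inr"
    and cover: "\<And>e. odd (count_if (\<lambda>p. e \<in> path_edges p) ps) \<longleftrightarrow> e \<in> image Inl ` edges G"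
  shows "p2_iso G \<le> length ps"
proof -
  have "finite (Inr -` (\<Union>p\<in>set ps. set p))" by (intro finite_vimageI) (auto simp: inj_on_def)
  \<comment> \<open>The paths visit only finitely many new vertices, so finitely many isolated
    vertices suffice although \<open>Z\<close> is infinite.\<close>
  then obtain m where m: "Inr -` (\<Union>p\<in>set ps. set p) \<subseteq> {..<m :: nat}"
    unfolding finite_nat_set_iff_bounded by blast
  have "set p \<subseteq> Inl ` verts G \<union> Inr ` {..<m}" if p: "p \<in> set ps" for p
  proof
    fix v assume v: "v \<in> set p"
    then consider "v \<in> Inl ` verts G" | k where "v = Inr k" using ps[OF p] by blast
    then show "v \<in> Inl ` verts G \<union> Inr ` {..<m}"
    proof cases
      case 2
      then have "k \<in> {..<m}" using v p m by blast
      then show ?thesis using 2 by simp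
    qed simp
  qed
  moreover have "foldr sym_diff (map path_edges ps) {} = image Inl ` edges G"
    using foldr_sym_diff[of _ path_edges ps] cover by blast
  ultimately have "path_odd_cover (add_isolated m G) ps"
    using ps by (auto simp: path_odd_cover_def path_on_def add_isolated_def)
  then have "p2 (add_isolated m G) \<le> length ps"
    unfolding p2_def by (intro Least_le) blast
  moreover have "p2_iso G \<le> p2 (add_isolated m G)"
    unfolding p2_iso_def by (intro Least_le) blast
  ultimately show ?thesis by simp
qed

theorem theorem2p2:
  fixes G :: "'a ugraph" and t d :: int
  assumes "simple_graph G"
    and "t = (if v_odd G = 4 \<and> max_degree G \<ge> 3 then 2 else \<lceil>real (v_odd G) / 4\<rceil>)"
    and "d = 2 * \<lceil>real (max_degree G) / 2\<rceil> - 2 * t"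
  shows "real (p2_iso G) \<le>
    (if d \<ge> 0 then 2 * real_of_int t + real (la_max (nat d)) else real (v_odd G) / 2)"
proof -
  let ?\<Delta> = "max_degree G"
  define E :: "('a + nat) set set" where "E = image Inl ` edges G"
  have finE: "finite (edges G)" by (rule finite_edges[OF assms(1)])
  have edge: "card e = 2" "e \<subseteq> verts G" if "e \<in> edges G" for e
    using assms(1) that by (auto simp: simple_graph_def)
  have E: "finite E" "\<forall>e\<in>E. card e = 2"
    using finE edge by (auto simp: E_def card_image)
  have degL: "edeg E (Inl v) = edeg (edges G) v" for v
  proof (cases "v \<in> \<Union>(edges G)")
    case True
    then show ?thesis unfolding E_def by (intro edeg_image) auto
  next
    case False
    then have "Inl v \<notin> \<Union>E" by (auto simp: E_def)
    then show ?thesis using False by (simp add: edeg_eq_0)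
  qed
  have degR: "edeg E (Inr k) = 0" for k by (rule edeg_eq_0) (auto simp: E_def)
  have X: "{v. odd (edeg E v)} = Inl ` {v\<in>verts G. odd (degree G v)}"
  proof -
    have "v \<in> verts G" if "odd (edeg (edges G) v)" for v
      using subsetD[OF odd_degree_subset, of v "edges G"] that edge(2) by blast
    moreover have "v \<in> Inl ` {v\<in>verts G. odd (degree G v)}" if "odd (edeg E v)" for v
      using that calculation degL degR by (cases v) (auto simp: degree_edeg)
    ultimately show ?thesis using degL by (auto simp: degree_edeg)
  qed
  have finV: "finite (verts G)" using assms(1) by (simp add: simple_graph_def)
  have finX: "finite {v. odd (edeg E v)}" unfolding X using finV by simp
  have cardX: "card {v. odd (edeg E v)} = v_odd G"
    unfolding X v_odd_def by (simp add: card_image)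
  have "even (v_odd G)"
    unfolding v_odd_def degree_edeg
    using even_card_odd_degree[OF finV finE] edge by blast
  then obtain q where q: "v_odd G = 2 * q" by blast
  define s where "s = (?\<Delta> + 1) div 2"
  have deg: "edeg E v \<le> 2 * s" for v
  proof -
    have "?\<Delta> \<le> 2 * s" by (simp add: s_def)
    moreover have "edeg E v \<le> ?\<Delta>"
      using edeg_le_max_degree[OF assms(1)] degL degR by (cases v) auto
    ultimately show ?thesis by simp
  qed
  have ceil2: "\<lceil>real n / 2\<rceil> = int ((n + 1) div 2)" for n :: nat
    by (rule ceiling_unique) (cases "even n"; force elim!: evenE oddE)+
  have s: "\<lceil>real ?\<Delta> / 2\<rceil> = int s" unfolding s_def by (rule ceil2)
  define p where "p = (q + 1) div 2"
  have "\<lceil>real (v_odd G) / 4\<rceil> = int p" unfolding q p_def using ceil2[of q] by simp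
  \<comment> \<open>\<open>q = 2\<close> means four odd vertices. There \<open>p = 1\<close> while
    \<open>r = 2\<close>, so one of the first \<open>r\<close> two-factors is split with fresh
    ends.\<close>
  define r where "r = (if q = 2 \<and> ?\<Delta> \<ge> 3 then 2 else p)"
  have t: "t = int r"
    using assms(2) \<open>\<lceil>real (v_odd G) / 4\<rceil> = int p\<close> q by (auto simp: r_def)
  have d: "d = 2 * int s - 2 * int r" using assms(3) s t by simp
  have pq: "q \<le> 2 * p" "2 * p \<le> q + 1" "p \<le> r" by (auto simp: p_def r_def)
  have inf: "infinite (range Inr :: ('a + nat) set)"
    using finite_imageD[of "Inr :: nat \<Rightarrow> 'a + nat" UNIV] by (auto simp: inj_on_def)
  have UE: "\<Union>E \<subseteq> Inl ` verts G" using edge(2) by (auto simp: E_def)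
  have X2: "card {v. odd (edeg E v)} = 2 * q" using cardX q by simp
  have le: "p2_iso G \<le> length ps"
    if ps: "\<And>p. p \<in> set ps \<Longrightarrow> p \<noteq> [] \<and> distinct p \<and> set p \<subseteq> \<Union>E \<union> range Inr"
      and cover: "\<And>e. odd (count_if (\<lambda>p. e \<in> path_edges p) ps) \<longleftrightarrow> e \<in> E" for ps
  proof (rule p2_iso_le)
    show "p \<noteq> [] \<and> distinct p \<and> set p \<subseteq> Inl ` verts G \<union> range Inr" if "p \<in> set ps" for p
      using ps[OF that] UE by blast
    show "odd (count_if (\<lambda>p. e \<in> path_edges p) ps) \<longleftrightarrow> e \<in> image Inl ` edges G" for e
      unfolding E_def[symmetric] by (rule cover)
  qed
  show ?thesis
  proof (cases "d \<ge> 0")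
    case True
    then have rs: "r \<le> s" using d by simp
    obtain ps where ps: "length ps \<le> 2 * r + la_max (2 * (s - r))"
      "\<And>p. p \<in> set ps \<Longrightarrow> p \<noteq> [] \<and> distinct p \<and> set p \<subseteq> \<Union>E \<union> range Inr"
      "\<And>e. odd (count_if (\<lambda>p. e \<in> path_edges p) ps) \<longleftrightarrow> e \<in> E"
      using odd_cover_large_degree[OF E deg finX X2 pq rs inf] by blast
    have "p2_iso G \<le> length ps" using ps(2,3) by (rule le)
    moreover have "nat d = 2 * (s - r)" using d rs by simp
    ultimately have "real (p2_iso G) \<le> real (2 * r + la_max (nat d))" using ps(1) by simp
    then show ?thesis using True t by simp
  next
    case False
    then have rs: "s < r" using d by simp
    \<comment> \<open>The exceptional value \<open>r = 2\<close> comes with maximum degree at least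
      3, hence \<open>s \<ge> 2\<close>, which contradicts \<open>s < r\<close>. With
      \<open>r = p\<close> the bound \<open>2 * p \<le> q + 1\<close> then gives
      \<open>2 * s \<le> q\<close>.\<close>
    have "r = p"
    proof (rule ccontr)
      assume "r \<noteq> p"
      then have "r = 2" "?\<Delta> \<ge> 3" by (auto simp: r_def split: if_splits)
      then show False using rs by (simp add: s_def)
    qed
    then have sq: "2 * s \<le> q" using rs pq by simp
    obtain ps where ps: "length ps = q"
      "\<And>p. p \<in> set ps \<Longrightarrow> p \<noteq> [] \<and> distinct p \<and> set p \<subseteq> \<Union>E \<union> range Inr"
      "\<And>e. odd (count_if (\<lambda>p. e \<in> path_edges p) ps) \<longleftrightarrow> e \<in> E"
      using odd_cover_small_degree[OF E deg finX X2 sq inf] by blast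
    have "p2_iso G \<le> length ps" using ps(2,3) by (rule le)
    then show ?thesis using False ps(1) q by simp
  qed
qed

end
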